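(* Let $n\ge2$ and let $w\in S_{n-1}$ be a permutation. Let $e_1,\dots,e_n$ be the standard basis of $\mathbb{C}^n$, let $H_i=\langle e_1,\dots,\widehat{e_i},\dots,e_n\rangle$, and for $S\subset\{1,\dots,n\}$ let $H_S=\bigcap_{i\in S}H_i$; write $[a,b]=\{a,a+1,\dots,b\}$. Let $F$ be the flag $$(0\subset H_{[1,n-1]}\subset H_{[1,n-2]}\subset\cdots\subset H_1\subset\mathbb{C}^n)$$ and let $F'$ be the transverse flag $$(0\subset H_{[2,n]}\subset H_{[3,n]}\subset\cdots\subset H_n\subset\mathbb{C}^n).$$ Then the torus orbit closure $Z_w\subset\mathrm{Fl}(n)$ is equal, as a scheme, to the Richardson variety $\Sigma^F_{\iota(w)}\cap\Sigma^{F'}_{\overline{\iota}(w_0w)}$.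
   Context: $\mathrm{Fl}(n)$ is the variety of complete flags $\mathcal{L}=(0\subset L_1\subset\cdots\subset L_{n-1}\subset\mathbb{C}^n)$, with the action of $T=(\mathbb{C}^* )^n$ induced by scaling coordinates of $\mathbb{C}^n$. A nonsingular $n\times n$ matrix $A$ determines the flag $\mathcal{L}(A)$ with $L_i$ the span of the first $i$ columns of $A$ (rows correspond to $e_1,\dots,e_n$). **The orbit closure $Z_w$.** For $w\in S_{n-1}$, the $n\times n$ matrix $A_w$ is defined as follows. For $i=1,2,\dots,n-1$ in order: place the symbol $\star_2$ in row $i$ and column $w^{-1}(i)+1$; place the symbol $\star_1$ in row $i$ and in the right-most column that lies to the left of column $w^{-1}(i)+1$ and does not contain a symbol $\star_2$ in any row above row $i$. Then place $\star_2$ in row $n$ and column $1$. All other entries are $0$. Finally, replace all symbols $\star_1,\star_2$ by generic (in particular nonzero) complex numbers. The matrix $A_w$ is nonsingular; $\mathcal{L}_w=\mathcal{L}(A_w)$ and $Z_w=\overline{T\cdot\mathcal{L}_w}\subset\mathrm{Fl}(n)$. **Schubert varieties.** For a complete flag $F=(0\subset F_1\subset\cdots\subset F_{n-1}\subset\mathbb{C}^n)$ and $v\in S_n$, the Schubert variety $\Sigma^F_v\subset\mathrm{Fl}(n)$ is the locus of flags $\mathcal{L}$ with $\dim(L_i\cap F_{n-j})\ge\#(\{v(1),\dots,v(i)\}\cap\{j+1,\dots,n\})$ for all $i,j$. For transverse flags $F,F'$ (meaning $\dim(F_j\cap F'_k)=\max(0,j+k-n)$ for all $j,k$), $\Sigma^F_v\cap\Sigma^{F'}_{v'}$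 is called a Richardson variety. **Permutations.** $\iota:S_{n-1}\to S_n$ sends $w$ to the permutation with $\iota(w)(n)=n$ and $\iota(w)(i)=w(i)$ for $i\le n-1$. $\overline{\iota}:S_{n-1}\to S_n$ sends $w$ to the permutation with $\overline{\iota}(w)(1)=1$ and $\overline{\iota}(w)(i)=w(i-1)+1$ for $2\le i\le n$. $w_0\in S_{n-1}$ is the longest permutation, $w_0(i)=n-i$. *)

theory Defs
  imports
    "HOL-Analysis.Function_Topology"
    "HOL-Combinatorics.Permutations"
    "Jordan_Normal_Form.DL_Rank"
begin

section \<open>Flags in complex n-space\<close>

text \<open>Vectors and matrices of the library are indexed from \<open>0\<close>, so that the standard basis vector
  \<open>e_i\<close> is \<open>unit_vec n (i - 1)\<close>.\<close>

abbreviation cspace :: "nat \<Rightarrow> (complex, complex vec) module"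
  where "cspace n \<equiv> module_vec TYPE(complex) n"

abbreviation cspan :: "nat \<Rightarrow> complex vec set \<Rightarrow> complex vec set"
  where "cspan n \<equiv> LinearCombinations.module.span class_ring (cspace n)"

abbreviation csubspace :: "nat \<Rightarrow> complex vec set \<Rightarrow> bool"
  where "csubspace n W \<equiv> VectorSpace.subspace class_ring W (cspace n)"

abbreviation cdim :: "nat \<Rightarrow> complex vec set \<Rightarrow> nat"
  where "cdim n W \<equiv> vectorspace.dim class_ring ((cspace n)\<lparr>carrier := W\<rparr>)"

type_synonym flag = "nat \<Rightarrow> complex vec set"

text \<open>A flag is padded by \<open>L 0 = 0\<close> and by the whole space from position \<open>n\<close> on; thus a flag
  is determined by its proper steps and equality of flags is equality of functions.\<close>

definition Fl :: "nat \<Rightarrow> flag set" where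
  "Fl n = {L. L 0 = {0\<^sub>v n} \<and> (\<forall>i\<ge>n. L i = carrier_vec n) \<and>
              (\<forall>i\<le>n. csubspace n (L i) \<and> cdim n (L i) = i) \<and>
              (\<forall>i<n. L i \<subseteq> L (Suc i))}"

definition GL :: "nat \<Rightarrow> complex mat set" where
  "GL n = {A \<in> carrier_mat n n. invertible_mat A}"

definition flag_of :: "nat \<Rightarrow> complex mat \<Rightarrow> flag" where
  "flag_of n A = (\<lambda>i. cspan n (set (take i (cols A))))"


section \<open>The flag variety and its closed subschemes\<close>

inductive polynomial_fun :: "nat \<Rightarrow> (complex mat \<Rightarrow> complex) \<Rightarrow> bool" for n where
  const: "polynomial_fun n (\<lambda>A. c)"
| entry: "i < n \<Longrightarrow> j < n \<Longrightarrow> polynomial_fun n (\<lambda>A. A $$ (i, j))"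
| add: "polynomial_fun n p \<Longrightarrow> polynomial_fun n q \<Longrightarrow> polynomial_fun n (\<lambda>A. p A + q A)"
| mult: "polynomial_fun n p \<Longrightarrow> polynomial_fun n q \<Longrightarrow> polynomial_fun n (\<lambda>A. p A * q A)"

definition GL_zariski :: "nat \<Rightarrow> complex mat topology" where
  "GL_zariski n = topology_generated_by {{A \<in> GL n. p A \<noteq> 0} | p. polynomial_fun n p}"

definition GL_regular :: "nat \<Rightarrow> complex mat set \<Rightarrow> (complex mat \<Rightarrow> complex) \<Rightarrow> bool" where
  "GL_regular n V f \<longleftrightarrow>
     (\<forall>A\<in>V. \<exists>p q. polynomial_fun n p \<and> polynomial_fun n q \<and> q A \<noteq> 0 \<and>
        (\<forall>B\<in>V. q B \<noteq> 0 \<longrightarrow> f B = p B / q B))"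

text \<open>The variety structure on \<open>Fl n\<close> is that of the geometric quotient of \<open>GL n\<close> by the upper
  triangular matrices, with quotient map \<open>flag_of n\<close>: a set of flags is open iff its
  preimage is open, and a function is regular iff its pullback is regular.\<close>

definition Fl_zariski :: "nat \<Rightarrow> flag topology" where
  "Fl_zariski n =
     topology (\<lambda>U. U \<subseteq> Fl n \<and> openin (GL_zariski n) {A \<in> GL n. flag_of n A \<in> U})"

text \<open>Sections over \<open>U\<close> are represented by total functions whose values outside \<open>U\<close> are
  irrelevant.\<close>

definition regular_funs :: "nat \<Rightarrow> flag set \<Rightarrow> (flag \<Rightarrow> complex) set" where
  "regular_funs n U = {f. GL_regular n {A \<in> GL n. flag_of n A \<in> U} (\<lambda>A. f (flag_of n A))}"

text \<open>A closed subscheme of \<open>Fl n\<close> is represented by its ideal sheaf, the assignment to each open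
  \<open>U\<close> of an ideal of \<open>regular_funs n U\<close>. A closed subset, with its reduced structure, corresponds
  to the sheaf of all regular functions vanishing on it, and the scheme-theoretic intersection
  corresponds to the sum of ideal sheaves, i.e. the sheafification of the sectionwise sum.\<close>

type_synonym ideal_sheaf = "flag set \<Rightarrow> (flag \<Rightarrow> complex) set"

definition reduced_subscheme :: "nat \<Rightarrow> flag set \<Rightarrow> ideal_sheaf" where
  "reduced_subscheme n Z = (\<lambda>U. {f \<in> regular_funs n U. \<forall>L\<in>U \<inter> Z. f L = 0})"

definition scheme_inter :: "nat \<Rightarrow> ideal_sheaf \<Rightarrow> ideal_sheaf \<Rightarrow> ideal_sheaf" where
  "scheme_inter n I J = (\<lambda>U. {f \<in> regular_funs n U.
     \<forall>L\<in>U. \<exists>V. openin (Fl_zariski n) V \<and> L \<in> V \<and> V \<subseteq> U \<and>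
       (\<exists>g\<in>I V. \<exists>h\<in>J V. \<forall>M\<in>V. f M = g M + h M)})"

definition same_subscheme :: "nat \<Rightarrow> ideal_sheaf \<Rightarrow> ideal_sheaf \<Rightarrow> bool" where
  "same_subscheme n I J \<longleftrightarrow> (\<forall>U. openin (Fl_zariski n) U \<longrightarrow> I U = J U)"


section \<open>The orbit closure\<close>

text \<open>Rows and columns are numbered from \<open>1\<close> in the two position functions.\<close>

definition star2_col :: "nat \<Rightarrow> (nat \<Rightarrow> nat) \<Rightarrow> nat \<Rightarrow> nat" where
  "star2_col n w i = (if i = n then 1 else Hilbert_Choice.inv w i + 1)"

definition star1_col :: "nat \<Rightarrow> (nat \<Rightarrow> nat) \<Rightarrow> nat \<Rightarrow> nat" where
  "star1_col n w i =
     Max {c. 1 \<le> c \<and> c < star2_col n w i \<and> (\<forall>k\<in>{1..<i}. star2_col n w k \<noteq> c)}"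

text \<open>The numbers \<open>a i\<close> and \<open>b i\<close> replace the first and the second symbol in row \<open>i\<close>; row \<open>n\<close>
  contains only the second one. Genericity means that these numbers are nonzero: the entries
  occupied by symbols form a spanning tree of the bipartite graph on rows and columns, so rescaling
  rows (the torus) and columns (which fixes the flag) carries any nonzero choice to any other.\<close>

definition A_mat :: "nat \<Rightarrow> (nat \<Rightarrow> nat) \<Rightarrow> (nat \<Rightarrow> complex) \<Rightarrow> (nat \<Rightarrow> complex) \<Rightarrow> complex mat" where
  "A_mat n w a b = mat n n (\<lambda>(r, s). let i = r + 1; c = s + 1 in
     if c = star2_col n w i then b i
     else if i < n \<and> c = star1_col n w i then a i
     else 0)"

definition torus_act :: "nat \<Rightarrow> (nat \<Rightarrow> complex) \<Rightarrow> flag \<Rightarrow> flag" where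
  "torus_act n t L = (\<lambda>i. (\<lambda>x. mat_diag n t *\<^sub>v x) ` L i)"

definition torus_orbit :: "nat \<Rightarrow> flag \<Rightarrow> flag set" where
  "torus_orbit n L = {torus_act n t L | t. \<forall>i<n. t i \<noteq> 0}"

definition Z_orbit_closure ::
    "nat \<Rightarrow> (nat \<Rightarrow> nat) \<Rightarrow> (nat \<Rightarrow> complex) \<Rightarrow> (nat \<Rightarrow> complex) \<Rightarrow> flag set" where
  "Z_orbit_closure n w a b =
     Fl_zariski n closure_of torus_orbit n (flag_of n (A_mat n w a b))"


section \<open>Schubert and Richardson varieties\<close>

definition Schubert :: "nat \<Rightarrow> flag \<Rightarrow> (nat \<Rightarrow> nat) \<Rightarrow> flag set" where
  "Schubert n F v = {L \<in> Fl n. \<forall>i\<le>n. \<forall>j\<le>n.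
     cdim n (L i \<inter> F (n - j)) \<ge> card (v ` {1..i} \<inter> {j+1..n})}"

definition transverse :: "nat \<Rightarrow> flag \<Rightarrow> flag \<Rightarrow> bool" where
  "transverse n F F' \<longleftrightarrow> (\<forall>j\<le>n. \<forall>k\<le>n. cdim n (F j \<inter> F' k) = j + k - n)"

definition Richardson ::
    "nat \<Rightarrow> flag \<Rightarrow> (nat \<Rightarrow> nat) \<Rightarrow> flag \<Rightarrow> (nat \<Rightarrow> nat) \<Rightarrow> ideal_sheaf" where
  "Richardson n F v F' v' =
     scheme_inter n (reduced_subscheme n (Schubert n F v)) (reduced_subscheme n (Schubert n F' v'))"

definition iota :: "nat \<Rightarrow> (nat \<Rightarrow> nat) \<Rightarrow> nat \<Rightarrow> nat" where
  "iota n w = (\<lambda>i. if i = n then n else w i)"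

definition iota_bar :: "nat \<Rightarrow> (nat \<Rightarrow> nat) \<Rightarrow> nat \<Rightarrow> nat" where
  "iota_bar n w = (\<lambda>i. if i = 1 then 1 else if i \<in> {2..n} then w (i - 1) + 1 else i)"

definition w0 :: "nat \<Rightarrow> nat \<Rightarrow> nat" where
  "w0 n = (\<lambda>i. if i \<in> {1..n-1} then n - i else i)"

definition H :: "nat \<Rightarrow> nat \<Rightarrow> complex vec set" where
  "H n i = cspan n (unit_vec n ` {j. j < n \<and> j + 1 \<noteq> i})"

definition H_inter :: "nat \<Rightarrow> nat set \<Rightarrow> complex vec set" where
  "H_inter n S = carrier_vec n \<inter> (\<Inter>i\<in>S. H n i)"

definition F_flag :: "nat \<Rightarrow> flag" where
  "F_flag n = (\<lambda>j. H_inter n {1..n-j})"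

definition F'_flag :: "nat \<Rightarrow> flag" where
  "F'_flag n = (\<lambda>j. H_inter n {j+1..n})"


section \<open>Basic facts\<close>

lemma topspace_GL_zariski: "topspace (GL_zariski n) = GL n"
proof -
  have "GL n \<in> {{A \<in> GL n. p A \<noteq> 0} | p. polynomial_fun n p}"
    by (intro CollectI exI[of _ "\<lambda>A. 1"]) (simp add: polynomial_fun.const)
  moreover have "U \<subseteq> GL n" if "U \<in> {{A \<in> GL n. p A \<noteq> 0} | p. polynomial_fun n p}" for U
    using that by blast
  ultimately show ?thesis
    unfolding GL_zariski_def topology_generated_by_topspace
    by (intro equalityI Sup_least Union_upper)
qed

lemma openin_Fl_zariski:
  "openin (Fl_zariski n) U \<longleftrightarrow>
     U \<subseteq> Fl n \<and> openin (GL_zariski n) {A \<in> GL n. flag_of n A \<in> U}"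
proof -
  have "istopology (\<lambda>U. U \<subseteq> Fl n \<and> openin (GL_zariski n) {A \<in> GL n. flag_of n A \<in> U})"
    unfolding istopology_def
  proof (intro conjI allI impI)
    fix S T
    assume "S \<subseteq> Fl n \<and> openin (GL_zariski n) {A \<in> GL n. flag_of n A \<in> S}"
      and "T \<subseteq> Fl n \<and> openin (GL_zariski n) {A \<in> GL n. flag_of n A \<in> T}"
    moreover have "{A \<in> GL n. flag_of n A \<in> S \<inter> T} =
        {A \<in> GL n. flag_of n A \<in> S} \<inter> {A \<in> GL n. flag_of n A \<in> T}" by auto
    ultimately show "S \<inter> T \<subseteq> Fl n" "openin (GL_zariski n) {A \<in> GL n. flag_of n A \<in> S \<inter> T}"
      by (auto intro: openin_Int)
  next
    fix K :: "flag set set"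
    assume K: "\<forall>U\<in>K. U \<subseteq> Fl n \<and> openin (GL_zariski n) {A \<in> GL n. flag_of n A \<in> U}"
    then show "\<Union> K \<subseteq> Fl n" by auto
    have "{A \<in> GL n. flag_of n A \<in> \<Union> K} = \<Union> ((\<lambda>U. {A \<in> GL n. flag_of n A \<in> U}) ` K)" by auto
    then show "openin (GL_zariski n) {A \<in> GL n. flag_of n A \<in> \<Union> K}"
      using K by (auto intro!: openin_Union)
  qed
  then show ?thesis
    unfolding Fl_zariski_def by (simp add: topology_inverse')
qed

lemma unit_vec_eq_iff:
  assumes "i < n"
  shows "unit_vec n i = (unit_vec n j :: complex vec) \<longleftrightarrow> i = j"
proof
  assume "unit_vec n i = (unit_vec n j :: complex vec)"
  then have "unit_vec n i $ i = (unit_vec n j $ i :: complex)" by simp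
  then show "i = j" using assms by (simp add: unit_vec_def split: if_splits)
qed simp

context
  fixes n :: nat
begin

interpretation vec_space "TYPE(complex)" n .

lemma cspan_unit_vecs:
  assumes J: "J \<subseteq> {..<n}"
  shows "cspan n (unit_vec n ` J) = {v \<in> carrier_vec n. \<forall>i<n. i \<notin> J \<longrightarrow> v $ i = 0}"
proof -
  have fin: "finite (unit_vec n ` J :: complex vec set)"
    using J finite_subset by blast
  have car: "(unit_vec n ` J :: complex vec set) \<subseteq> carrier_vec n" by auto
  have inj: "inj_on (unit_vec n :: nat \<Rightarrow> complex vec) J"
    using J by (auto intro!: inj_onI simp: unit_vec_eq_iff subset_iff)
  have finJ: "finite J" using J finite_subset by blast
  have ix: "lincomb a (unit_vec n ` J) $ i = (if i \<in> J then a (unit_vec n i) else 0)"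
    if i: "i < n" for a :: "complex vec \<Rightarrow> complex" and i
  proof -
    have "lincomb a (unit_vec n ` J) $ i = (\<Sum>j\<in>J. a (unit_vec n j) * unit_vec n j $ i)"
      unfolding lincomb_index[OF i car] by (simp add: sum.reindex[OF inj])
    also have "\<dots> = (\<Sum>j\<in>J. if j = i then a (unit_vec n j) else 0)"
      using J i by (intro sum.cong refl) (auto simp: subset_iff)
    finally show ?thesis using finJ by simp
  qed
  show ?thesis
  proof (intro equalityI subsetI)
    fix v assume "v \<in> span (unit_vec n ` J)"
    then obtain a where "v = lincomb a (unit_vec n ` J)"
      unfolding finite_span[OF fin car] by auto
    then show "v \<in> {v \<in> carrier_vec n. \<forall>i<n. i \<notin> J \<longrightarrow> v $ i = 0}"
      using lincomb_closed[OF car] ix by auto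
  next
    fix v :: "complex vec" assume v: "v \<in> {v \<in> carrier_vec n. \<forall>i<n. i \<notin> J \<longrightarrow> v $ i = 0}"
    define a :: "complex vec \<Rightarrow> complex" where "a = (\<lambda>u. v $ (THE i. i < n \<and> u = unit_vec n i))"
    have a: "a (unit_vec n i) = v $ i" if "i < n" for i
      unfolding a_def using that by (intro arg_cong[of _ _ "($) v"] the_equality) (auto simp: unit_vec_eq_iff)
    have "lincomb a (unit_vec n ` J) = v"
    proof (rule eq_vecI)
      have "lincomb a (unit_vec n ` J) \<in> carrier_vec n" using lincomb_closed[OF car] by auto
      then show d: "dim_vec (lincomb a (unit_vec n ` J)) = dim_vec v" using v by auto
      fix i assume "i < dim_vec v"
      then have "i < n" using v by auto
      then show "lincomb a (unit_vec n ` J) $ i = v $ i" using ix a v by auto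
    qed
    then show "v \<in> span (unit_vec n ` J)"
      unfolding finite_span[OF fin car] by auto
  qed
qed

lemma csubspace_unit_vecs: "csubspace n (cspan n (unit_vec n ` J))"
proof -
  have "(unit_vec n ` J :: complex vec set) \<subseteq> carrier_vec n" by auto
  from span_is_submodule[OF this] show ?thesis
    by (simp add: VectorSpace.subspace_def vec_vs)
qed

lemma cdim_unit_vecs:
  assumes J: "J \<subseteq> {..<n}"
  shows "cdim n (cspan n (unit_vec n ` J)) = card J"
proof -
  have sub: "(unit_vec n ` J :: complex vec set) \<subseteq> set (unit_vecs n)"
    using J by (auto simp: unit_vecs_def)
  have li: "lin_indpt (unit_vec n ` J :: complex vec set)"
    using subset_li_is_li[OF _ sub] unit_vecs_basis by (auto simp: basis_def)
  have inj: "inj_on (unit_vec n :: nat \<Rightarrow> complex vec) J"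
    using J by (auto intro!: inj_onI simp: unit_vec_eq_iff subset_iff)
  have "maximal (unit_vec n ` J) (\<lambda>T. T \<subseteq> unit_vec n ` J \<and> lin_indpt T)"
    using li by (auto simp: maximal_def)
  moreover have "finite (unit_vec n ` J :: complex vec set)"
    using J finite_subset by blast
  ultimately have "cdim n (cspan n (unit_vec n ` J)) = card (unit_vec n ` J :: complex vec set)"
    by (intro dim_span) auto
  then show ?thesis by (simp add: card_image[OF inj])
qed

end

lemma H_inter_eq:
  assumes "S \<subseteq> {1..n}"
  shows "H_inter n S = cspan n (unit_vec n ` {j. j < n \<and> j + 1 \<notin> S})"
proof -
  have 1: "H n i = {v \<in> carrier_vec n. \<forall>j<n. j + 1 = i \<longrightarrow> v $ j = 0}" for i
    unfolding H_def by (subst cspan_unit_vecs) auto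
  show ?thesis
    unfolding H_inter_def 1 by (subst cspan_unit_vecs) auto
qed

lemma F_flag_in_Fl: "F_flag n \<in> Fl n"
  and F'_flag_in_Fl: "F'_flag n \<in> Fl n"
proof -
  have F: "F_flag n i = cspan n (unit_vec n ` {j. j < n \<and> n - i \<le> j})" for i
    unfolding F_flag_def by (subst H_inter_eq) (auto intro!: arg_cong[where f = "cspan n"])
  have F': "F'_flag n i = cspan n (unit_vec n ` {j. j < n \<and> j < i})" for i
    unfolding F'_flag_def by (subst H_inter_eq) (auto intro!: arg_cong[where f = "cspan n"])
  have c: "card {j. j < n \<and> n - i \<le> j} = i" if "i \<le> n" for i
  proof -
    have "{j. j < n \<and> n - i \<le> j} = {n-i..<n}" by auto
    then show ?thesis using that by simp
  qed
  have c': "card {j. j < n \<and> j < i} = i" if "i \<le> n" for i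
  proof -
    have "{j. j < n \<and> j < i} = {..<i}" using that by auto
    then show ?thesis by simp
  qed
  have z: "{v \<in> carrier_vec n. \<forall>i<n. v $ i = 0} = {0\<^sub>v n :: complex vec}"
    by (auto intro!: eq_vecI)
  show "F_flag n \<in> Fl n"
    unfolding Fl_def F
    apply (intro CollectI conjI allI impI csubspace_unit_vecs)
    subgoal by (subst cspan_unit_vecs) (auto simp flip: z)
    subgoal by (subst cspan_unit_vecs) auto
    subgoal by (subst cdim_unit_vecs) (auto simp: c)
    subgoal by (subst (1 2) cspan_unit_vecs) (auto intro!: Collect_mono)
    done
  show "F'_flag n \<in> Fl n"
    unfolding Fl_def F'
    apply (intro CollectI conjI allI impI csubspace_unit_vecs)
    subgoal by (subst cspan_unit_vecs) (auto simp flip: z)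
    subgoal by (subst cspan_unit_vecs) auto
    subgoal by (subst cdim_unit_vecs) (auto simp: c')
    subgoal by (subst (1 2) cspan_unit_vecs) (auto intro!: Collect_mono)
    done
qed

lemma transverse_F_F': "transverse n (F_flag n) (F'_flag n)"
  unfolding transverse_def
proof (intro allI impI)
  fix j k assume jk: "j \<le> n" "k \<le> n"
  have "F_flag n j \<inter> F'_flag n k = H_inter n ({1..n-j} \<union> {k+1..n})"
    unfolding F_flag_def F'_flag_def H_inter_def by auto
  also have "\<dots> = cspan n (unit_vec n ` {n-j..<k})"
    using jk by (subst H_inter_eq) (auto intro!: arg_cong[where f = "\<lambda>J. cspan n (unit_vec n ` J)"])
  finally have "cdim n (F_flag n j \<inter> F'_flag n k) = card {n-j..<k}"
    using jk by (simp add: cdim_unit_vecs subset_iff)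
  then show "cdim n (F_flag n j \<inter> F'_flag n k) = j + k - n" using jk by simp
qed

end

theory Submission
  imports Defs
begin

text \<open>Two facts are combined. First, the intersection of two opposite Schubert varieties is reduced:
  near a point, multiplication by triangular matrices (an LU factorization of \<open>M * M'\<^sup>-\<^sup>1\<close>) turns
  the intersection of the matrix Schubert varieties into the diagonal part of their product, and the
  ideal of a product of varieties is the sum of the two ideals. Second, the torus orbit is dense in
  the Richardson variety. Let \<open>p\<close> be the position of the value 1 in \<open>w\<close>. The rank conditions force
  \<open>L i\<close> to lie in \<open>H 1\<close> for \<open>i < p\<close> and to contain \<open>e_1\<close> for \<open>i > p\<close>; so \<open>L\<close> is given by a flag in the
  Richardson variety of \<open>w\<close> with the value 1 deleted, together with the free choice of \<open>L p\<close> on a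
  projective line. The matrix \<open>A_w\<close> has the same recursive structure, with the first row and the column
  \<open>p + 1\<close> removed, and generic points of the projective line are permuted transitively by the first
  factor of the torus.\<close>

section \<open>Dimensions of subspaces\<close>

text \<open>Both halves have an obstacle that the outline hides. For reducedness, the product
  argument works with polynomial functions, whereas inverting \<open>M'\<close> and clearing entries
  produce denominators. They are avoided by fixing the determinant, so that the inverse is a
  constant multiple of the adjugate, and by taking the elimination rows from adjugates of leading
  blocks, without division by minors. The result is a splitting on matrices whose summands need not
  be constant on the fibres of the quotient map; they become functions of flags after evaluation at
  a canonical representative, which exists because the unipotent factor is unique. Density uses
  neither dimension theory nor irreducibility: a given matrix is moved along a line and then in the
  base, and both moves stay inside a prescribed open set because that set is given by the
  nonvanishing of one polynomial. As the orbit closure carries the reduced structure, only functions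
  are compared in the end.\<close>

lemma csubspace_iff:
  "csubspace n W \<longleftrightarrow> W \<subseteq> carrier_vec n \<and> 0\<^sub>v n \<in> W \<and> (\<forall>x\<in>W. \<forall>y\<in>W. x + y \<in> W)
     \<and> (\<forall>c. \<forall>x\<in>W. c \<cdot>\<^sub>v x \<in> W)"
  by (auto simp: VectorSpace.subspace_def LinearCombinations.submodule_def vec_vs vec_module
      module_vec_simps class_ring_simps)

lemma csubspaceD:
  assumes "csubspace n W"
  shows "W \<subseteq> carrier_vec n" "0\<^sub>v n \<in> W"
    "x \<in> W \<Longrightarrow> y \<in> W \<Longrightarrow> x + y \<in> W" "x \<in> W \<Longrightarrow> c \<cdot>\<^sub>v x \<in> W"
    "x \<in> W \<Longrightarrow> x \<in> carrier_vec n"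
  using assms by (auto simp: csubspace_iff)

lemma csubspace_vectorspace:
  assumes "csubspace n W"
  shows "vectorspace class_ring ((cspace n)\<lparr>carrier := W\<rparr>)"
  using vectorspace.subspace_is_vs[OF vec_vs assms] by simp

text \<open>Independence in \<open>W\<close> and in the ambient space agree, so independent subsets
  of \<open>W\<close> have at most \<open>n\<close> elements; a maximal one is a finite
  basis.\<close>

lemma csubspace_fin_dim:
  assumes W: "csubspace n W"
  shows "vectorspace.fin_dim class_ring ((cspace n)\<lparr>carrier := W\<rparr>)"
proof -
  interpret vec_space "TYPE(complex)" n .
  interpret W: vectorspace class_ring "(cspace n)\<lparr>carrier := W\<rparr>"
    by (rule csubspace_vectorspace[OF W])
  have sm: "submodule class_ring W V" using W by (simp add: VectorSpace.subspace_def)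
  have Wc: "W \<subseteq> carrier_vec n" using W by (simp add: csubspace_iff)
  let ?P = "\<lambda>S. S \<subseteq> W \<and> W.lin_indpt S"
  have "\<exists>A. finite A \<and> maximal A ?P"
  proof (rule maximal_exists[where N = n and B = "{}"])
    fix A assume A: "?P A"
    then have "lin_indpt A" using span_li_not_depend(2)[OF _ sm] by auto
    then show "finite A \<and> card A \<le> n" using li_le_dim[OF fin_dim, of A] A Wc dim_is_n by auto
  next
    show "?P {}" by (auto simp: W.lin_dep_def)
  qed
  then obtain A where A: "finite A" "maximal A ?P" by auto
  then have "W.basis A" using W.max_li_is_basis[of A] by simp
  then show ?thesis using A(1) unfolding W.fin_dim_def W.basis_def by auto
qed

lemma csubspace_md:
  assumes "csubspace n W" "csubspace n X" "X \<subseteq> W"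
  shows "VectorSpace.subspace class_ring X ((cspace n)\<lparr>carrier := W\<rparr>)"
  using vectorspace.nested_subspaces[OF vec_vs assms] by simp

lemma cdim_mono:
  assumes "csubspace n W" "csubspace n X" "X \<subseteq> W"
  shows "cdim n X \<le> cdim n W"
  using vectorspace.subspace_dim[OF csubspace_vectorspace[OF assms(1)] csubspace_md[OF assms]
      csubspace_fin_dim[OF assms(1)]] csubspace_fin_dim[OF assms(2)] by simp

text \<open>A basis of \<open>X\<close> is independent in \<open>W\<close> and has enough elements
  to be a basis of \<open>W\<close>. Equalities of flag steps are proved in this way, by one
  inclusion and a dimension count.\<close>

lemma csubspace_eqI:
  assumes W: "csubspace n W" and X: "csubspace n X" and sub: "X \<subseteq> W" and dim: "cdim n W \<le> cdim n X"
  shows "X = W"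
proof -
  interpret vec_space "TYPE(complex)" n .
  interpret W: vectorspace class_ring "(cspace n)\<lparr>carrier := W\<rparr>"
    by (rule csubspace_vectorspace[OF W])
  interpret X: vectorspace class_ring "(cspace n)\<lparr>carrier := X\<rparr>"
    by (rule csubspace_vectorspace[OF X])
  have smX: "submodule class_ring X V" and smW: "submodule class_ring W V"
    using W X by (simp_all add: VectorSpace.subspace_def)
  obtain B where B: "finite B" "X.basis B" using X.finite_basis_exists[OF csubspace_fin_dim[OF X]] by auto
  then have BX: "B \<subseteq> X" "X.lin_indpt B" "X.span B = X" by (auto simp: X.basis_def)
  have "card B = cdim n X" using X.dim_basis[OF B] by simp
  moreover have "W.lin_indpt B"
    using BX span_li_not_depend(2)[OF _ smX] span_li_not_depend(2)[OF _ smW] sub by auto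
  ultimately have "W.basis B" using dim BX sub B
    by (intro W.dim_li_is_basis csubspace_fin_dim[OF W]) auto
  then have "W.span B = W" by (auto simp: W.basis_def)
  then show ?thesis
    using BX sub span_li_not_depend(1)[OF _ smX, of B] span_li_not_depend(1)[OF _ smW, of B] by auto
qed

section \<open>Linear maps on subspaces and the dimensions of their images\<close>

definition linear_on :: "nat \<Rightarrow> nat \<Rightarrow> complex vec set \<Rightarrow> (complex vec \<Rightarrow> complex vec) \<Rightarrow> bool" where
  "linear_on n m W f \<longleftrightarrow> (\<forall>x\<in>W. f x \<in> carrier_vec m) \<and> (\<forall>x\<in>W. \<forall>y\<in>W. f (x + y) = f x + f y)
     \<and> (\<forall>c. \<forall>x\<in>W. f (c \<cdot>\<^sub>v x) = c \<cdot>\<^sub>v f x)"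

lemma linear_on_zero:
  assumes "csubspace n W" "linear_on n m W f"
  shows "f (0\<^sub>v n) = 0\<^sub>v m"
proof -
  have "f (0 \<cdot>\<^sub>v 0\<^sub>v n) = 0 \<cdot>\<^sub>v f (0\<^sub>v n)" and c: "f (0\<^sub>v n) \<in> carrier_vec m"
    using assms csubspaceD(2)[OF assms(1)] unfolding linear_on_def by blast+
  moreover have "0 \<cdot>\<^sub>v 0\<^sub>v n = (0\<^sub>v n :: complex vec)" "0 \<cdot>\<^sub>v f (0\<^sub>v n) = 0\<^sub>v m"
    using c by auto
  ultimately show ?thesis by metis
qed

lemma csubspace_image:
  assumes W: "csubspace n W" and f: "linear_on n m W f"
  shows "csubspace m (f ` W)"
proof -
  have 0: "0\<^sub>v m \<in> f ` W"
    using linear_on_zero[OF assms] csubspaceD(2)[OF W] by (metis image_eqI)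
  have p: "f x + f y \<in> f ` W" "c \<cdot>\<^sub>v f x \<in> f ` W" if "x \<in> W" "y \<in> W" for x y c
  proof -
    have "f x + f y = f (x + y)" "c \<cdot>\<^sub>v f x = f (c \<cdot>\<^sub>v x)"
      using that f unfolding linear_on_def by auto
    then show "f x + f y \<in> f ` W" "c \<cdot>\<^sub>v f x \<in> f ` W"
      using that csubspaceD(3,4)[OF W] by auto
  qed
  have "f ` W \<subseteq> carrier_vec m" using f unfolding linear_on_def by auto
  then show ?thesis unfolding csubspace_iff using 0 p by blast
qed

lemma rank_nullity_cdim:
  assumes W: "csubspace n W" and f: "linear_on n m W f"
  shows "cdim m (f ` W) + cdim n {x \<in> W. f x = 0\<^sub>v m} = cdim n W"
proof -
  interpret W: vectorspace class_ring "(cspace n)\<lparr>carrier := W\<rparr>"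
    by (rule csubspace_vectorspace[OF W])
  interpret U: vec_space "TYPE(complex)" m .
  interpret lm: linear_map class_ring "(cspace n)\<lparr>carrier := W\<rparr>" "cspace m" f
    using f unfolding linear_on_def
    by unfold_locales (auto simp: LinearCombinations.module_hom_def module_vec_simps)
  have "lm.imT = f ` W" "lm.kerT = {x \<in> W. f x = 0\<^sub>v m}"
    by (auto simp: lm.im_def lm.ker_def)
  then show ?thesis
    using lm.rank_nullity[OF csubspace_fin_dim[OF W]] by simp
qed

lemma cdim_zero: "cdim n {0\<^sub>v n} = 0"
proof -
  have W: "csubspace n {0\<^sub>v n}" by (auto simp: csubspace_iff)
  interpret W: vectorspace class_ring "(cspace n)\<lparr>carrier := {0\<^sub>v n}\<rparr>"
    by (rule csubspace_vectorspace[OF W])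
  have "0\<^sub>v n \<in> W.span {0\<^sub>v n}" using W.span_zero by (simp add: module_vec_simps)
  then have "W.gen_set {0\<^sub>v n}" using W.span_closed[of "{0\<^sub>v n}"] by auto
  then show ?thesis using W.dim0I by (simp add: module_vec_simps)
qed

lemma cdim_eq_0:
  assumes "csubspace n W" "cdim n W = 0"
  shows "W = {0\<^sub>v n}"
proof -
  have "{0\<^sub>v n} = W"
    using assms by (intro csubspace_eqI) (auto simp: csubspace_iff)
  then show ?thesis by simp
qed

lemma cdim_image:
  assumes W: "csubspace n W" and f: "linear_on n m W f"
    and inj: "\<And>x. x \<in> W \<Longrightarrow> f x = 0\<^sub>v m \<Longrightarrow> x = 0\<^sub>v n"
  shows "cdim m (f ` W) = cdim n W"
proof -
  have "{x \<in> W. f x = 0\<^sub>v m} = {0\<^sub>v n}"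
    using inj csubspaceD(2)[OF W] linear_on_zero[OF W f] by blast
  then show ?thesis using rank_nullity_cdim[OF W f] by (simp add: cdim_zero)
qed

lemma csubspace_Int: "csubspace n W \<Longrightarrow> csubspace n X \<Longrightarrow> csubspace n (W \<inter> X)"
  by (auto simp: csubspace_iff)

section \<open>Flags of invertible matrices\<close>

lemma GL_iff_det: "A \<in> GL n \<longleftrightarrow> A \<in> carrier_mat n n \<and> det A \<noteq> 0"
proof
  assume "A \<in> GL n"
  then obtain B where A: "A \<in> carrier_mat n n" and B: "A * B = 1\<^sub>m n" "B * A = 1\<^sub>m (dim_row B)"
    by (auto simp: GL_def invertible_mat_def inverts_mat_def)
  \<comment> \<open>\<open>invertible_mat\<close> does not prescribe the shape of the inverse; the
    column counts of the two products do.\<close>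
  have "dim_col B = n" using arg_cong[OF B(1), of dim_col] by simp
  moreover have "dim_row B = n" using arg_cong[OF B(2), of dim_col] A by simp
  ultimately have "B \<in> carrier_mat n n" by auto
  then have "det A * det B = 1" using det_mult[OF A, of B] B(1) by simp
  then show "A \<in> carrier_mat n n \<and> det A \<noteq> 0" using A by auto
next
  assume A: "A \<in> carrier_mat n n \<and> det A \<noteq> 0"
  define B where "B = (1 / det A) \<cdot>\<^sub>m adj_mat A"
  have "A * B = 1\<^sub>m n" "B * A = 1\<^sub>m n" "B \<in> carrier_mat n n"
    unfolding B_def using A adj_mat[of A n]
    by (auto simp: mult_smult_distrib[of _ n n] mult_smult_assoc_mat[of _ n n] intro!: eq_matI)
  then show "A \<in> GL n" using A
    by (auto simp: GL_def invertible_mat_def inverts_mat_def square_mat.simps)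
qed

lemma GL_carrier: "A \<in> GL n \<Longrightarrow> A \<in> carrier_mat n n"
  by (simp add: GL_def)

lemma GL_mult:
  assumes "A \<in> GL n" "B \<in> GL n"
  shows "A * B \<in> GL n"
  using assms det_mult[of A n B] by (auto simp: GL_iff_det)

lemma GL_multD:
  assumes "A * B \<in> GL n" "A \<in> carrier_mat n n" "B \<in> carrier_mat n n"
  shows "A \<in> GL n" "B \<in> GL n"
  using assms det_mult[of A n B] by (auto simp: GL_iff_det)

lemma one_GL: "1\<^sub>m n \<in> GL n"
  by (simp add: GL_iff_det)

lemma GL_inverse:
  assumes "A \<in> GL n"
  obtains B where "B \<in> GL n" "A * B = 1\<^sub>m n" "B * A = 1\<^sub>m n"
proof
  define B where "B = (1 / det A) \<cdot>\<^sub>m adj_mat A"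
  show *: "A * B = 1\<^sub>m n" "B * A = 1\<^sub>m n"
    unfolding B_def using assms adj_mat[of A n]
    by (auto simp: mult_smult_distrib[of _ n n] mult_smult_assoc_mat[of _ n n] GL_iff_det intro!: eq_matI)
  show "B \<in> GL n"
    using GL_multD(2)[of A B n] * one_GL[of n] assms adj_mat(1)[of A n] by (auto simp: GL_iff_det B_def)
qed

lemma GL_kernel:
  assumes "A \<in> GL n" "x \<in> carrier_vec n" "A *\<^sub>v x = 0\<^sub>v n"
  shows "x = 0\<^sub>v n"
  using assms det_0_iff_vec_prod_zero_field[of A n] by (auto simp: GL_iff_det)

lemma GL_I:
  assumes "A \<in> carrier_mat n n" "\<And>x. x \<in> carrier_vec n \<Longrightarrow> A *\<^sub>v x = 0\<^sub>v n \<Longrightarrow> x = 0\<^sub>v n"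
  shows "A \<in> GL n"
  using assms det_0_iff_vec_prod_zero_field[of A n] by (auto simp: GL_iff_det)

text \<open>These spaces have two roles: they hold the coefficient vectors for the first
  \<open>i\<close> columns of a matrix, and they are the steps of \<open>F'_flag n\<close>.\<close>

definition std_flag :: "nat \<Rightarrow> flag" where
  "std_flag n i = {c \<in> carrier_vec n. \<forall>k<n. i \<le> k \<longrightarrow> c $ k = 0}"

lemma std_flag_cspan: "std_flag n i = cspan n (unit_vec n ` {..<min n i})"
  by (subst cspan_unit_vecs) (auto simp: std_flag_def)

lemma csubspace_std_flag: "csubspace n (std_flag n i)"
  by (simp add: std_flag_cspan csubspace_unit_vecs)

lemma cdim_std_flag: "i \<le> n \<Longrightarrow> cdim n (std_flag n i) = i"
  unfolding std_flag_cspan by (subst cdim_unit_vecs) auto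

lemma std_flag_mono: "i \<le> j \<Longrightarrow> std_flag n i \<subseteq> std_flag n j"
  by (auto simp: std_flag_def)

lemma linear_on_mult_mat_vec:
  assumes "A \<in> carrier_mat m n" "W \<subseteq> carrier_vec n"
  shows "linear_on n m W ((*\<^sub>v) A)"
  unfolding linear_on_def
  using assms by (auto simp: mult_add_distrib_mat_vec[of A m n] mult_mat_vec[of A m n] subset_iff)

text \<open>As an image of a fixed subspace, a step of the flag is accessible to rank-nullity and to
  left multiplication. Padding with zeros turns coefficients for the truncated column list into
  coefficients for the whole matrix.\<close>

lemma flag_of_altdef:
  assumes A: "A \<in> carrier_mat n n"
  shows "flag_of n A i = (*\<^sub>v) A ` std_flag n i"
proof -
  interpret vec_space "TYPE(complex)" n .
  let ?ws = "take i (cols A)"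
  have len: "length ?ws = min i n" using A by simp
  have ws: "set ?ws \<subseteq> carrier_vec n"
    using A set_take_subset[of i "cols A"] cols_dim[of A] by auto
  have key: "mat_of_cols n ?ws *\<^sub>v vec (length ?ws) c = A *\<^sub>v vec n (\<lambda>k. if k < i then c k else 0)" for c
  proof (rule eq_vecI)
    show "dim_vec (mat_of_cols n ?ws *\<^sub>v vec (length ?ws) c) = dim_vec (A *\<^sub>v vec n (\<lambda>k. if k < i then c k else 0))"
      using A by simp
    fix r assume "r < dim_vec (A *\<^sub>v vec n (\<lambda>k. if k < i then c k else 0))"
    then have r: "r < n" using A by simp
    have "(mat_of_cols n ?ws *\<^sub>v vec (length ?ws) c) $ r = (\<Sum>k\<in>{0..<min i n}. A $$ (r, k) * c k)"
      using r A by (auto simp: scalar_prod_def mat_of_cols_def len intro!: sum.cong)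
    also have "\<dots> = (\<Sum>k\<in>{0..<n}. A $$ (r, k) * (if k < i then c k else 0))"
      by (intro sum.mono_neutral_cong_left) auto
    also have "\<dots> = (A *\<^sub>v vec n (\<lambda>k. if k < i then c k else 0)) $ r"
      using r A by (auto simp: scalar_prod_def intro!: sum.cong)
    finally show "(mat_of_cols n ?ws *\<^sub>v vec (length ?ws) c) $ r = \<dots>" .
  qed
  have "flag_of n A i = span_list ?ws"
    unfolding flag_of_def using span_list_as_span[OF ws] by simp
  also have "\<dots> = range (\<lambda>c. lincomb_list c ?ws)"
    unfolding span_list_def by auto
  also have "\<dots> = range (\<lambda>c. A *\<^sub>v vec n (\<lambda>k. if k < i then c k else 0))"
    using lincomb_list_as_mat_mult[of ?ws] ws key by (auto simp: subset_iff)
  also have "\<dots> = (*\<^sub>v) A ` std_flag n i"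
  proof -
    have R: "range (\<lambda>c::nat \<Rightarrow> complex. vec n (\<lambda>k. if k < i then c k else 0)) = std_flag n i"
    proof (intro equalityI subsetI)
      fix x assume x: "x \<in> std_flag n i"
      then have "x = vec n (\<lambda>k. if k < i then x $ k else 0)"
        by (auto simp: std_flag_def intro!: eq_vecI)
      then show "x \<in> range (\<lambda>c::nat \<Rightarrow> complex. vec n (\<lambda>k. if k < i then c k else 0))"
        by (intro image_eqI[where x = "\<lambda>k. x $ k"]) simp_all
    qed (auto simp: std_flag_def)
    show ?thesis unfolding R[symmetric] image_image ..
  qed
  finally show ?thesis .
qed

lemma flag_of_I:
  assumes "A \<in> carrier_mat n n" "c \<in> std_flag n i"
  shows "A *\<^sub>v c \<in> flag_of n A i"
  using assms by (simp add: flag_of_altdef)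

lemma mult_mat_unit_vec:
  assumes "A \<in> carrier_mat m n" "i < n"
  shows "A *\<^sub>v unit_vec n i = (col A i :: complex vec)"
  using assms by (intro eq_vecI) auto

lemma col_in_flag_of:
  assumes A: "A \<in> carrier_mat n n" and i: "i < n"
  shows "col A i \<in> flag_of n A (Suc i)"
proof -
  have "col A i = A *\<^sub>v unit_vec n i" using mult_mat_unit_vec[OF A i] by simp
  moreover have "unit_vec n i \<in> std_flag n (Suc i)" using i by (auto simp: std_flag_def)
  ultimately show ?thesis using flag_of_I[OF A] by simp
qed

lemma csubspace_flag_of: "A \<in> carrier_mat n n \<Longrightarrow> csubspace n (flag_of n A i)"
  unfolding flag_of_altdef
  by (intro csubspace_image[OF csubspace_std_flag] linear_on_mult_mat_vec)
    (auto simp: std_flag_def)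

lemma flag_of_mono: "A \<in> carrier_mat n n \<Longrightarrow> i \<le> j \<Longrightarrow> flag_of n A i \<subseteq> flag_of n A j"
  unfolding flag_of_altdef by (intro image_mono std_flag_mono)

lemma cdim_flag_of:
  assumes "A \<in> GL n" "i \<le> n"
  shows "cdim n (flag_of n A i) = i"
proof -
  have "cdim n ((*\<^sub>v) A ` std_flag n i) = cdim n (std_flag n i)"
    using assms GL_carrier[OF assms(1)] GL_kernel[OF assms(1)]
    by (intro cdim_image csubspace_std_flag linear_on_mult_mat_vec) (auto simp: std_flag_def)
  then show ?thesis using assms by (simp add: flag_of_altdef GL_carrier cdim_std_flag)
qed

lemma csubspace_carrier: "csubspace n (carrier_vec n)"
  by (auto simp: csubspace_iff)

lemma cdim_carrier: "cdim n (carrier_vec n) = n"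
proof -
  have "carrier_vec n = std_flag n n" by (auto simp: std_flag_def)
  then show ?thesis using cdim_std_flag[of n n] by simp
qed

lemma flag_of_in_Fl:
  assumes A: "A \<in> GL n"
  shows "flag_of n A \<in> Fl n"
proof -
  have "flag_of n A i = carrier_vec n" if "i \<ge> n" for i
  proof -
    have "flag_of n A i = flag_of n A n" using that A
      by (auto simp: flag_of_altdef GL_carrier std_flag_def)
    also have "\<dots> = carrier_vec n"
      using csubspace_flag_of[OF GL_carrier[OF A], of n] cdim_flag_of[OF A, of n]
      by (intro csubspace_eqI csubspace_carrier) (auto simp: cdim_carrier csubspace_iff)
    finally show ?thesis .
  qed
  moreover have "flag_of n A 0 = {0\<^sub>v n}"
    using cdim_eq_0[OF csubspace_flag_of] cdim_flag_of[of A n 0] A by (auto simp: GL_carrier)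
  ultimately show ?thesis
    using A flag_of_mono[OF GL_carrier[OF A]] by (auto simp: Fl_def csubspace_flag_of cdim_flag_of GL_carrier)
qed

lemma Fl_mono:
  assumes "L \<in> Fl n" "i \<le> j"
  shows "L i \<subseteq> L j"
proof -
  have "L k \<subseteq> L (Suc k)" for k
    using assms(1) by (cases "k < n") (auto simp: Fl_def)
  then show ?thesis using lift_Suc_mono_le[of L] assms(2) by blast
qed

lemma FlD:
  assumes "L \<in> Fl n"
  shows "csubspace n (L i)" "i \<le> n \<Longrightarrow> cdim n (L i) = i" "L 0 = {0\<^sub>v n}" "n \<le> i \<Longrightarrow> L i = carrier_vec n"
proof -
  have *: "L 0 = {0\<^sub>v n} \<and> (\<forall>i\<ge>n. L i = carrier_vec n) \<and>
      (\<forall>i\<le>n. csubspace n (L i) \<and> cdim n (L i) = i) \<and> (\<forall>i<n. L i \<subseteq> L (Suc i))"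
    using assms unfolding Fl_def mem_Collect_eq .
  show "L 0 = {0\<^sub>v n}" by (rule *[THEN conjunct1])
  show c: "n \<le> i \<Longrightarrow> L i = carrier_vec n" by (rule *[THEN conjunct2, THEN conjunct1, rule_format])
  have d: "i \<le> n \<Longrightarrow> csubspace n (L i) \<and> cdim n (L i) = i"
    by (rule *[THEN conjunct2, THEN conjunct2, THEN conjunct1, rule_format])
  then show "i \<le> n \<Longrightarrow> cdim n (L i) = i" by (rule conjunct2)
  show "csubspace n (L i)"
  proof (cases "i \<le> n")
    case True
    then show ?thesis by (rule d[THEN conjunct1])
  next
    case False
    then have "L i = carrier_vec n" by (intro c) simp
    then show ?thesis using csubspace_carrier[of n] by (rule ssubst)
  qed
qed

text \<open>Partial sums of the column combination stay in \<open>W\<close>. The membership is asked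
  for columns with nonzero coefficient, which suits coefficient vectors from a step of
  \<open>std_flag\<close>.\<close>

lemma mult_mat_vec_as_sum:
  assumes A: "A \<in> carrier_mat m n" and c: "c \<in> carrier_vec n" and W: "csubspace m W"
    and cols: "\<And>k. k < n \<Longrightarrow> c $ k \<noteq> 0 \<Longrightarrow> col A k \<in> W"
  shows "A *\<^sub>v c \<in> W"
proof -
  have "\<exists>x\<in>W. \<forall>r<m. x $ r = (\<Sum>k<j. A $$ (r, k) * c $ k)" if "j \<le> n" for j
    using that
  proof (induction j)
    case 0
    then show ?case using csubspaceD(2)[OF W] by (intro bexI[of _ "0\<^sub>v m"]) auto
  next
    case (Suc j)
    then obtain x where x: "x \<in> W" "\<forall>r<m. x $ r = (\<Sum>k<j. A $$ (r, k) * c $ k)" by auto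
    have "c $ j \<cdot>\<^sub>v col A j \<in> W"
    proof (cases "c $ j = 0")
      case True
      have "col A j \<in> carrier_vec m" using A Suc.prems by auto
      then have "c $ j \<cdot>\<^sub>v col A j = 0\<^sub>v m" using True A by (auto intro!: eq_vecI)
      then show ?thesis using csubspaceD(2)[OF W] by simp
    qed (use cols[of j] Suc.prems csubspaceD(4)[OF W] in auto)
    then have "x + c $ j \<cdot>\<^sub>v col A j \<in> W" using x csubspaceD(3)[OF W] by auto
    moreover have "\<forall>r<m. (x + c $ j \<cdot>\<^sub>v col A j) $ r = (\<Sum>k<Suc j. A $$ (r, k) * c $ k)"
      using x A Suc.prems by auto
    ultimately show ?case by blast
  qed
  from this[of n] obtain x where x: "x \<in> W" "\<forall>r<m. x $ r = (\<Sum>k<n. A $$ (r, k) * c $ k)" by auto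
  have "A *\<^sub>v c = x"
    using x A c csubspaceD(5)[OF W x(1)]
    by (intro eq_vecI) (auto simp: scalar_prod_def atLeast0LessThan intro!: sum.cong)
  then show ?thesis using x by simp
qed

lemma flag_of_subset:
  assumes A: "A \<in> carrier_mat n n" and W: "csubspace n W"
    and cols: "\<And>k. k < n \<Longrightarrow> k < i \<Longrightarrow> col A k \<in> W"
  shows "flag_of n A i \<subseteq> W"
proof
  fix x assume "x \<in> flag_of n A i"
  then obtain c where "c \<in> std_flag n i" "x = A *\<^sub>v c" using A by (auto simp: flag_of_altdef)
  then show "x \<in> W" using A W cols
    by (auto simp: std_flag_def not_le[symmetric] intro!: mult_mat_vec_as_sum[of A n n])
qed

text \<open>The columns give the inclusion and the dimensions give equality. Identifications of
  flags below are reduced to this test on columns.\<close>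

lemma flag_of_eqI:
  assumes L: "L \<in> Fl n" and A: "A \<in> GL n" and cols: "\<And>i. i < n \<Longrightarrow> col A i \<in> L (Suc i)"
  shows "flag_of n A = L"
proof
  fix i
  note Ac = GL_carrier[OF A]
  show "flag_of n A i = L i"
  proof (cases "i \<le> n")
    case True
    show ?thesis
    proof (rule csubspace_eqI[OF FlD(1)[OF L] csubspace_flag_of[OF Ac]])
      show "flag_of n A i \<subseteq> L i"
      proof (rule flag_of_subset[OF Ac FlD(1)[OF L]])
        fix k assume "k < n" "k < i"
        then show "col A k \<in> L i" using cols[of k] Fl_mono[OF L, of "Suc k" i] by auto
      qed
      show "cdim n (L i) \<le> cdim n (flag_of n A i)"
        using True FlD(2)[OF L] cdim_flag_of[OF A] by simp
    qed
  next
    case False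
    then show ?thesis using FlD(4)[OF L] FlD(4)[OF flag_of_in_Fl[OF A]] by simp
  qed
qed

lemma Fl_flag_of:
  assumes L: "L \<in> Fl n"
  obtains A where "A \<in> GL n" "flag_of n A = L"
proof -
  have "\<exists>v. v \<in> L (Suc i) \<and> v \<notin> L i" if "i < n" for i
  proof (rule ccontr)
    assume "\<not> ?thesis"
    then have "L (Suc i) \<subseteq> L i" by auto
    then have "cdim n (L (Suc i)) \<le> cdim n (L i)" using FlD(1)[OF L] by (intro cdim_mono)
    then show False using FlD(2)[OF L] that by simp
  qed
  then obtain v where v: "\<And>i. i < n \<Longrightarrow> v i \<in> L (Suc i) \<and> v i \<notin> L i" by metis
  have vc: "v i \<in> carrier_vec n" if "i < n" for i
    using csubspaceD(5)[OF FlD(1)[OF L]] v that by blast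
  define A where "A = mat n n (\<lambda>(r, k). v k $ r)"
  have A: "A \<in> carrier_mat n n" by (simp add: A_def)
  have col: "col A k = v k" if "k < n" for k
    using that vc[OF that] by (auto simp: A_def intro!: eq_vecI)
  have "A \<in> GL n"
  proof (rule GL_I[OF A])
    fix c :: "complex vec" assume c: "c \<in> carrier_vec n" and Ac: "A *\<^sub>v c = 0\<^sub>v n"
    show "c = 0\<^sub>v n"
    proof (rule ccontr)
      assume "c \<noteq> 0\<^sub>v n"
      then have ne: "{k. k < n \<and> c $ k \<noteq> 0} \<noteq> {}" using c by (auto intro!: eq_vecI)
      \<comment> \<open>The last nonzero entry of a kernel vector would express \<open>v m\<close>
        through earlier columns, all of which lie in \<open>L m\<close>.\<close>
      define m where "m = Max {k. k < n \<and> c $ k \<noteq> 0}"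
      have m: "m < n" "c $ m \<noteq> 0" using Max_in[OF _ ne] by (auto simp: m_def)
      have gt: "c $ k = 0" if "m < k" "k < n" for k
      proof (rule ccontr)
        assume "c $ k \<noteq> 0"
        then have "k \<le> m" unfolding m_def using that by (intro Max_ge) auto
        then show False using that by simp
      qed
      define c' where "c' = vec n (\<lambda>k. if k = m then 0 else c $ k)"
      have W: "csubspace n (L m)" by (rule FlD(1)[OF L])
      have "A *\<^sub>v c' \<in> L m"
      proof (rule mult_mat_vec_as_sum[OF A _ W])
        fix k assume k: "k < n" "c' $ k \<noteq> 0"
        then have "k < m" using gt[of k] by (auto simp: c'_def split: if_splits) (metis nat_neq_iff)
        then show "col A k \<in> L m" using col v[of k] k Fl_mono[OF L, of "Suc k" m] by auto
      qed (simp add: c'_def)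
      moreover have "c = c' + c $ m \<cdot>\<^sub>v unit_vec n m"
        using c m by (auto simp: c'_def intro!: eq_vecI)
      then have "A *\<^sub>v c = A *\<^sub>v c' + c $ m \<cdot>\<^sub>v v m"
        using mult_add_distrib_mat_vec[OF A, of c' "c $ m \<cdot>\<^sub>v unit_vec n m"] mult_mat_vec[OF A, of "unit_vec n m" "c $ m"]
          mult_mat_unit_vec[OF A m(1)] col[OF m(1)] by (auto simp: c'_def)
      then have "v m = (-1 / c $ m) \<cdot>\<^sub>v (A *\<^sub>v c')"
      proof -
        assume e: "A *\<^sub>v c = A *\<^sub>v c' + c $ m \<cdot>\<^sub>v v m"
        have "0 = (A *\<^sub>v c') $ r + c $ m * v m $ r" if "r < n" for r
          using arg_cong[OF e, of "\<lambda>x. x $ r"] that vc[OF m(1)] A by (simp add: Ac)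
        then show ?thesis using vc[OF m(1)] A m
          by (intro eq_vecI) (auto simp: field_simps eq_neg_iff_add_eq_0 simp del: index_mult_mat_vec)
      qed
      ultimately have "v m \<in> L m" using csubspaceD(4)[OF W] by metis
      then show False using v[OF m(1)] by simp
    qed
  qed
  then show ?thesis using that flag_of_eqI[OF L] col v by simp
qed

section \<open>Fibres of the quotient map and multiplication from the left\<close>

lemma upper_triangular_mult_std_flag:
  assumes T: "T \<in> carrier_mat n n" "upper_triangular T" and c: "c \<in> std_flag n i"
  shows "T *\<^sub>v c \<in> std_flag n i"
proof -
  have "(\<Sum>k = 0..<n. T $$ (r, k) * c $ k) = 0" if "r < n" "i \<le> r" for r
  proof (rule sum.neutral, intro ballI)
    fix k assume "k \<in> {0..<n}"
    then show "T $$ (r, k) * c $ k = 0"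
      using c T that by (cases "k < i") (auto simp: std_flag_def upper_triangular_def)
  qed
  then show ?thesis using T c by (auto simp: std_flag_def scalar_prod_def)
qed

lemma flag_of_mult_upper:
  assumes A: "A \<in> GL n" and T: "T \<in> GL n" "upper_triangular T"
  shows "flag_of n (A * T) = flag_of n A"
proof (rule flag_of_eqI[OF flag_of_in_Fl[OF A] GL_mult[OF A T(1)]])
  fix i assume i: "i < n"
  note Ac = GL_carrier[OF A] and Tc = GL_carrier[OF T(1)]
  have "col (A * T) i = A *\<^sub>v (T *\<^sub>v unit_vec n i)"
    using col_mult2[OF Ac Tc i] mult_mat_unit_vec[OF Tc i] by simp
  then show "col (A * T) i \<in> flag_of n A (Suc i)"
    using upper_triangular_mult_std_flag[OF Tc T(2), of "unit_vec n i" "Suc i"] flag_of_I[OF Ac] i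
    by (simp add: std_flag_def)
qed

text \<open>\<open>T\<close> is the inverse of \<open>A\<close> times \<open>B\<close>. Column
  \<open>j\<close> of \<open>B\<close> is a combination of the first \<open>j + 1\<close> columns of
  \<open>A\<close>, which says that column \<open>j\<close> of \<open>T\<close> vanishes below the
  diagonal. Together with \<open>flag_of_mult_upper\<close> this identifies flags with cosets of the
  upper triangular group.\<close>

lemma flag_of_eqD:
  assumes A: "A \<in> GL n" and B: "B \<in> GL n" and cols: "\<And>i. i < n \<Longrightarrow> col B i \<in> flag_of n A (Suc i)"
  obtains T where "T \<in> GL n" "upper_triangular T" "B = A * T"
proof -
  note Ac = GL_carrier[OF A] and Bc = GL_carrier[OF B]
  obtain A' where A': "A' \<in> GL n" "A * A' = 1\<^sub>m n" "A' * A = 1\<^sub>m n" using GL_inverse[OF A] .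
  note A'c = GL_carrier[OF A'(1)]
  define T where "T = A' * B"
  have T: "T \<in> GL n" unfolding T_def by (rule GL_mult[OF A'(1) B])
  have AT: "A * T = B" unfolding T_def using A' Ac A'c Bc by (metis assoc_mult_mat left_mult_one_mat)
  have "T $$ (i, j) = 0" if "i < n" "j < i" for i j
  proof -
    have "j < n" using that by simp
    then obtain c where c: "c \<in> std_flag n (Suc j)" "col B j = A *\<^sub>v c"
      using cols[of j] Ac by (auto simp: flag_of_altdef)
    have "col T j = A' *\<^sub>v col B j" unfolding T_def by (rule col_mult2[OF A'c Bc \<open>j < n\<close>])
    also have "\<dots> = (A' * A) *\<^sub>v c" unfolding c(2) using A'c Ac c(1)
      by (intro assoc_mult_mat_vec[symmetric]) (auto simp: std_flag_def)
    also have "\<dots> = c" using c(1) A'(3) by (auto simp: std_flag_def)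
    finally have "col T j $ i = c $ i" by simp
    then show ?thesis using c(1) that GL_carrier[OF T] by (auto simp: std_flag_def)
  qed
  then have "upper_triangular T" using GL_carrier[OF T] by (auto simp: upper_triangular_def)
  then show ?thesis using that T AT by simp
qed

lemma flag_of_eqE:
  assumes "A \<in> GL n" "B \<in> GL n" "flag_of n A = flag_of n B"
  obtains T where "T \<in> GL n" "upper_triangular T" "B = A * T"
  using flag_of_eqD[OF assms(1,2)] col_in_flag_of[OF GL_carrier[OF assms(2)]] assms(3) by metis

lemma flag_of_mult_left:
  assumes "G \<in> carrier_mat n n" "A \<in> carrier_mat n n"
  shows "flag_of n (G * A) i = (*\<^sub>v) G ` flag_of n A i"
  using assms by (auto simp: flag_of_altdef image_image std_flag_def intro!: image_cong)

lemma mat_diag_GL: "mat_diag n t \<in> GL n \<longleftrightarrow> (\<forall>i<n. t i \<noteq> 0)"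
proof -
  have "det (mat_diag n t) = (\<Prod>i<n. t i)"
    by (subst det_upper_triangular[of _ n])
      (auto simp: mat_diag_def upper_triangular_def prod_list_diag_prod atLeast0LessThan)
  then show ?thesis by (auto simp: GL_iff_det mat_diag_def)
qed

lemma torus_act_flag_of:
  assumes "A \<in> carrier_mat n n"
  shows "torus_act n t (flag_of n A) = flag_of n (mat_diag n t * A)"
  using flag_of_mult_left[of "mat_diag n t" n A] assms by (auto simp: torus_act_def mat_diag_def)

section \<open>Algebras of functions\<close>

text \<open>Matrix operations and substitution are needed over four algebras: polynomials in one
  matrix, polynomials in two matrices, fractions with a fixed denominator, and polynomials in one
  parameter along a curve. The locale treats them at once.\<close>

locale fun_algebra =
  fixes P :: "('a \<Rightarrow> complex) \<Rightarrow> bool"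
  assumes const: "P (\<lambda>_. c)"
    and add: "P f \<Longrightarrow> P g \<Longrightarrow> P (\<lambda>x. f x + g x)"
    and mult: "P f \<Longrightarrow> P g \<Longrightarrow> P (\<lambda>x. f x * g x)"
begin

lemma cmult: "P f \<Longrightarrow> P (\<lambda>x. c * f x)"
  by (intro mult const)

lemma diff: "P f \<Longrightarrow> P g \<Longrightarrow> P (\<lambda>x. f x - g x)"
  using add[of f "\<lambda>x. - 1 * g x"] cmult[of g "- 1"] by simp

lemma sum: "(\<And>i. i \<in> I \<Longrightarrow> P (f i)) \<Longrightarrow> P (\<lambda>x. \<Sum>i\<in>I. f i x)"
  by (induction I rule: infinite_finite_induct) (auto intro: const add)

lemma prod: "(\<And>i. i \<in> I \<Longrightarrow> P (f i)) \<Longrightarrow> P (\<lambda>x. \<Prod>i\<in>I. f i x)"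
  by (induction I rule: infinite_finite_induct) (auto intro: const mult)

lemma power: "P f \<Longrightarrow> P (\<lambda>x. f x ^ k)"
  by (induction k) (auto intro: const mult)

definition mats :: "nat \<Rightarrow> nat \<Rightarrow> ('a \<Rightarrow> complex mat) \<Rightarrow> bool" where
  "mats k l M \<longleftrightarrow> (\<forall>x. M x \<in> carrier_mat k l) \<and> (\<forall>i<k. \<forall>j<l. P (\<lambda>x. M x $$ (i, j)))"

lemma matsD: "mats k l M \<Longrightarrow> i < k \<Longrightarrow> j < l \<Longrightarrow> P (\<lambda>x. M x $$ (i, j))"
  and mats_carrier: "mats k l M \<Longrightarrow> M x \<in> carrier_mat k l"
  by (auto simp: mats_def)

lemma mats_mat:
  assumes "\<And>i j. i < k \<Longrightarrow> j < l \<Longrightarrow> P (\<lambda>x. f x i j)"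
  shows "mats k l (\<lambda>x. mat k l (\<lambda>(i, j). f x i j))"
  using assms by (simp add: mats_def)

lemma mats_const: "M \<in> carrier_mat k l \<Longrightarrow> mats k l (\<lambda>_. M)"
  by (auto simp: mats_def intro: const)

lemma mats_mult:
  assumes "mats k l M" "mats l m N"
  shows "mats k m (\<lambda>x. M x * N x)"
proof -
  have "P (\<lambda>x. (M x * N x) $$ (i, j))" if "i < k" "j < m" for i j
  proof -
    have "(M x * N x) $$ (i, j) = (\<Sum>r\<in>{0..<l}. M x $$ (i, r) * N x $$ (r, j))" for x
      using mats_carrier[OF assms(1), of x] mats_carrier[OF assms(2), of x] that
      by (auto simp: scalar_prod_def intro!: sum.cong)
    then show ?thesis using that assms by (auto intro!: sum mult matsD)
  qed
  moreover have "M x * N x \<in> carrier_mat k m" for x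
    using mats_carrier[OF assms(1), of x] mats_carrier[OF assms(2), of x] by auto
  ultimately show ?thesis by (simp add: mats_def)
qed

lemma mats_transpose: "mats k l M \<Longrightarrow> mats l k (\<lambda>x. transpose_mat (M x))"
proof -
  assume M: "mats k l M"
  have "P (\<lambda>x. transpose_mat (M x) $$ (i, j))" if "i < l" "j < k" for i j
  proof -
    have "transpose_mat (M x) $$ (i, j) = M x $$ (j, i)" for x
      using mats_carrier[OF M, of x] that by auto
    then show ?thesis using matsD[OF M that(2,1)] by simp
  qed
  then show ?thesis using mats_carrier[OF M] by (simp add: mats_def)
qed

lemma det:
  assumes "mats k k M"
  shows "P (\<lambda>x. det (M x))"
proof -
  have "P (\<lambda>x. \<Sum>p\<in>{p. p permutes {0..<k}}. signof p * (\<Prod>i = 0..<k. M x $$ (i, p i)))"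
  proof (intro sum mult const prod matsD[OF assms])
    fix p i assume p: "p \<in> {p. p permutes {0..<k}}" and i: "i \<in> {0..<k}"
    then show "i < k" "p i < k" using permutes_in_image[of p "{0..<k}" i] by auto
  qed
  then show ?thesis using det_def'[OF mats_carrier[OF assms]] by simp
qed

lemma mats_delete:
  assumes "mats (Suc k) (Suc k) M" "i \<le> k" "j \<le> k"
  shows "mats k k (\<lambda>x. mat_delete (M x) i j)"
proof -
  have "P (\<lambda>x. mat_delete (M x) i j $$ (r, s))" if "r < k" "s < k" for r s
  proof -
    have "mat_delete (M x) i j $$ (r, s) = M x $$ (if r < i then r else Suc r, if s < j then s else Suc s)" for x
      using mats_carrier[OF assms(1), of x] that by (auto simp: mat_delete_def)
    then show ?thesis using that assms(1) by (auto intro!: matsD)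
  qed
  moreover have "mat_delete (M x) i j \<in> carrier_mat k k" for x
    using mats_carrier[OF assms(1), of x] by (auto simp: mat_delete_def)
  ultimately show ?thesis by (simp add: mats_def)
qed

lemma mats_adj:
  assumes "mats k k M"
  shows "mats k k (\<lambda>x. adj_mat (M x))"
proof -
  have "P (\<lambda>x. adj_mat (M x) $$ (i, j))" if ij: "i < k" "j < k" for i j
  proof -
    obtain k' where k': "k = Suc k'" using ij(1) by (cases k) auto
    have "adj_mat (M x) $$ (i, j) = (-1)^(j+i) * det (mat_delete (M x) j i)" for x
      using mats_carrier[OF assms, of x] ij by (auto simp: adj_mat_def cofactor_def)
    moreover have "P (\<lambda>x. (-1)^(j+i) * det (mat_delete (M x) j i))"
      using assms ij by (intro mult const det[of k'] mats_delete) (auto simp: k')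
    ultimately show ?thesis by simp
  qed
  then show ?thesis using adj_mat(1)[OF mats_carrier[OF assms]] by (simp add: mats_def)
qed

text \<open>The entries of \<open>S\<close> may lie in any algebra of the locale, so that a
  polynomial can be evaluated to a fraction or along a curve.\<close>

lemma subst:
  assumes p: "polynomial_fun n p" and S: "\<And>i j. i < n \<Longrightarrow> j < n \<Longrightarrow> P (\<lambda>x. S x $$ (i, j))"
  shows "P (\<lambda>x. p (S x))"
  using p by induction (auto intro: const add mult S)

end

interpretation poly: fun_algebra "polynomial_fun n" for n
  by unfold_locales (auto intro: polynomial_fun.intros)

text \<open>The entry of \<open>A * T\<close> is written as an explicit sum because polynomial
  functions are defined on matrices of every shape, where the matrix product need not have this
  value.\<close>

lemma poly_entry_mult:
  assumes "T \<in> carrier_mat n n" "i < n" "j < n"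
  shows "polynomial_fun n (\<lambda>A. \<Sum>k<n. A $$ (i, k) * T $$ (k, j))"
  using assms by (intro poly.sum poly.mult poly.const) (auto intro: polynomial_fun.entry)

text \<open>This is the image of the tensor product of two polynomial algebras. Closure under
  products is derived rather than built in, so that every element is visibly a finite sum of
  tensors.\<close>

inductive bipolynomial :: "nat \<Rightarrow> (complex mat \<times> complex mat \<Rightarrow> complex) \<Rightarrow> bool" for n where
  tensor: "polynomial_fun n p \<Longrightarrow> polynomial_fun n q \<Longrightarrow> bipolynomial n (\<lambda>x. p (fst x) * q (snd x))"
| add: "bipolynomial n f \<Longrightarrow> bipolynomial n g \<Longrightarrow> bipolynomial n (\<lambda>x. f x + g x)"

lemma bipolynomial_mult:
  assumes "bipolynomial n f" "bipolynomial n g"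
  shows "bipolynomial n (\<lambda>x. f x * g x)"
  using assms
proof (induction arbitrary: g)
  case (tensor p q)
  show ?case using tensor(3)
  proof induction
    case t: (tensor p' q')
    have "bipolynomial n (\<lambda>x. (p (fst x) * p' (fst x)) * (q (snd x) * q' (snd x)))"
      using tensor t by (intro bipolynomial.tensor[of n "\<lambda>A. p A * p' A" "\<lambda>A. q A * q' A"]) (auto intro: poly.mult)
    then show ?case by (simp add: mult_ac)
  next
    case (add f g)
    then show ?case using bipolynomial.add by (fastforce simp: distrib_left)
  qed
next
  case (add f f')
  then show ?case
    using bipolynomial.add[OF add.IH(1)[OF add.prems] add.IH(2)[OF add.prems]] by (simp add: distrib_right)
qed

interpretation bipoly: fun_algebra "bipolynomial n" for n
proof
  show "bipolynomial n (\<lambda>_. c)" for c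
    using bipolynomial.tensor[of n "\<lambda>_. c" "\<lambda>_. 1"] by (simp add: poly.const)
qed (auto intro: bipolynomial.add bipolynomial_mult)

lemma bipolynomial_fst: "polynomial_fun n p \<Longrightarrow> bipolynomial n (\<lambda>x. p (fst x))"
  and bipolynomial_snd: "polynomial_fun n p \<Longrightarrow> bipolynomial n (\<lambda>x. p (snd x))"
  using bipolynomial.tensor[of n p "\<lambda>_. 1"] bipolynomial.tensor[of n "\<lambda>_. 1" p] by (simp_all add: poly.const)

lemma bipolynomial_sum_list:
  assumes "bipolynomial n f"
  shows "\<exists>xs. (\<forall>(p, q)\<in>set xs. polynomial_fun n p \<and> polynomial_fun n q) \<and>
    f = (\<lambda>x. \<Sum>(p, q)\<leftarrow>xs. p (fst x) * q (snd x))"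
  using assms
proof induction
  case (tensor p q)
  then show ?case by (intro exI[of _ "[(p, q)]"]) auto
next
  case (add f g)
  then obtain xs ys where "\<forall>(p, q)\<in>set xs. polynomial_fun n p \<and> polynomial_fun n q"
      "f = (\<lambda>x. \<Sum>(p, q)\<leftarrow>xs. p (fst x) * q (snd x))"
      "\<forall>(p, q)\<in>set ys. polynomial_fun n p \<and> polynomial_fun n q"
      "g = (\<lambda>x. \<Sum>(p, q)\<leftarrow>ys. p (fst x) * q (snd x))"
    by blast
  then show ?case by (intro exI[of _ "xs @ ys"]) auto
qed

lemma poly_sum_list:
  assumes "\<And>y. y \<in> set ys \<Longrightarrow> polynomial_fun n (f y)"
  shows "polynomial_fun n (\<lambda>A. \<Sum>y\<leftarrow>ys. f y A)"
  using assms by (induction ys) (auto intro: poly.const poly.add)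

text \<open>The product of two reduced varieties is reduced. Only the restriction of the splitting to the
  diagonal is recorded.\<close>

lemma tensor_split:
  assumes "\<forall>(p, q)\<in>set xs. polynomial_fun n p \<and> polynomial_fun n q"
    and "\<And>x y. x \<in> X \<Longrightarrow> y \<in> Y \<Longrightarrow> (\<Sum>(p, q)\<leftarrow>xs. p x * q y) = 0"
  shows "\<exists>g h. polynomial_fun n g \<and> polynomial_fun n h \<and> (\<forall>x\<in>X. g x = 0) \<and> (\<forall>y\<in>Y. h y = 0) \<and>
    (\<forall>x. (\<Sum>(p, q)\<leftarrow>xs. p x * q x) = g x + h x)"
  using assms
proof (induction "length xs" arbitrary: xs)
  case 0
  then show ?case
    by (intro exI[of _ "\<lambda>_. 0"]) (simp add: poly.const)
next
  case (Suc m)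
  then obtain p0 q0 ys where xs: "xs = (p0, q0) # ys" and m: "m = length ys"
    by (cases xs) auto
  have p0: "polynomial_fun n p0" and q0: "polynomial_fun n q0"
    and ys: "\<forall>(p, q)\<in>set ys. polynomial_fun n p \<and> polynomial_fun n q"
    using Suc.prems(1) xs by auto
  have van: "p0 x * q0 y + (\<Sum>(p, q)\<leftarrow>ys. p x * q y) = 0" if "x \<in> X" "y \<in> Y" for x y
    using Suc.prems(2)[OF that] xs by simp
  show ?case
  \<comment> \<open>If \<open>p0\<close> vanishes on \<open>X\<close>, the first tensor goes into
    \<open>g\<close>. Otherwise a point of \<open>X\<close> is used to trade \<open>q0\<close> for a
    function that vanishes on \<open>Y\<close>.\<close>
  proof (cases "\<forall>x\<in>X. p0 x = 0")
    case True
    then obtain g h where gh: "polynomial_fun n g" "polynomial_fun n h" "\<forall>x\<in>X. g x = 0" "\<forall>y\<in>Y. h y = 0"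
        "\<forall>x. (\<Sum>(p, q)\<leftarrow>ys. p x * q x) = g x + h x"
      using Suc.hyps(1)[OF m ys] van by fastforce
    show ?thesis
    proof (intro exI conjI)
      show "polynomial_fun n (\<lambda>x. p0 x * q0 x + g x)" "polynomial_fun n h"
        using p0 q0 gh by (auto intro: poly.add poly.mult)
    qed (use gh True xs in auto)
  next
    case False
    then obtain x0 where x0: "x0 \<in> X" "p0 x0 \<noteq> 0" by auto
    \<comment> \<open>Evaluating the vanishing sum at \<open>x0\<close> and dividing by
      \<open>p0 x0\<close> leaves a function of \<open>y\<close> alone.\<close>
    define h0 where "h0 = (\<lambda>y. q0 y + (\<Sum>(p, q)\<leftarrow>ys. p x0 / p0 x0 * q y))"
    have h0: "polynomial_fun n h0"
      unfolding h0_def using q0 ys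
      by (intro poly.add) (auto intro!: poly_sum_list poly.cmult simp: case_prod_beta simp del: times_divide_eq_left)
    have h0Y: "h0 y = 0" if "y \<in> Y" for y
    proof -
      have "p0 x0 * h0 y = p0 x0 * q0 y + (\<Sum>(p, q)\<leftarrow>ys. p x0 * q y)"
        using x0(2) unfolding h0_def distrib_left sum_list_const_mult[symmetric]
        by (simp add: case_prod_unfold)
      then show ?thesis using van[OF x0(1) that] x0 by simp
    qed
    \<comment> \<open>Expressing \<open>q0\<close> through \<open>h0\<close> changes each
      \<open>p\<close> by a multiple of \<open>p0\<close> and shortens the sum of tensors by
      one.\<close>
    define zs where "zs = map (\<lambda>(p, q). (\<lambda>x. p x - p x0 / p0 x0 * p0 x, q)) ys"
    have sum: "p0 x * q0 y + (\<Sum>(p, q)\<leftarrow>ys. p x * q y) = (\<Sum>(p, q)\<leftarrow>zs. p x * q y) + p0 x * h0 y" for x y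
      unfolding h0_def zs_def
      by (induction ys) (auto simp: algebra_simps)
    have zs: "\<forall>(p, q)\<in>set zs. polynomial_fun n p \<and> polynomial_fun n q"
      using ys p0 unfolding zs_def
      by (auto intro!: poly.diff poly.cmult simp del: times_divide_eq_left)
    have "(\<Sum>(p, q)\<leftarrow>zs. p x * q y) = 0" if "x \<in> X" "y \<in> Y" for x y
      using sum[of x y] van[OF that] h0Y[OF that(2)] by simp
    then obtain g h where gh: "polynomial_fun n g" "polynomial_fun n h" "\<forall>x\<in>X. g x = 0" "\<forall>y\<in>Y. h y = 0"
        "\<forall>x. (\<Sum>(p, q)\<leftarrow>zs. p x * q x) = g x + h x"
      using Suc.hyps(1)[of zs] zs m by (fastforce simp: zs_def)
    show ?thesis
    proof (intro exI conjI)
      show "polynomial_fun n g" "polynomial_fun n (\<lambda>x. h x + p0 x * h0 x)"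
        using p0 h0 gh by (auto intro: poly.add poly.mult)
      show "\<forall>x. (\<Sum>(p, q)\<leftarrow>xs. p x * q x) = g x + (h x + p0 x * h0 x)"
        using sum gh xs by (simp add: add.assoc)
    qed (use gh h0Y in auto)
  qed
qed

lemma bipolynomial_split:
  assumes f: "bipolynomial n f" and "\<And>x y. x \<in> X \<Longrightarrow> y \<in> Y \<Longrightarrow> f (x, y) = 0"
  obtains g h where "polynomial_fun n g" "polynomial_fun n h" "\<And>x. x \<in> X \<Longrightarrow> g x = 0" "\<And>y. y \<in> Y \<Longrightarrow> h y = 0"
    "\<And>x. f (x, x) = g x + h x"
proof -
  obtain xs where xs: "\<forall>(p, q)\<in>set xs. polynomial_fun n p \<and> polynomial_fun n q"
      "f = (\<lambda>x. \<Sum>(p, q)\<leftarrow>xs. p (fst x) * q (snd x))"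
    using bipolynomial_sum_list[OF f] by blast
  show ?thesis using tensor_split[OF xs(1), of X Y] assms(2) that unfolding xs(2) by fastforce
qed

text \<open>Elements of the polynomial algebra localized at \<open>D\<close>. The formula is
  demanded where \<open>D\<close> is nonzero, so that division by zero never enters.\<close>

definition fraction :: "nat \<Rightarrow> (complex mat \<Rightarrow> complex) \<Rightarrow> (complex mat \<Rightarrow> complex) \<Rightarrow> bool" where
  "fraction n D F \<longleftrightarrow> (\<exists>p m. polynomial_fun n p \<and> (\<forall>A. D A \<noteq> 0 \<longrightarrow> F A = p A / D A ^ m))"

lemma fun_algebra_fraction:
  assumes D: "polynomial_fun n D"
  shows "fun_algebra (fraction n D)"
proof
  show "fraction n D (\<lambda>_. c)" for c
    unfolding fraction_def by (intro exI[of _ "\<lambda>_. c"] exI[of _ 0]) (auto intro: poly.const)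
next
  fix f g assume "fraction n D f" "fraction n D g"
  then obtain p k q m where p: "polynomial_fun n p" "\<And>A. D A \<noteq> 0 \<Longrightarrow> f A = p A / D A ^ k"
      and q: "polynomial_fun n q" "\<And>A. D A \<noteq> 0 \<Longrightarrow> g A = q A / D A ^ m"
    by (auto simp: fraction_def)
  show "fraction n D (\<lambda>x. f x + g x)"
    unfolding fraction_def
    by (rule exI[of _ "\<lambda>A. p A * D A ^ m + q A * D A ^ k"], rule exI[of _ "k + m"])
      (use p q D in \<open>auto intro!: poly.add poly.mult poly.power simp: field_simps power_add\<close>)
  show "fraction n D (\<lambda>x. f x * g x)"
    unfolding fraction_def
    by (rule exI[of _ "\<lambda>A. p A * q A"], rule exI[of _ "k + m"])
      (use p q D in \<open>auto intro!: poly.mult simp: power_add\<close>)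
qed

lemma fraction_poly: "polynomial_fun n p \<Longrightarrow> fraction n D p"
  unfolding fraction_def by (intro exI[of _ p] exI[of _ 0]) auto

text \<open>The product of two polynomials shows that the generating sets are closed under
  intersection; hence they form a basis.\<close>

lemma openin_GL_zariski:
  "openin (GL_zariski n) S \<longleftrightarrow> S \<subseteq> GL n \<and>
     (\<forall>A\<in>S. \<exists>r. polynomial_fun n r \<and> r A \<noteq> 0 \<and> {B \<in> GL n. r B \<noteq> 0} \<subseteq> S)" (is "?L = ?R")
proof
  assume ?L
  then have "generate_topology_on {{A \<in> GL n. p A \<noteq> 0} | p. polynomial_fun n p} S"
    unfolding GL_zariski_def by (simp add: openin_topology_generated_by_iff)
  then show ?R
  proof induction
    case (Int a b)
    have "\<exists>r. polynomial_fun n r \<and> r A \<noteq> 0 \<and> {B \<in> GL n. r B \<noteq> 0} \<subseteq> a \<inter> b" if A: "A \<in> a \<inter> b" for A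
    proof -
      obtain r s where "polynomial_fun n r" "r A \<noteq> 0" "{B \<in> GL n. r B \<noteq> 0} \<subseteq> a"
          "polynomial_fun n s" "s A \<noteq> 0" "{B \<in> GL n. s B \<noteq> 0} \<subseteq> b"
        using Int.IH A by blast
      then show ?thesis by (intro exI[of _ "\<lambda>B. r B * s B"]) (auto intro: poly.mult)
    qed
    then show ?case using Int.IH by blast
  next
    case (UN K)
    then show ?case by (auto simp: subset_iff) (metis (no_types, lifting))
  qed auto
next
  assume R: ?R
  have "openin (GL_zariski n) {B \<in> GL n. r B \<noteq> 0}" if "polynomial_fun n r" for r
    unfolding GL_zariski_def using that by (intro topology_generated_by_Basis) auto
  then show ?L
    using R by (subst openin_subopen) blast
qed

section \<open>Triangular factorization\<close>

definition lower_triangular :: "nat \<Rightarrow> complex mat \<Rightarrow> bool" where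
  "lower_triangular n B \<longleftrightarrow> (\<forall>i j. i < j \<longrightarrow> j < n \<longrightarrow> B $$ (i, j) = 0)"

definition lead :: "complex mat \<Rightarrow> nat \<Rightarrow> complex mat" where
  "lead g k = mat k k (\<lambda>(i, j). g $$ (i, j))"

text \<open>Row \<open>k\<close> is the last row of the adjugate of the leading block of size \<open>k + 1\<close>; the adjugate
  identity for that block says that multiplication by this row clears row \<open>k\<close> below the diagonal.\<close>

definition elim_mat :: "nat \<Rightarrow> complex mat \<Rightarrow> complex mat" where
  "elim_mat n g = mat n n (\<lambda>(k, j). if j \<le> k then adj_mat (lead g (Suc k)) $$ (k, j) else 0)"

lemma lead_carrier: "lead g k \<in> carrier_mat k k"
  by (simp add: lead_def)

lemma elim_mat_carrier: "elim_mat n g \<in> carrier_mat n n"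
  by (simp add: elim_mat_def)

lemma lower_triangular_elim_mat: "lower_triangular n (elim_mat n g)"
  by (auto simp: lower_triangular_def elim_mat_def)

lemma elim_mat_mult:
  assumes g: "g \<in> carrier_mat n n" and kj: "k < n" "j \<le> k"
  shows "(elim_mat n g * g) $$ (k, j) = (if j = k then det (lead g (Suc k)) else 0)"
proof -
  let ?G = "lead g (Suc k)"
  have "(elim_mat n g * g) $$ (k, j) = (\<Sum>i\<in>{0..<n}. (if i \<le> k then adj_mat ?G $$ (k, i) else 0) * g $$ (i, j))"
    using g kj by (auto simp: scalar_prod_def elim_mat_def intro!: sum.cong)
  also have "\<dots> = (\<Sum>i\<in>{0..<Suc k}. adj_mat ?G $$ (k, i) * ?G $$ (i, j))"
    using kj by (intro sum.mono_neutral_cong_right) (auto simp: lead_def)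
  also have "\<dots> = (adj_mat ?G * ?G) $$ (k, j)"
    using kj adj_mat(1)[OF lead_carrier[of g "Suc k"]] lead_carrier[of g "Suc k"]
    by (auto simp: scalar_prod_def intro!: sum.cong)
  also have "\<dots> = (if j = k then det ?G else 0)"
    using kj adj_mat(3)[OF lead_carrier[of g "Suc k"]] by auto
  finally show ?thesis .
qed

lemma upper_triangular_elim_mat_mult:
  assumes "g \<in> carrier_mat n n"
  shows "upper_triangular (elim_mat n g * g)"
  using elim_mat_mult[OF assms] elim_mat_carrier[of n g] by (auto simp: upper_triangular_def)

text \<open>For \<open>M = M'\<close> the quotient of the two matrices is the identity, and
  elimination has to leave it unchanged.\<close>

lemma elim_mat_one: "elim_mat n (1\<^sub>m n) = 1\<^sub>m n"
proof -
  have "adj_mat (lead (1\<^sub>m n) (Suc k)) = (1\<^sub>m (Suc k) :: complex mat)" if "k < n" for k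
  proof -
    have "lead (1\<^sub>m n) (Suc k) = 1\<^sub>m (Suc k)" using that by (auto simp: lead_def intro!: eq_matI)
    moreover have "adj_mat (1\<^sub>m (Suc k)) = (1\<^sub>m (Suc k) :: complex mat)"
      using adj_mat(1,3)[of "1\<^sub>m (Suc k) :: complex mat" "Suc k"] by (auto intro!: eq_matI)
    ultimately show ?thesis by simp
  qed
  then show ?thesis by (auto simp: elim_mat_def intro!: eq_matI)
qed

lemma (in fun_algebra) mats_elim_mat:
  assumes M: "mats n n M"
  shows "mats n n (\<lambda>x. elim_mat n (M x))"
  unfolding elim_mat_def
proof (rule mats_mat)
  fix k j assume kj: "k < n" "j < n"
  have "mats (Suc k) (Suc k) (\<lambda>x. lead (M x) (Suc k))"
    unfolding lead_def using kj by (intro mats_mat matsD[OF M]) auto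
  from mats_adj[OF this] show "P (\<lambda>x. if j \<le> k then adj_mat (lead (M x) (Suc k)) $$ (k, j) else 0)"
    using kj by (cases "j \<le> k") (auto intro: matsD const)
qed

lemma det_lower:
  assumes "B \<in> carrier_mat n n" "lower_triangular n B"
  shows "det B = (\<Prod>i<n. B $$ (i, i))"
  using det_lower_triangular[of n B] assms
  by (auto simp: lower_triangular_def prod_list_diag_prod atLeast0LessThan)

definition unipotent_lower :: "nat \<Rightarrow> complex mat \<Rightarrow> bool" where
  "unipotent_lower n l \<longleftrightarrow> l \<in> carrier_mat n n \<and> lower_triangular n l \<and> (\<forall>i<n. l $$ (i, i) = 1)"

lemma det_unipotent_lower: "unipotent_lower n l \<Longrightarrow> det l = 1"
  using det_lower[of l n] by (simp add: unipotent_lower_def)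

text \<open>Rows of \<open>T\<close> are found from the top: row \<open>i\<close> of the product
  involves rows up to \<open>i\<close>, and the earlier ones are already rows of the identity. Hence
  a flag has at most one representative \<open>A0 * l\<close> with \<open>l\<close> unipotent lower
  triangular.\<close>

lemma unipotent_lower_unique:
  assumes l: "unipotent_lower n l" and l': "unipotent_lower n l'"
    and T: "T \<in> carrier_mat n n" "upper_triangular T" and eq: "l' = l * T"
  shows "l' = l"
proof -
  have lc: "l \<in> carrier_mat n n" using l by (simp add: unipotent_lower_def)
  have "\<forall>j<n. T $$ (i, j) = (if i = j then 1 else 0)" if "i < n" for i
    using that
  proof (induction i rule: less_induct)
    case (less i)
    show ?case
    proof (intro allI impI)
      fix j assume j: "j < n"
      show "T $$ (i, j) = (if i = j then 1 else 0)"
      proof (cases "j < i")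
        case True
        then show ?thesis using T less.prems by (auto simp: upper_triangular_def)
      next
        case False
        have "l' $$ (i, j) = (\<Sum>k\<in>{0..<n}. l $$ (i, k) * T $$ (k, j))"
          using eq lc T less.prems j by (auto simp: scalar_prod_def intro!: sum.cong)
        also have "\<dots> = (\<Sum>k\<in>{0..<n}. if k = i then T $$ (i, j) else 0)"
        proof (rule sum.cong)
          fix k assume k: "k \<in> {0..<n}"
          show "l $$ (i, k) * T $$ (k, j) = (if k = i then T $$ (i, j) else 0)"
            using l less k False j
            by (cases k i rule: linorder_cases) (auto simp: unipotent_lower_def lower_triangular_def)
        qed simp
        also have "\<dots> = T $$ (i, j)" using less.prems by simp
        finally show ?thesis using l' False less.prems j
          by (auto simp: unipotent_lower_def lower_triangular_def)
      qed
    qed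
  qed
  then have "T = 1\<^sub>m n" using T by (auto intro!: eq_matI)
  then show ?thesis using eq lc by simp
qed

text \<open>\<open>lower_part n g\<close> is the unipotent lower triangular factor of \<open>g\<close> in its LU factorization,
  which exists where \<open>lead_minors n g\<close> is nonzero.\<close>

definition lead_minors :: "nat \<Rightarrow> complex mat \<Rightarrow> complex" where
  "lead_minors n g = (\<Prod>k<n. det (lead (transpose_mat g) (Suc k)))"

definition lower_part :: "nat \<Rightarrow> complex mat \<Rightarrow> complex mat" where
  "lower_part n g = g * (transpose_mat (elim_mat n (transpose_mat g)) *
     mat_diag n (\<lambda>k. 1 / det (lead (transpose_mat g) (Suc k))))"

text \<open>Transposing \<open>elim_mat_mult\<close> turns row elimination into column elimination:
  \<open>g * E\<close> is lower triangular with the leading minors \<open>d k\<close> on its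
  diagonal, and rescaling the columns makes it unipotent.\<close>

lemma lower_part:
  assumes g: "g \<in> carrier_mat n n" and nz: "lead_minors n g \<noteq> 0"
  shows "unipotent_lower n (lower_part n g)"
    and "\<exists>T. T \<in> carrier_mat n n \<and> upper_triangular T \<and> lower_part n g = g * T"
proof -
  define E where "E = transpose_mat (elim_mat n (transpose_mat g))"
  define d where "d = (\<lambda>k. det (lead (transpose_mat g) (Suc k)))"
  have E: "E \<in> carrier_mat n n" using elim_mat_carrier[of n "transpose_mat g"] by (simp add: E_def)
  have gt: "transpose_mat g \<in> carrier_mat n n" using g by simp
  have d: "d k \<noteq> 0" if "k < n" for k using nz that by (auto simp: lead_minors_def d_def)
  have gE: "(g * E) $$ (j, k) = (if j = k then d k else 0)" if "j \<le> k" "k < n" for j k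
  proof -
    have "g * E = transpose_mat (elim_mat n (transpose_mat g) * transpose_mat g)"
      unfolding E_def using transpose_mult[OF elim_mat_carrier[of n "transpose_mat g"] gt] g by simp
    then show ?thesis
      using elim_mat_mult[OF gt that(2,1)] that elim_mat_carrier[of n "transpose_mat g"] g
      by (simp add: d_def)
  qed
  have lp: "lower_part n g = (g * E) * mat_diag n (\<lambda>k. 1 / d k)"
    unfolding lower_part_def using assoc_mult_mat[OF g E mat_diag_dim] by (simp add: E_def d_def)
  have lp': "lower_part n g = mat n n (\<lambda>(i, k). (g * E) $$ (i, k) / d k)"
    unfolding lp using mat_diag_mult_right[of "g * E" n n "\<lambda>k. 1 / d k"] g E by simp
  show "unipotent_lower n (lower_part n g)"
    unfolding lp' unipotent_lower_def lower_triangular_def using gE d by auto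
  have "upper_triangular E"
    using lower_triangular_elim_mat[of n "transpose_mat g"] elim_mat_carrier[of n "transpose_mat g"]
    by (auto simp: upper_triangular_def E_def lower_triangular_def)
  then have "upper_triangular (E * mat_diag n (\<lambda>k. 1 / d k))"
    using E mat_diag_mult_right[OF E, of "\<lambda>k. 1 / d k"] by (auto simp: upper_triangular_def)
  moreover have "E * mat_diag n (\<lambda>k. 1 / d k) \<in> carrier_mat n n" using E by (simp add: mat_diag_def)
  ultimately show "\<exists>T. T \<in> carrier_mat n n \<and> upper_triangular T \<and> lower_part n g = g * T"
    unfolding lower_part_def E_def d_def by blast
qed

lemma lead_minors_one: "lead_minors n (1\<^sub>m n) = 1"
proof -
  have "lead (transpose_mat (1\<^sub>m n)) (Suc k) = 1\<^sub>m (Suc k)" if "k < n" for k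
    using that by (auto simp: lead_def intro!: eq_matI)
  then show ?thesis by (simp add: lead_minors_def)
qed

lemma lower_part_one: "lower_part n (1\<^sub>m n) = 1\<^sub>m n"
proof -
  obtain T where T: "T \<in> carrier_mat n n" "upper_triangular T" "lower_part n (1\<^sub>m n) = 1\<^sub>m n * T"
    using lower_part(2)[of "1\<^sub>m n" n] lead_minors_one by auto
  have "unipotent_lower n (1\<^sub>m n)" by (auto simp: unipotent_lower_def lower_triangular_def)
  moreover have "unipotent_lower n (lower_part n (1\<^sub>m n))"
    using lower_part(1)[of "1\<^sub>m n" n] lead_minors_one by simp
  ultimately show ?thesis using unipotent_lower_unique T by blast
qed

lemma (in fun_algebra) mats_lead_minors:
  assumes M: "mats n n M" and "k \<le> n"
  shows "P (\<lambda>x. det (lead (transpose_mat (M x)) k))"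
proof (rule det)
  show "mats k k (\<lambda>x. lead (transpose_mat (M x)) k)"
    unfolding lead_def using assms(2) by (intro mats_mat matsD[OF mats_transpose[OF M]]) auto
qed

lemma fraction_lower_part:
  assumes M: "poly.mats n n n M"
  shows "fun_algebra.mats (fraction n (\<lambda>A. lead_minors n (M A))) n n (\<lambda>A. lower_part n (M A))"
proof -
  let ?D = "\<lambda>A. lead_minors n (M A)"
  let ?d = "\<lambda>A k. det (lead (transpose_mat (M A)) (Suc k))"
  have d: "polynomial_fun n (\<lambda>A. ?d A k)" if "k < n" for k
    using that by (intro poly.mats_lead_minors[OF M]) simp
  have D: "polynomial_fun n ?D"
    unfolding lead_minors_def using d by (intro poly.prod) auto
  interpret fr: fun_algebra "fraction n ?D" by (rule fun_algebra_fraction[OF D])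
  have lift: "fr.mats k l N" if "poly.mats n k l N" for k l N
    using that by (auto simp: fr.mats_def poly.mats_def intro: fraction_poly)
  \<comment> \<open>A single minor is inverted by expanding with all the others; the common
    denominator stays the product of all minors.\<close>
  have inv: "fraction n ?D (\<lambda>A. 1 / ?d A k)" if k: "k < n" for k
    unfolding fraction_def
  proof (intro exI conjI allI impI)
    show "polynomial_fun n (\<lambda>A. \<Prod>j\<in>{..<n} - {k}. ?d A j)" using d by (intro poly.prod) auto
    fix A assume nz: "?D A \<noteq> 0"
    have "?D A = ?d A k * (\<Prod>j\<in>{..<n} - {k}. ?d A j)"
      unfolding lead_minors_def using k by (intro prod.remove) auto
    then show "1 / ?d A k = (\<Prod>j\<in>{..<n} - {k}. ?d A j) / ?D A ^ 1"
      using nz by (simp add: field_simps)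
  qed
  have "fr.mats n n (\<lambda>A. mat_diag n (\<lambda>k. 1 / ?d A k))"
    unfolding mat_diag_def
  proof (rule fr.mats_mat)
    fix i j assume "i < n" "j < n"
    then show "fraction n ?D (\<lambda>A. if i = j then 1 / ?d A j else 0)"
      using inv[of j] fr.const[of 0] by (cases "i = j") simp_all
  qed
  then show ?thesis
    unfolding lower_part_def
    by (rule fr.mats_mult[OF lift[OF M] fr.mats_mult[OF lift[OF
          poly.mats_transpose[OF poly.mats_elim_mat[OF poly.mats_transpose[OF M]]]]]])
qed

section \<open>Intersections of opposite Schubert varieties are reduced\<close>

text \<open>The preimage of the image is the union of the translates of the principal open set by
  upper triangular matrices. Near \<open>A\<close> the translate by one \<open>T\<close>
  suffices.\<close>

lemma openin_Fl_zariski_image: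
  assumes s: "polynomial_fun n s"
  shows "openin (Fl_zariski n) (flag_of n ` {A \<in> GL n. s A \<noteq> 0})"
  unfolding openin_Fl_zariski openin_GL_zariski
proof (intro conjI ballI)
  show "flag_of n ` {A \<in> GL n. s A \<noteq> 0} \<subseteq> Fl n" using flag_of_in_Fl by auto
next
  fix A assume "A \<in> {A \<in> GL n. flag_of n A \<in> flag_of n ` {A \<in> GL n. s A \<noteq> 0}}"
  then obtain A1 where A: "A \<in> GL n" "A1 \<in> GL n" "s A1 \<noteq> 0" "flag_of n A = flag_of n A1" by auto
  obtain T where T: "T \<in> GL n" "upper_triangular T" "A1 = A * T" using flag_of_eqE[OF A(1,2,4)] .
  have "polynomial_fun n (\<lambda>B. s (mat n n (\<lambda>(i, j). \<Sum>k<n. B $$ (i, k) * T $$ (k, j))))"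
    using GL_carrier[OF T(1)] by (intro poly.subst[OF s]) (simp add: poly_entry_mult)
  moreover have eq: "mat n n (\<lambda>(i, j). \<Sum>k<n. B $$ (i, k) * T $$ (k, j)) = B * T" if "B \<in> GL n" for B
    using GL_carrier[OF T(1)] GL_carrier[OF that]
    by (intro eq_matI) (auto simp: scalar_prod_def atLeast0LessThan intro!: sum.cong)
  moreover have "flag_of n B \<in> flag_of n ` {A \<in> GL n. s A \<noteq> 0}" if "B \<in> GL n" "s (B * T) \<noteq> 0" for B
    using flag_of_mult_upper[OF that(1) T(1,2)] GL_mult[OF that(1) T(1)] that(2) by (metis (mono_tags) image_eqI mem_Collect_eq)
  ultimately show "\<exists>r. polynomial_fun n r \<and> r A \<noteq> 0 \<and>
      {B \<in> GL n. r B \<noteq> 0} \<subseteq> {A \<in> GL n. flag_of n A \<in> flag_of n ` {A \<in> GL n. s A \<noteq> 0}}"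
    using A T by (intro exI[of _ "\<lambda>B. s (mat n n (\<lambda>(i, j). \<Sum>k<n. B $$ (i, k) * T $$ (k, j)))"]) auto
qed auto

lemma regular_funs_image:
  assumes s: "polynomial_fun n s" and N: "polynomial_fun n N" and D: "polynomial_fun n D"
    and F: "\<And>A. A \<in> GL n \<Longrightarrow> s A \<noteq> 0 \<Longrightarrow> D A \<noteq> 0 \<and> F (flag_of n A) = N A / D A"
  shows "F \<in> regular_funs n (flag_of n ` {A \<in> GL n. s A \<noteq> 0})"
  unfolding regular_funs_def GL_regular_def mem_Collect_eq
proof (intro ballI)
  fix A assume "A \<in> {A \<in> GL n. flag_of n A \<in> flag_of n ` {A \<in> GL n. s A \<noteq> 0}}"
  then obtain A1 where A: "A \<in> GL n" "A1 \<in> GL n" "s A1 \<noteq> 0" "flag_of n A = flag_of n A1" by auto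
  obtain T where T: "T \<in> GL n" "upper_triangular T" "A1 = A * T" using flag_of_eqE[OF A(1,2,4)] .
  let ?m = "\<lambda>B. mat n n (\<lambda>(i, j). \<Sum>k<n. B $$ (i, k) * T $$ (k, j))"
  have eq: "?m B = B * T" if "B \<in> GL n" for B
    using GL_carrier[OF T(1)] GL_carrier[OF that]
    by (intro eq_matI) (auto simp: scalar_prod_def atLeast0LessThan intro!: sum.cong)
  have sub: "polynomial_fun n (\<lambda>B. p (?m B))" if "polynomial_fun n p" for p
    using GL_carrier[OF T(1)] by (intro poly.subst[OF that]) (simp add: poly_entry_mult)
  show "\<exists>p q. polynomial_fun n p \<and> polynomial_fun n q \<and> q A \<noteq> 0 \<and>
      (\<forall>B\<in>{A \<in> GL n. flag_of n A \<in> flag_of n ` {A \<in> GL n. s A \<noteq> 0}}.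
        q B \<noteq> 0 \<longrightarrow> F (flag_of n B) = p B / q B)"
  proof (intro exI conjI ballI impI)
    \<comment> \<open>The factor \<open>s (?m B)\<close> forces \<open>B * T\<close> into the set
      where the quotient formula is known to hold.\<close>
    show "polynomial_fun n (\<lambda>B. N (?m B) * s (?m B))" "polynomial_fun n (\<lambda>B. D (?m B) * s (?m B))"
      using s N D by (auto intro!: poly.mult sub)
    show "D (?m A) * s (?m A) \<noteq> 0" using F[OF A(2,3)] A T eq by auto
    fix B assume B: "B \<in> {A \<in> GL n. flag_of n A \<in> flag_of n ` {A \<in> GL n. s A \<noteq> 0}}"
      "D (?m B) * s (?m B) \<noteq> 0"
    then have "B \<in> GL n" "s (B * T) \<noteq> 0" using eq by auto
    then show "F (flag_of n B) = N (?m B) * s (?m B) / (D (?m B) * s (?m B))"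
      using F[OF GL_mult[OF _ T(1)], of B] eq flag_of_mult_upper[OF _ T(1,2), of B] by simp
  qed
qed

text \<open>Near \<open>(A0, A0)\<close> factor \<open>M * M'\<^sup>-\<^sup>1\<close> into a lower and an upper triangular matrix. This gives a
  matrix \<open>N\<close> which lies in both matrix Schubert varieties if \<open>M\<close> lies in the first and \<open>M'\<close> in the
  second one, and which equals \<open>M\<close> if \<open>M = M'\<close>. Hence a function that vanishes on the intersection
  pulls back, along \<open>(M, M') \<mapsto> N\<close>, to a function that vanishes on a product of varieties. Such
  a function splits, and restriction to the diagonal splits the original function. The section
  \<open>A0 * lower_part\<close> of the quotient map makes the summands functions of flags.\<close>

lemma local_splitting:
  assumes S1: "\<And>A B. A \<in> GL n \<Longrightarrow> B \<in> GL n \<Longrightarrow> lower_triangular n B \<Longrightarrow> flag_of n A \<in> S1 \<Longrightarrow> flag_of n (B * A) \<in> S1"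
    and S2: "\<And>A B. A \<in> GL n \<Longrightarrow> B \<in> GL n \<Longrightarrow> upper_triangular B \<Longrightarrow> flag_of n A \<in> S2 \<Longrightarrow> flag_of n (B * A) \<in> S2"
    and U: "openin (Fl_zariski n) U" and f: "f \<in> regular_funs n U"
    and f0: "\<And>L. L \<in> U \<Longrightarrow> L \<in> S1 \<Longrightarrow> L \<in> S2 \<Longrightarrow> f L = 0"
    and L: "L \<in> U"
  shows "\<exists>V. openin (Fl_zariski n) V \<and> L \<in> V \<and> V \<subseteq> U \<and>
    (\<exists>g\<in>reduced_subscheme n S1 V. \<exists>h\<in>reduced_subscheme n S2 V. \<forall>M\<in>V. f M = g M + h M)"
proof -
  have "L \<in> Fl n" using U L by (auto simp: openin_Fl_zariski)
  then obtain A0 where A0: "A0 \<in> GL n" "flag_of n A0 = L" by (rule Fl_flag_of)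
  note A0c = GL_carrier[OF A0(1)]
  obtain A0i where A0i: "A0i \<in> GL n" "A0 * A0i = 1\<^sub>m n" "A0i * A0 = 1\<^sub>m n" by (rule GL_inverse[OF A0(1)])
  note A0ic = GL_carrier[OF A0i(1)]
  have detA0: "det A0 \<noteq> 0" using A0 by (simp add: GL_iff_det)
  obtain p q0 where pq0: "polynomial_fun n p" "polynomial_fun n q0" "q0 A0 \<noteq> 0"
      "\<And>B. B \<in> GL n \<Longrightarrow> flag_of n B \<in> U \<Longrightarrow> q0 B \<noteq> 0 \<Longrightarrow> f (flag_of n B) = p B / q0 B"
    using f A0 L unfolding regular_funs_def GL_regular_def by fastforce
  obtain r where r: "polynomial_fun n r" "r A0 \<noteq> 0" "\<And>B. B \<in> GL n \<Longrightarrow> r B \<noteq> 0 \<Longrightarrow> flag_of n B \<in> U"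
    using U A0 L unfolding openin_Fl_zariski openin_GL_zariski by fastforce
  \<comment> \<open>A single polynomial whose nonvanishing puts the flag into \<open>U\<close> and
    makes the local formula for \<open>f\<close> valid.\<close>
  define q where "q = (\<lambda>B. q0 B * r B)"
  have q: "polynomial_fun n q" "q A0 \<noteq> 0" using pq0 r by (auto simp: q_def intro: poly.mult)
  have fU: "flag_of n B \<in> U" if "B \<in> GL n" "q B \<noteq> 0" for B
    using that r(3) by (simp add: q_def)
  have fq: "f (flag_of n B) = p B * r B / q B" if "B \<in> GL n" "q B \<noteq> 0" for B
    using that pq0(4)[OF that(1) fU[OF that]] by (simp add: q_def)

  \<comment> \<open>The inverse of a matrix with determinant \<open>det A0\<close> is its adjugate
    divided by that constant, hence polynomial in the entries.\<close>
  define X where "X = {M \<in> GL n. det M = det A0 \<and> flag_of n M \<in> S1}"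
  define Y where "Y = {M \<in> GL n. det M = det A0 \<and> flag_of n M \<in> S2}"
  \<comment> \<open>Cuts off entries outside of the range, since the algebras consist of functions on all matrices.\<close>
  define coord where "coord = (\<lambda>M. mat n n (\<lambda>(i, j). M $$ (i, j)) :: complex mat)"
  have coord: "coord M = M" if "M \<in> carrier_mat n n" for M using that by (auto simp: coord_def intro!: eq_matI)
  have m1: "bipoly.mats n n n (\<lambda>x. coord (fst x))" and m2: "bipoly.mats n n n (\<lambda>x. coord (snd x))"
    unfolding coord_def
    by (intro bipoly.mats_mat bipolynomial_fst bipolynomial_snd polynomial_fun.entry; simp)+
  \<comment> \<open>This is \<open>M * M'^-1\<close>. With the elimination matrix \<open>E\<close>
    one has \<open>N = E * M = (E * g) * M'\<close>, a lower triangular multiple of \<open>M\<close>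
    and an upper triangular multiple of \<open>M'\<close>.\<close>
  define g where "g = (\<lambda>x. coord (fst x) * (mat_diag n (\<lambda>_. 1 / det A0) * adj_mat (coord (snd x))))"
  define N where "N = (\<lambda>x. elim_mat n (g x) * coord (fst x))"
  have mg: "bipoly.mats n n n g"
    unfolding g_def by (rule bipoly.mats_mult[OF m1 bipoly.mats_mult[OF bipoly.mats_const[OF mat_diag_dim] bipoly.mats_adj[OF m2]]])
  have mN: "bipoly.mats n n n N"
    unfolding N_def by (rule bipoly.mats_mult[OF bipoly.mats_elim_mat[OF mg] m1])
  note gc = bipoly.mats_carrier[OF mg] and Nc = bipoly.mats_carrier[OF mN]
  have adj: "(mat_diag n (\<lambda>_. 1 / det A0) * adj_mat M) * M = 1\<^sub>m n"
    if "M \<in> GL n" "det M = det A0" for M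
  proof -
    have M: "M \<in> carrier_mat n n" using that by (simp add: GL_carrier)
    have "(mat_diag n (\<lambda>_. 1 / det A0) * adj_mat M) * M = mat_diag n (\<lambda>_. 1 / det A0) * (adj_mat M * M)"
      by (rule assoc_mult_mat[OF mat_diag_dim adj_mat(1)[OF M] M])
    also have "\<dots> = 1\<^sub>m n"
      unfolding adj_mat(3)[OF M] using that detA0
      by (subst mat_diag_mult_left[of _ n n]) (auto intro!: eq_matI)
    finally show ?thesis .
  qed
  have gM: "g (M, M') * M' = M" if "M \<in> carrier_mat n n" "M' \<in> GL n" "det M' = det A0" for M M'
  proof -
    have M': "M' \<in> carrier_mat n n" using that by (simp add: GL_carrier)
    have "g (M, M') * M' = M * ((mat_diag n (\<lambda>_. 1 / det A0) * adj_mat M') * M')"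
      using assoc_mult_mat[OF that(1) mult_carrier_mat[OF mat_diag_dim adj_mat(1)[OF M']] M'] that(1) M'
      by (simp add: g_def coord)
    then show ?thesis using adj[OF that(2,3)] that by simp
  qed
  have N1: "N (M, M) = M" if "M \<in> GL n" "det M = det A0" for M
  proof -
    have M: "M \<in> carrier_mat n n" using that by (simp add: GL_carrier)
    let ?I = "mat_diag n (\<lambda>_. 1 / det A0) * adj_mat M"
    have "?I \<in> carrier_mat n n" using adj_mat(1)[OF M] by (auto simp: mat_diag_def)
    then have "M * ?I = 1\<^sub>m n" using mat_mult_left_right_inverse[OF _ M adj[OF that]] by simp
    then have "g (M, M) = 1\<^sub>m n" using M by (simp add: g_def coord)
    then show ?thesis using M by (simp add: N_def coord elim_mat_one)
  qed
  \<comment> \<open>Since \<open>f\<close> equals \<open>p * r / q\<close>, the factor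
    \<open>q * det N\<close> makes the product vanish also where \<open>N\<close> is singular or the
    formula is not valid.\<close>
  define \<phi> where "\<phi> = (\<lambda>x. (p (N x) * r (N x)) * (q (N x) * det (N x)))"
  have sub: "bipolynomial n (\<lambda>x. P (N x))" if "polynomial_fun n P" for P
    by (rule bipoly.subst[OF that]) (rule bipoly.matsD[OF mN])
  have \<phi>: "bipolynomial n \<phi>"
    unfolding \<phi>_def
    by (rule bipoly.mult[OF bipoly.mult[OF sub[OF pq0(1)] sub[OF r(1)]]
          bipoly.mult[OF sub[OF q(1)] bipoly.det[OF mN]]])
  have "\<phi> (M, M') = 0" if M: "M \<in> X" and M': "M' \<in> Y" for M M'
  proof (rule ccontr)
    assume nz: "\<phi> (M, M') \<noteq> 0"
    let ?N = "N (M, M')" and ?E = "elim_mat n (g (M, M'))"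
    have Mg: "M \<in> GL n" "M' \<in> GL n" "det M = det A0" "det M' = det A0" using M M' by (auto simp: X_def Y_def)
    have Mc: "M \<in> carrier_mat n n" and M'c: "M' \<in> carrier_mat n n" using Mg by (auto simp: GL_carrier)
    have NGL: "?N \<in> GL n" and qN: "q ?N \<noteq> 0" and pN: "p ?N * r ?N \<noteq> 0"
      using nz Nc by (auto simp: GL_iff_det \<phi>_def)
    have N1: "?N = ?E * M" using Mc by (simp add: N_def coord)
    have N2: "?N = (?E * g (M, M')) * M'"
      using N1 gM[OF Mc Mg(2,4)] assoc_mult_mat[OF elim_mat_carrier gc M'c] by simp
    have Ec: "?E * g (M, M') \<in> carrier_mat n n" using elim_mat_carrier gc by (metis mult_carrier_mat)
    have "?E \<in> GL n" by (rule GL_multD(1)[OF _ elim_mat_carrier Mc]) (use NGL N1 in simp)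
    then have "flag_of n ?N \<in> S1"
      using S1[OF Mg(1) _ lower_triangular_elim_mat] M N1 by (simp add: X_def)
    moreover have "?E * g (M, M') \<in> GL n"
      by (rule GL_multD(1)[OF _ Ec M'c]) (use NGL N2 in simp)
    then have "flag_of n ?N \<in> S2"
      using S2[OF Mg(2) _ upper_triangular_elim_mat_mult[OF gc]] M' N2 by (simp add: Y_def)
    ultimately have "f (flag_of n ?N) = 0" using f0 fU[OF NGL qN] by blast
    then show False using fq[OF NGL qN] pN qN by simp
  qed
  then obtain G H where GH: "polynomial_fun n G" "polynomial_fun n H"
      "\<And>M. M \<in> X \<Longrightarrow> G M = 0" "\<And>M. M \<in> Y \<Longrightarrow> H M = 0" "\<And>M. \<phi> (M, M) = G M + H M"
    using bipolynomial_split[OF \<phi>] by metis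

  define ga where "ga = (\<lambda>A. A0i * coord A)"
  define D where "D = (\<lambda>A. lead_minors n (ga A))"
  \<comment> \<open>The representative of the flag of \<open>A\<close> in \<open>A0\<close> times
    the unipotent lower triangular group. Its determinant is \<open>det A0\<close>, so its
    membership in \<open>X\<close> or \<open>Y\<close> depends on the flag alone.\<close>
  define \<sigma> where "\<sigma> = (\<lambda>A. A0 * lower_part n (ga A))"
  have "poly.mats n n n coord"
    unfolding coord_def by (intro poly.mats_mat polynomial_fun.entry)
  then have mga: "poly.mats n n n ga"
    unfolding ga_def by (rule poly.mats_mult[OF poly.mats_const[OF A0ic]])
  note gac = poly.mats_carrier[OF mga]
  have Dp: "polynomial_fun n D"
    unfolding D_def lead_minors_def by (intro poly.prod poly.mats_lead_minors[OF mga]) auto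
  interpret fr: fun_algebra "fraction n D" by (rule fun_algebra_fraction[OF Dp])
  have m\<sigma>: "fr.mats n n \<sigma>"
    unfolding \<sigma>_def
    by (rule fr.mats_mult[OF fr.mats_const[OF A0c] fraction_lower_part[OF mga, folded D_def]])
  have frac: "fraction n D (\<lambda>A. P (\<sigma> A))" if "polynomial_fun n P" for P
    by (rule fr.subst[OF that]) (rule fr.matsD[OF m\<sigma>])
  have \<sigma>: "\<sigma> A \<in> GL n" "flag_of n (\<sigma> A) = flag_of n A" "det (\<sigma> A) = det A0"
    and \<sigma>_unip: "unipotent_lower n (lower_part n (ga A))"
    if A: "A \<in> GL n" "D A \<noteq> 0" for A
  proof -
    have nz: "lead_minors n (ga A) \<noteq> 0" using A by (simp add: D_def)
    note Ac = GL_carrier[OF A(1)]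
    show u: "unipotent_lower n (lower_part n (ga A))" by (rule lower_part(1)[OF gac nz])
    then have lc: "lower_part n (ga A) \<in> carrier_mat n n" by (simp add: unipotent_lower_def)
    show d: "det (\<sigma> A) = det A0"
      unfolding \<sigma>_def using det_mult[OF A0c lc] det_unipotent_lower[OF u] by simp
    show GL: "\<sigma> A \<in> GL n" using d detA0 A0c lc by (auto simp: GL_iff_det \<sigma>_def)
    obtain T where T: "T \<in> carrier_mat n n" "upper_triangular T" "lower_part n (ga A) = ga A * T"
      using lower_part(2)[OF gac nz] by blast
    have "\<sigma> A = A0 * ((A0i * A) * T)" unfolding \<sigma>_def T(3) by (simp add: ga_def coord[OF Ac])
    also have "\<dots> = A0 * (A0i * (A * T))" using assoc_mult_mat[OF A0ic Ac T(1)] by simp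
    also have "\<dots> = (A0 * A0i) * (A * T)" using assoc_mult_mat[OF A0c A0ic, of "A * T" n] Ac T(1) by simp
    also have "\<dots> = A * T" using A0i(2) Ac T(1) by simp
    finally have \<sigma>T: "\<sigma> A = A * T" .
    then have "T \<in> GL n" using GL_multD(2)[of A T n] GL Ac T(1) by simp
    then show "flag_of n (\<sigma> A) = flag_of n A" unfolding \<sigma>T by (rule flag_of_mult_upper[OF A(1) _ T(2)])
  qed
  \<comment> \<open>A choice of matrix makes this a function of flags; uniqueness of the unipotent
    factor makes it independent of the choice.\<close>
  define \<sigma>' where "\<sigma>' = (\<lambda>K. \<sigma> (SOME A. A \<in> GL n \<and> D A \<noteq> 0 \<and> flag_of n A = K))"
  have \<sigma>': "\<sigma>' (flag_of n A) = \<sigma> A" if A: "A \<in> GL n" "D A \<noteq> 0" for A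
  proof -
    define B where "B = (SOME B. B \<in> GL n \<and> D B \<noteq> 0 \<and> flag_of n B = flag_of n A)"
    have "B \<in> GL n \<and> D B \<noteq> 0 \<and> flag_of n B = flag_of n A"
      unfolding B_def by (rule someI[of _ A]) (use A in auto)
    then have B: "B \<in> GL n" "D B \<noteq> 0" "flag_of n B = flag_of n A" by auto
    let ?l = "lower_part n (ga A)" and ?l' = "lower_part n (ga B)"
    have lc: "?l \<in> carrier_mat n n" "?l' \<in> carrier_mat n n"
      using \<sigma>_unip[OF A] \<sigma>_unip[OF B(1,2)] by (auto simp: unipotent_lower_def)
    obtain T where T: "T \<in> GL n" "upper_triangular T" "\<sigma> B = \<sigma> A * T"
      using flag_of_eqE[OF \<sigma>(1)[OF A] \<sigma>(1)[OF B(1,2)]] \<sigma>(2)[OF A] \<sigma>(2)[OF B(1,2)] B(3) by metis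
    note Tc = GL_carrier[OF T(1)]
    have "A0i * (A0 * ?l') = A0i * (A0 * (?l * T))"
      using T(3) assoc_mult_mat[OF A0c lc(1) Tc] by (simp add: \<sigma>_def)
    then have "(A0i * A0) * ?l' = (A0i * A0) * (?l * T)"
      using assoc_mult_mat[OF A0ic A0c lc(2)] assoc_mult_mat[OF A0ic A0c, of "?l * T" n] lc Tc by simp
    then have "?l' = ?l * T" using A0i(3) lc Tc by simp
    then have "?l' = ?l" using unipotent_lower_unique[OF \<sigma>_unip[OF A] \<sigma>_unip[OF B(1,2)] Tc T(2)] by simp
    then show ?thesis unfolding \<sigma>'_def B_def[symmetric] by (simp add: \<sigma>_def)
  qed
  obtain q2 m where q2: "polynomial_fun n q2" "\<And>A. D A \<noteq> 0 \<Longrightarrow> q (\<sigma> A) = q2 A / D A ^ m"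
    using frac[OF q(1)] by (auto simp: fraction_def)
  \<comment> \<open>Where \<open>D\<close> is nonzero, nonvanishing of \<open>q2\<close> says that
    \<open>q\<close> is nonzero at the representative.\<close>
  define s where "s = (\<lambda>A. D A * q2 A)"
  have s: "polynomial_fun n s" unfolding s_def using Dp q2 by (auto intro: poly.mult)
  define V where "V = flag_of n ` {A \<in> GL n. s A \<noteq> 0}"
  have sD: "D A \<noteq> 0" "q (\<sigma> A) \<noteq> 0" if "s A \<noteq> 0" for A
    using that q2(2)[of A] by (auto simp: s_def)
  have openV: "openin (Fl_zariski n) V" unfolding V_def by (rule openin_Fl_zariski_image[OF s])
  have "ga A0 = 1\<^sub>m n" using A0i(3) by (simp add: ga_def coord[OF A0c])
  then have "D A0 = 1" "\<sigma> A0 = A0" using A0c by (simp_all add: D_def lead_minors_one \<sigma>_def lower_part_one)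
  then have "s A0 \<noteq> 0" using q2(2)[of A0] q(2) by (simp add: s_def)
  then have LV: "L \<in> V" unfolding V_def using A0 by auto
  have VU: "V \<subseteq> U"
    unfolding V_def
  proof (rule image_subsetI)
    fix A assume "A \<in> {A \<in> GL n. s A \<noteq> 0}"
    then have A: "A \<in> GL n" "s A \<noteq> 0" by auto
    show "flag_of n A \<in> U"
      using fU[OF \<sigma>(1)[OF A(1) sD(1)[OF A(2)]] sD(2)[OF A(2)]] \<sigma>(2)[OF A(1) sD(1)[OF A(2)]] by simp
  qed
  \<comment> \<open>On the diagonal, where \<open>q\<close> is nonzero, \<phi> equals
    \<open>f * q^2 * det A0\<close>; this is the origin of the denominator.\<close>
  define tr where "tr = (\<lambda>P K. P (\<sigma>' K) / (q (\<sigma>' K) * q (\<sigma>' K) * det A0) :: complex)"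
  have tr: "tr P \<in> regular_funs n V" if P: "polynomial_fun n P" for P
  proof -
    obtain P2 k where P2: "polynomial_fun n P2" "\<And>A. D A \<noteq> 0 \<Longrightarrow> P (\<sigma> A) = P2 A / D A ^ k"
      using frac[OF P] by (auto simp: fraction_def)
    show ?thesis
      unfolding V_def
    proof (rule regular_funs_image[OF s])
      show "polynomial_fun n (\<lambda>A. P2 A * (D A ^ m * D A ^ m))"
        "polynomial_fun n (\<lambda>A. D A ^ k * (q2 A * (q2 A * det A0)))"
        using P2 Dp q2 by (auto intro!: poly.mult poly.power poly.const)
      fix A assume A: "A \<in> GL n" "s A \<noteq> 0"
      have "tr P (flag_of n A) = P (\<sigma> A) / (q (\<sigma> A) * q (\<sigma> A) * det A0)"
        using \<sigma>'[OF A(1) sD(1)[OF A(2)]] by (simp add: tr_def)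
      also have "\<dots> = P2 A * (D A ^ m * D A ^ m) / (D A ^ k * (q2 A * (q2 A * det A0)))"
        unfolding P2(2)[OF sD(1)[OF A(2)]] q2(2)[OF sD(1)[OF A(2)]]
        using A(2) detA0 by (simp add: s_def field_simps)
      finally show "D A ^ k * (q2 A * (q2 A * det A0)) \<noteq> 0 \<and>
          tr P (flag_of n A) = P2 A * (D A ^ m * D A ^ m) / (D A ^ k * (q2 A * (q2 A * det A0)))"
        using A(2) detA0 by (simp add: s_def)
    qed
  qed
  have eq: "f K = tr G K + tr H K" if K: "K \<in> V" for K
  proof -
    obtain A where A: "A \<in> GL n" "s A \<noteq> 0" "K = flag_of n A" using K by (auto simp: V_def)
    note D = sD(1)[OF A(2)] and qs = sD(2)[OF A(2)]
    note sA = \<sigma>[OF A(1) D]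
    have "f K = p (\<sigma> A) * r (\<sigma> A) / q (\<sigma> A)" using fq[OF sA(1) qs] sA(2) A(3) by simp
    also have "\<dots> = \<phi> (\<sigma> A, \<sigma> A) / (q (\<sigma> A) * q (\<sigma> A) * det A0)"
      using qs detA0 sA(3) N1[OF sA(1,3)] by (simp add: \<phi>_def)
    also have "\<dots> = tr G K + tr H K"
      unfolding GH(5) tr_def A(3) \<sigma>'[OF A(1) D] by (rule add_divide_distrib)
    finally show ?thesis .
  qed
  have van: "tr P K = 0"
    if P: "\<And>M. M \<in> {M \<in> GL n. det M = det A0 \<and> flag_of n M \<in> S} \<Longrightarrow> P M = 0" and K: "K \<in> V \<inter> S" for P K S
  proof -
    obtain A where A: "A \<in> GL n" "s A \<noteq> 0" "K = flag_of n A" using K by (auto simp: V_def)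
    note sA = \<sigma>[OF A(1) sD(1)[OF A(2)]]
    have "P (\<sigma> A) = 0" using P sA K A(3) by auto
    then show ?thesis unfolding tr_def A(3) \<sigma>'[OF A(1) sD(1)[OF A(2)]] by simp
  qed
  have "tr G \<in> reduced_subscheme n S1 V" "tr H \<in> reduced_subscheme n S2 V"
    using tr[OF GH(1)] tr[OF GH(2)] van[of S1 G] van[of S2 H] GH(3,4)
    unfolding reduced_subscheme_def X_def Y_def by blast+
  then show ?thesis using openV LV VU eq by blast
qed

text \<open>The sheafified sum asks for local splittings, which have just been constructed.
  Conversely, a local sum of functions from both ideals vanishes on the intersection.\<close>

lemma reduced_subscheme_eq_inter:
  assumes S1: "\<And>A B. A \<in> GL n \<Longrightarrow> B \<in> GL n \<Longrightarrow> lower_triangular n B \<Longrightarrow> flag_of n A \<in> S1 \<Longrightarrow> flag_of n (B * A) \<in> S1"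
    and S2: "\<And>A B. A \<in> GL n \<Longrightarrow> B \<in> GL n \<Longrightarrow> upper_triangular B \<Longrightarrow> flag_of n A \<in> S2 \<Longrightarrow> flag_of n (B * A) \<in> S2"
  shows "same_subscheme n (reduced_subscheme n (S1 \<inter> S2))
    (scheme_inter n (reduced_subscheme n S1) (reduced_subscheme n S2))"
  unfolding same_subscheme_def
proof (intro allI impI equalityI subsetI)
  fix U f assume U: "openin (Fl_zariski n) U" and f: "f \<in> reduced_subscheme n (S1 \<inter> S2) U"
  then show "f \<in> scheme_inter n (reduced_subscheme n S1) (reduced_subscheme n S2) U"
    using local_splitting[OF S1 S2 U] unfolding reduced_subscheme_def[of n "S1 \<inter> S2"] scheme_inter_def
    by simp
next
  fix U f assume U: "openin (Fl_zariski n) U"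
    and f: "f \<in> scheme_inter n (reduced_subscheme n S1) (reduced_subscheme n S2) U"
  then show "f \<in> reduced_subscheme n (S1 \<inter> S2) U"
    by (fastforce simp: scheme_inter_def reduced_subscheme_def)
qed

text \<open>The nonvanishing locus is open: near a matrix with local formula \<open>p / q\<close> it
  contains the principal open set of \<open>p * q * r\<close>, where \<open>r\<close> keeps the flag
  inside \<open>U\<close>.\<close>

lemma regular_fun_vanishes_on_closure:
  assumes U: "openin (Fl_zariski n) U" and f: "f \<in> regular_funs n U"
    and f0: "\<And>K. K \<in> U \<Longrightarrow> K \<in> S \<Longrightarrow> f K = 0" and L: "L \<in> U" "L \<in> Fl_zariski n closure_of S"
  shows "f L = 0"
proof (rule ccontr)
  assume nz: "f L \<noteq> 0"
  define W where "W = {K \<in> U. f K \<noteq> 0}"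
  have "openin (Fl_zariski n) W"
    unfolding openin_Fl_zariski openin_GL_zariski
  proof (intro conjI ballI)
    show "W \<subseteq> Fl n" using U by (auto simp: W_def openin_Fl_zariski)
    fix A assume "A \<in> {A \<in> GL n. flag_of n A \<in> W}"
    then have A: "A \<in> GL n" "flag_of n A \<in> U" "f (flag_of n A) \<noteq> 0" by (auto simp: W_def)
    obtain p q where pq: "polynomial_fun n p" "polynomial_fun n q" "q A \<noteq> 0"
        "\<And>B. B \<in> GL n \<Longrightarrow> flag_of n B \<in> U \<Longrightarrow> q B \<noteq> 0 \<Longrightarrow> f (flag_of n B) = p B / q B"
      using f A unfolding regular_funs_def GL_regular_def by fastforce
    obtain r where r: "polynomial_fun n r" "r A \<noteq> 0" "\<And>B. B \<in> GL n \<Longrightarrow> r B \<noteq> 0 \<Longrightarrow> flag_of n B \<in> U"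
      using U A unfolding openin_Fl_zariski openin_GL_zariski by fastforce
    have "p A \<noteq> 0" using pq(4)[OF A(1,2) pq(3)] A(3) by auto
    then show "\<exists>r. polynomial_fun n r \<and> r A \<noteq> 0 \<and> {B \<in> GL n. r B \<noteq> 0} \<subseteq> {A \<in> GL n. flag_of n A \<in> W}"
      using pq r by (intro exI[of _ "\<lambda>B. p B * (q B * r B)"]) (auto intro!: poly.mult simp: W_def)
  qed auto
  moreover have "L \<in> W" using L nz by (simp add: W_def)
  ultimately obtain K where "K \<in> S" "K \<in> W" using L(2) by (auto simp: in_closure_of)
  then show False using f0 by (auto simp: W_def)
qed

section \<open>Adding a coordinate\<close>

text \<open>These are the steps of \<open>F_flag n\<close>, with \<open>j\<close> as the
  codimension.\<close>

definition low_zero :: "nat \<Rightarrow> nat \<Rightarrow> complex vec set" where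
  "low_zero n j = {v \<in> carrier_vec n. \<forall>k<n. k < j \<longrightarrow> v $ k = 0}"

definition tail :: "complex vec \<Rightarrow> complex vec" where
  "tail y = vec (dim_vec y - 1) (\<lambda>r. y $ Suc r)"

text \<open>The sum of the first coordinate axis and the copy of \<open>W\<close> in the hyperplane
  where the first coordinate vanishes.\<close>

definition cone :: "nat \<Rightarrow> complex vec set \<Rightarrow> complex vec set" where
  "cone n W = {y \<in> carrier_vec (Suc n). tail y \<in> W}"

abbreviation emb :: "complex vec \<Rightarrow> complex vec" where
  "emb \<equiv> vCons 0"

lemma tail_vCons [simp]: "tail (vCons c x) = x"
  by (auto simp: tail_def)

lemma tail_index [simp]: "y \<in> carrier_vec (Suc n) \<Longrightarrow> r < n \<Longrightarrow> tail y $ r = y $ Suc r"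
  by (auto simp: tail_def)

lemma tail_carrier [simp]: "y \<in> carrier_vec (Suc n) \<Longrightarrow> tail y \<in> carrier_vec n"
  by (auto simp: tail_def)

lemma vCons_carrier [simp]: "vCons c x \<in> carrier_vec (Suc n) \<longleftrightarrow> x \<in> carrier_vec n"
  by (metis Suc_inject carrier_dim_vec dim_vec_vCons)

lemma vCons_tail: "y \<in> carrier_vec (Suc n) \<Longrightarrow> vCons (y $ 0) (tail y) = y"
  by (rule eq_vecI) (auto simp: tail_def vec_index_vCons gr0_conv_Suc)

lemma csubspace_low_zero: "csubspace n (low_zero n j)"
  by (auto simp: csubspace_iff low_zero_def)

lemma emb_add:
  assumes "x \<in> carrier_vec n" "y \<in> carrier_vec n"
  shows "emb (x + y) = emb x + emb y"
  using assms by (intro eq_vecI) (auto simp: vec_index_vCons)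

lemma emb_smult: "emb (c \<cdot>\<^sub>v x) = c \<cdot>\<^sub>v emb (x :: complex vec)"
  by (intro eq_vecI) (auto simp: vec_index_vCons)

lemma linear_on_emb: "W \<subseteq> carrier_vec n \<Longrightarrow> linear_on n (Suc n) W emb"
  by (simp add: linear_on_def subset_iff emb_add[of _ n] emb_smult)

lemma tail_add:
  assumes "x \<in> carrier_vec (Suc n)" "y \<in> carrier_vec (Suc n)"
  shows "tail (x + y) = tail x + tail y"
  using assms by (intro eq_vecI) (auto simp: tail_def)

lemma tail_smult: "x \<in> carrier_vec (Suc n) \<Longrightarrow> tail (c \<cdot>\<^sub>v x) = c \<cdot>\<^sub>v tail x"
  by (intro eq_vecI) (auto simp: tail_def)

lemma linear_on_tail: "W \<subseteq> carrier_vec (Suc n) \<Longrightarrow> linear_on (Suc n) n W tail"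
  unfolding linear_on_def using tail_add[of _ n] tail_smult[of _ n] tail_carrier[of _ n] by blast

lemma csubspace_emb: "csubspace n W \<Longrightarrow> csubspace (Suc n) (emb ` W)"
  by (rule csubspace_image[OF _ linear_on_emb]) (auto simp: csubspace_iff)

lemma cdim_emb:
  assumes "csubspace n W"
  shows "cdim (Suc n) (emb ` W) = cdim n W"
proof (rule cdim_image[OF assms linear_on_emb])
  show "W \<subseteq> carrier_vec n" using assms by (simp add: csubspace_iff)
  fix x assume "emb x = 0\<^sub>v (Suc n)"
  then show "x = 0\<^sub>v n" using tail_vCons[of 0 x] by (simp add: tail_def) (auto intro!: eq_vecI)
qed

lemma csubspace_cone:
  assumes "csubspace n W"
  shows "csubspace (Suc n) (cone n W)"
proof -
  have "tail (0\<^sub>v (Suc n)) = 0\<^sub>v n" by (auto simp: tail_def)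
  then show ?thesis
    using assms by (auto simp: csubspace_iff cone_def tail_add[of _ n] tail_smult[of _ n])
qed

text \<open>Rank-nullity for \<open>tail\<close>, with image \<open>W\<close> and the first
  coordinate axis as kernel.\<close>

lemma cdim_cone:
  assumes W: "csubspace n W"
  shows "cdim (Suc n) (cone n W) = Suc (cdim n W)"
proof -
  have lin: "linear_on (Suc n) n (cone n W) tail"
    by (rule linear_on_tail) (auto simp: cone_def)
  have "tail ` cone n W = W"
  proof (intro equalityI subsetI)
    fix x assume "x \<in> W"
    then have "emb x \<in> cone n W" "x = tail (emb x)"
      using W by (auto simp: cone_def csubspace_iff)
    then show "x \<in> tail ` cone n W" by (rule rev_image_eqI)
  qed (auto simp: cone_def)
  moreover have "{y \<in> cone n W. tail y = 0\<^sub>v n} = std_flag (Suc n) 1"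
  proof (intro equalityI subsetI)
    fix y assume y: "y \<in> std_flag (Suc n) 1"
    then have "tail y = 0\<^sub>v n" by (auto simp: std_flag_def tail_def intro!: eq_vecI)
    then show "y \<in> {y \<in> cone n W. tail y = 0\<^sub>v n}"
      using y csubspaceD(2)[OF W] by (simp add: cone_def std_flag_def)
  next
    fix y assume y: "y \<in> {y \<in> cone n W. tail y = 0\<^sub>v n}"
    then have "y $ Suc r = 0" if "r < n" for r
      using tail_index[of y n r] that by (simp add: cone_def)
    then show "y \<in> std_flag (Suc n) 1"
      using y by (auto simp: cone_def std_flag_def Suc_le_eq gr0_conv_Suc)
  qed
  ultimately show ?thesis
    using rank_nullity_cdim[OF csubspace_cone[OF W] lin] cdim_std_flag[of 1 "Suc n"] by simp
qed

lemma emb_in_low_zero: "x \<in> carrier_vec n \<Longrightarrow> emb x \<in> low_zero (Suc n) (Suc j) \<longleftrightarrow> x \<in> low_zero n j"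
  by (simp add: low_zero_def All_less_Suc2)

lemma emb_in_std: "x \<in> carrier_vec n \<Longrightarrow> emb x \<in> std_flag (Suc n) (Suc k) \<longleftrightarrow> x \<in> std_flag n k"
  by (simp add: std_flag_def All_less_Suc2)

lemma emb_inter_low_zero:
  assumes "W \<subseteq> carrier_vec n"
  shows "emb ` W \<inter> low_zero (Suc n) (Suc j) = emb ` (W \<inter> low_zero n j)"
  using emb_in_low_zero assms by blast

lemma emb_inter_std:
  assumes "W \<subseteq> carrier_vec n"
  shows "emb ` W \<inter> std_flag (Suc n) (Suc k) = emb ` (W \<inter> std_flag n k)"
  using emb_in_std assms by blast

lemma cone_inter_std: "cone n W \<inter> std_flag (Suc n) (Suc k) = cone n (W \<inter> std_flag n k)"
proof (intro equalityI subsetI)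
  fix y assume "y \<in> cone n (W \<inter> std_flag n k)"
  then have y: "y \<in> carrier_vec (Suc n)" "tail y \<in> W" "tail y \<in> std_flag n k"
    by (auto simp: cone_def)
  have z: "y $ Suc r = 0" if "r < n" "k \<le> r" for r
    using y(3) tail_index[OF y(1) that(1)] that by (simp add: std_flag_def)
  then have "y $ r = 0" if "r < Suc n" "Suc k \<le> r" for r
    using that z by (cases r) auto
  then show "y \<in> cone n W \<inter> std_flag (Suc n) (Suc k)" using y by (auto simp: cone_def std_flag_def)
qed (auto simp: cone_def std_flag_def)

text \<open>A vanishing first coordinate removes the free axis of the cone, so this intersection
  gains no dimension, while the one with a nonzero step of \<open>std_flag\<close> keeps the
  axis.\<close>

lemma cone_inter_low_zero: "cone n W \<inter> low_zero (Suc n) (Suc j) = emb ` (W \<inter> low_zero n j)"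
proof (intro equalityI subsetI)
  fix y assume y: "y \<in> cone n W \<inter> low_zero (Suc n) (Suc j)"
  then have "y = emb (tail y)" using vCons_tail[of y n] by (auto simp: cone_def low_zero_def)
  moreover have "tail y \<in> W \<inter> low_zero n j" using y by (auto simp: cone_def low_zero_def)
  ultimately show "y \<in> emb ` (W \<inter> low_zero n j)" by (rule image_eqI)
next
  fix y assume "y \<in> emb ` (W \<inter> low_zero n j)"
  then obtain x where "y = emb x" "x \<in> W" "x \<in> low_zero n j" by auto
  then show "y \<in> cone n W \<inter> low_zero (Suc n) (Suc j)"
    by (auto simp: cone_def low_zero_def vec_index_vCons)
qed

text \<open>The flag \<open>L'\<close> is obtained from \<open>L\<close> by forgetting the first coordinate; the step \<open>q + 1\<close> of
  \<open>L\<close> is not determined by \<open>L'\<close> but varies on a projective line.\<close>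

definition lifted :: "nat \<Rightarrow> nat \<Rightarrow> flag \<Rightarrow> flag \<Rightarrow> bool" where
  "lifted n q L L' \<longleftrightarrow> (\<forall>i\<le>q. L i = emb ` L' i) \<and> (\<forall>i\<ge>q + 2. L i = cone n (L' (i - 1)))"

text \<open>Column \<open>q\<close> of \<open>B\<close> is doubled. The ratio of \<alpha> and
  \<beta> is the point on the projective line that fixes step \<open>q + 1\<close>; \<gamma> and
  \<delta> complete the two columns to an invertible matrix.\<close>

definition lift_mat :: "nat \<Rightarrow> nat \<Rightarrow> complex mat \<Rightarrow> complex \<Rightarrow> complex \<Rightarrow> complex \<Rightarrow> complex \<Rightarrow> complex mat" where
  "lift_mat n q B \<alpha> \<beta> \<gamma> \<delta> = mat (Suc n) (Suc n) (\<lambda>(r, s).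
     if r = 0 then (if s = q then \<beta> else if s = Suc q then \<delta> else 0)
     else if s < q then B $$ (r - 1, s) else if s = q then \<alpha> * B $$ (r - 1, q)
     else if s = Suc q then \<gamma> * B $$ (r - 1, q) else B $$ (r - 1, s - 1))"

lemma lift_mat_carrier: "lift_mat n q B \<alpha> \<beta> \<gamma> \<delta> \<in> carrier_mat (Suc n) (Suc n)"
  by (simp add: lift_mat_def)

lemma col_lift_mat:
  assumes B: "B \<in> carrier_mat n n" and q: "q < n" and s: "s < Suc n"
  shows "col (lift_mat n q B \<alpha> \<beta> \<gamma> \<delta>) s =
    (if s < q then emb (col B s) else if s = q then vCons \<beta> (\<alpha> \<cdot>\<^sub>v col B q)
     else if s = Suc q then vCons \<delta> (\<gamma> \<cdot>\<^sub>v col B q) else emb (col B (s - 1)))"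
  using B q s by (auto simp: lift_mat_def vec_index_vCons intro!: eq_vecI)

lemma lift_mat_mult_vec:
  assumes B: "B \<in> carrier_mat n n" and q: "q < n" and c: "c \<in> carrier_vec (Suc n)"
  shows "lift_mat n q B \<alpha> \<beta> \<gamma> \<delta> *\<^sub>v c = vCons (\<beta> * c $ q + \<delta> * c $ Suc q)
    (B *\<^sub>v vec n (\<lambda>k. if k < q then c $ k else if k = q then \<alpha> * c $ q + \<gamma> * c $ Suc q else c $ Suc k))"
    (is "?M *\<^sub>v c = vCons _ (B *\<^sub>v ?c)")
proof (rule eq_vecI)
  show "dim_vec (?M *\<^sub>v c) = dim_vec (vCons (\<beta> * c $ q + \<delta> * c $ Suc q) (B *\<^sub>v ?c))"
    using B by (simp add: lift_mat_def)
  fix r assume "r < dim_vec (vCons (\<beta> * c $ q + \<delta> * c $ Suc q) (B *\<^sub>v ?c))"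
  then have r: "r < Suc n" using B by simp
  have Mc: "(?M *\<^sub>v c) $ r = (\<Sum>s\<in>{0..<Suc n}. ?M $$ (r, s) * c $ s)"
    using r c lift_mat_carrier[of n q B \<alpha> \<beta> \<gamma> \<delta>] by (auto simp: scalar_prod_def intro!: sum.cong)
  show "(?M *\<^sub>v c) $ r = vCons (\<beta> * c $ q + \<delta> * c $ Suc q) (B *\<^sub>v ?c) $ r"
  proof (cases r)
    case 0
    have "(\<Sum>s\<in>{0..<Suc n}. ?M $$ (r, s) * c $ s) = (\<Sum>s\<in>{q, Suc q}. ?M $$ (r, s) * c $ s)"
      using q 0 by (intro sum.mono_neutral_right) (auto simp: lift_mat_def)
    then show ?thesis using Mc q 0 by (simp add: lift_mat_def)
  next
    case (Suc r')
    have split: "{0..<Suc n} = ({0..<q} \<union> {q, Suc q}) \<union> {Suc (Suc q)..<Suc n}" using q by auto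
    have split': "{0..<n} = ({0..<q} \<union> {q}) \<union> {Suc q..<n}" using q by auto
    have "(\<Sum>s\<in>{0..<Suc n}. ?M $$ (r, s) * c $ s) =
        (\<Sum>s\<in>{0..<q}. ?M $$ (r, s) * c $ s) + (\<Sum>s\<in>{q, Suc q}. ?M $$ (r, s) * c $ s)
          + (\<Sum>s\<in>{Suc (Suc q)..<Suc n}. ?M $$ (r, s) * c $ s)"
      unfolding split by (subst sum.union_disjoint; auto)+
    also have "(\<Sum>s\<in>{0..<q}. ?M $$ (r, s) * c $ s) = (\<Sum>k\<in>{0..<q}. B $$ (r', k) * ?c $ k)"
      using q r Suc by (intro sum.cong) (auto simp: lift_mat_def)
    also have "(\<Sum>s\<in>{q, Suc q}. ?M $$ (r, s) * c $ s) = (\<Sum>k\<in>{q}. B $$ (r', k) * ?c $ k)"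
      using q r Suc by (auto simp: lift_mat_def algebra_simps)
    also have "(\<Sum>s\<in>{Suc (Suc q)..<Suc n}. ?M $$ (r, s) * c $ s) = (\<Sum>k\<in>{Suc q..<n}. ?M $$ (r, Suc k) * c $ Suc k)"
      by (rule sum.shift_bounds_Suc_ivl)
    also have "\<dots> = (\<Sum>k\<in>{Suc q..<n}. B $$ (r', k) * ?c $ k)"
      using q r Suc by (intro sum.cong) (auto simp: lift_mat_def)
    also have "(\<Sum>k\<in>{0..<q}. B $$ (r', k) * ?c $ k) + (\<Sum>k\<in>{q}. B $$ (r', k) * ?c $ k)
        + (\<Sum>k\<in>{Suc q..<n}. B $$ (r', k) * ?c $ k) = (\<Sum>k\<in>{0..<n}. B $$ (r', k) * ?c $ k)"
      unfolding split' by (subst sum.union_disjoint; auto)+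
    also have "\<dots> = (B *\<^sub>v ?c) $ r'"
      using B r Suc by (auto simp: scalar_prod_def intro!: sum.cong)
    finally show ?thesis using Mc Suc by simp
  qed
qed

text \<open>A kernel vector yields a kernel vector of \<open>B\<close> and a two by two system with
  determinant \<open>\<alpha> * \<delta> - \<beta> * \<gamma>\<close>, solved by Cramer's
  rule.\<close>

lemma lift_mat_GL:
  assumes B: "B \<in> GL n" and q: "q < n" and nz: "\<alpha> * \<delta> \<noteq> \<beta> * \<gamma>"
  shows "lift_mat n q B \<alpha> \<beta> \<gamma> \<delta> \<in> GL (Suc n)"
proof (rule GL_I[OF lift_mat_carrier])
  fix c assume c: "c \<in> carrier_vec (Suc n)" and 0: "lift_mat n q B \<alpha> \<beta> \<gamma> \<delta> *\<^sub>v c = 0\<^sub>v (Suc n)"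
  let ?c = "vec n (\<lambda>k. if k < q then c $ k else if k = q then \<alpha> * c $ q + \<gamma> * c $ Suc q else c $ Suc k)"
  have e: "vCons (\<beta> * c $ q + \<delta> * c $ Suc q) (B *\<^sub>v ?c) = 0\<^sub>v (Suc n)"
    using 0 lift_mat_mult_vec[OF GL_carrier[OF B] q c] by simp
  have e1: "\<beta> * c $ q + \<delta> * c $ Suc q = 0" using arg_cong[OF e, of "\<lambda>x. x $ 0"] by simp
  have "B *\<^sub>v ?c = tail (0\<^sub>v (Suc n))" unfolding e[symmetric] by simp
  also have "tail (0\<^sub>v (Suc n)) = 0\<^sub>v n" by (auto simp: tail_def)
  finally have "?c = 0\<^sub>v n" using GL_kernel[OF B, of ?c] by simp
  then have ck: "?c $ k = 0" if "k < n" for k using that by simp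
  have e2: "\<alpha> * c $ q + \<gamma> * c $ Suc q = 0" using ck[OF q] q by simp
  have "(\<alpha> * \<delta> - \<beta> * \<gamma>) * c $ q = \<delta> * (\<alpha> * c $ q + \<gamma> * c $ Suc q) - \<gamma> * (\<beta> * c $ q + \<delta> * c $ Suc q)"
    by (simp add: algebra_simps)
  then have q0: "c $ q = 0" using e1 e2 nz by simp
  have "(\<alpha> * \<delta> - \<beta> * \<gamma>) * c $ Suc q = \<alpha> * (\<beta> * c $ q + \<delta> * c $ Suc q) - \<beta> * (\<alpha> * c $ q + \<gamma> * c $ Suc q)"
    by (simp add: algebra_simps)
  then have q1: "c $ Suc q = 0" using e1 e2 nz by simp
  have "c $ k = 0" if k: "k < Suc n" for k
  proof -
    consider "k < q" | "k = q" | "k = Suc q" | k' where "k = Suc k'" "q < k'" "k' < n"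
      using k by (cases k) (auto, linarith)
    then show ?thesis
    proof cases
      case 1
      then show ?thesis using ck[of k] q by simp
    next
      case 4
      then show ?thesis using ck[of k'] by simp
    qed (use q0 q1 in auto)
  qed
  then show "c = 0\<^sub>v (Suc n)" using c by (auto intro!: eq_vecI)
qed

lemma lifted_lift_mat:
  assumes B: "B \<in> GL n" and q: "q < n" and M: "lift_mat n q B \<alpha> \<beta> \<gamma> \<delta> \<in> GL (Suc n)"
  shows "lifted n q (flag_of (Suc n) (lift_mat n q B \<alpha> \<beta> \<gamma> \<delta>)) (flag_of n B)"
proof -
  let ?M = "lift_mat n q B \<alpha> \<beta> \<gamma> \<delta>"
  note Bc = GL_carrier[OF B]
  have 1: "flag_of (Suc n) ?M i = emb ` flag_of n B i" if i: "i \<le> q" for i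
  proof (rule csubspace_eqI)
    show "flag_of (Suc n) ?M i \<subseteq> emb ` flag_of n B i"
    proof (rule flag_of_subset[OF lift_mat_carrier csubspace_emb[OF csubspace_flag_of[OF Bc]]])
      fix k assume "k < Suc n" "k < i"
      then have "col ?M k = emb (col B k)" "col B k \<in> flag_of n B i"
        using col_lift_mat[OF Bc q, of k] i q col_in_flag_of[OF Bc, of k] flag_of_mono[OF Bc, of "Suc k" i]
        by auto
      then show "col ?M k \<in> emb ` flag_of n B i" by simp
    qed
    show "cdim (Suc n) (emb ` flag_of n B i) \<le> cdim (Suc n) (flag_of (Suc n) ?M i)"
      using i q cdim_flag_of[OF M, of i] cdim_flag_of[OF B, of i] cdim_emb[OF csubspace_flag_of[OF Bc]] by simp
  qed (auto intro: csubspace_emb csubspace_flag_of Bc lift_mat_carrier)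
  have 2: "flag_of (Suc n) ?M i = cone n (flag_of n B (i - 1))" if i: "q + 2 \<le> i" for i
  proof (cases "i \<le> Suc n")
    case True
    show ?thesis
    proof (rule csubspace_eqI)
      show "flag_of (Suc n) ?M i \<subseteq> cone n (flag_of n B (i - 1))"
      proof (rule flag_of_subset[OF lift_mat_carrier csubspace_cone[OF csubspace_flag_of[OF Bc]]])
        fix k assume k: "k < Suc n" "k < i"
        have B1: "col B l \<in> flag_of n B (i - 1)" if "l < n" "Suc l < i" for l
          by (rule subsetD[OF flag_of_mono[OF Bc] col_in_flag_of[OF Bc that(1)]]) (use that in simp)
        then have "tail (col ?M k) \<in> flag_of n B (i - 1)"
          using k i q csubspaceD(4)[OF csubspace_flag_of[OF Bc]]
          by (auto simp: col_lift_mat[OF Bc q])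
        then show "col ?M k \<in> cone n (flag_of n B (i - 1))"
          using k lift_mat_carrier[of n q B \<alpha> \<beta> \<gamma> \<delta>] by (auto simp: cone_def)
      qed
      show "cdim (Suc n) (cone n (flag_of n B (i - 1))) \<le> cdim (Suc n) (flag_of (Suc n) ?M i)"
        using i True cdim_flag_of[OF M, of i] cdim_flag_of[OF B, of "i - 1"] cdim_cone[OF csubspace_flag_of[OF Bc]] by simp
    qed (auto intro: csubspace_cone csubspace_flag_of Bc lift_mat_carrier)
  next
    case False
    then show ?thesis
      using FlD(4)[OF flag_of_in_Fl[OF M], of i] FlD(4)[OF flag_of_in_Fl[OF B], of "i - 1"]
      by (auto simp: cone_def)
  qed
  show ?thesis unfolding lifted_def using 1 2 by auto
qed

text \<open>For nonzero \<alpha> the free step is the graph of a linear functional on step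
  \<open>q + 1\<close> of the flag of \<open>B\<close>; the value of the functional is the new first
  coordinate.\<close>

lemma vCons_in_flag_of_lift_mat:
  assumes B: "B \<in> carrier_mat n n" and q: "q < n" and \<alpha>: "\<alpha> \<noteq> 0" and c: "c \<in> std_flag n (Suc q)"
  shows "vCons (\<beta> * c $ q / \<alpha>) (B *\<^sub>v c) \<in> flag_of (Suc n) (lift_mat n q B \<alpha> \<beta> \<gamma> \<delta>) (Suc q)"
proof -
  define d where "d = vec (Suc n) (\<lambda>k. if k < q then c $ k else if k = q then c $ q / \<alpha> else 0)"
  have d: "d \<in> std_flag (Suc n) (Suc q)" by (auto simp: d_def std_flag_def)
  have "vec n (\<lambda>k. if k < q then d $ k else if k = q then \<alpha> * d $ q + \<gamma> * d $ Suc q else d $ Suc k) = c"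
    using c q \<alpha> by (auto simp: d_def std_flag_def intro!: eq_vecI)
  then have "lift_mat n q B \<alpha> \<beta> \<gamma> \<delta> *\<^sub>v d = vCons (\<beta> * c $ q / \<alpha>) (B *\<^sub>v c)"
    using lift_mat_mult_vec[OF B q, of d \<alpha> \<beta> \<gamma> \<delta>] q by (simp add: d_def)
  then show ?thesis using flag_of_I[OF lift_mat_carrier d] by metis
qed

lemma lifted_eq_lift_mat:
  assumes L: "L \<in> Fl (Suc n)" and B: "B \<in> GL n" and q: "q < n" and lift: "lifted n q L (flag_of n B)"
  obtains \<alpha> \<beta> \<gamma> \<delta> where "lift_mat n q B \<alpha> \<beta> \<gamma> \<delta> \<in> GL (Suc n)" "flag_of (Suc n) (lift_mat n q B \<alpha> \<beta> \<gamma> \<delta>) = L"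
proof -
  note Bc = GL_carrier[OF B]
  have Lq: "L i = emb ` flag_of n B i" if "i \<le> q" for i using lift that by (simp add: lifted_def)
  have Lc: "L i = cone n (flag_of n B (i - 1))" if "q + 2 \<le> i" for i using lift that by (simp add: lifted_def)
  have "\<not> L (Suc q) \<subseteq> L q"
  proof
    assume "L (Suc q) \<subseteq> L q"
    then have "cdim (Suc n) (L (Suc q)) \<le> cdim (Suc n) (L q)" by (intro cdim_mono FlD(1)[OF L])
    then show False using FlD(2)[OF L] q by simp
  qed
  \<comment> \<open>This vector generates step \<open>q + 1\<close> modulo step \<open>q\<close>.
    After subtraction of a vector of step \<open>q\<close> it has the shape of column
    \<open>q\<close> of a lift.\<close>
  then obtain y where y: "y \<in> L (Suc q)" "y \<notin> L q" by auto
  have yc: "y \<in> carrier_vec (Suc n)" by (rule csubspaceD(5)[OF FlD(1)[OF L] y(1)])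
  have "y \<in> L (q + 2)" using Fl_mono[OF L, of "Suc q" "q + 2"] y by auto
  then have "tail y \<in> flag_of n B (Suc q)" using Lc[of "q + 2"] by (simp add: cone_def)
  then obtain c where c: "c \<in> std_flag n (Suc q)" "tail y = B *\<^sub>v c" using Bc by (auto simp: flag_of_altdef)
  have cc: "c \<in> carrier_vec n" using c by (simp add: std_flag_def)
  define \<alpha> where "\<alpha> = c $ q"
  define \<beta> where "\<beta> = y $ 0"
  define c' where "c' = vec n (\<lambda>k. if k < q then c $ k else 0)"
  have c': "c' \<in> std_flag n q" by (auto simp: c'_def std_flag_def)
  have "c = c' + \<alpha> \<cdot>\<^sub>v unit_vec n q" using c q by (auto simp: c'_def \<alpha>_def std_flag_def intro!: eq_vecI)
  then have Bcc: "B *\<^sub>v c = B *\<^sub>v c' + \<alpha> \<cdot>\<^sub>v col B q"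
    using mult_add_distrib_mat_vec[OF Bc, of c' "\<alpha> \<cdot>\<^sub>v unit_vec n q"] mult_mat_vec[OF Bc, of "unit_vec n q" \<alpha>]
      mult_mat_unit_vec[OF Bc q] by (simp add: c'_def)
  have emb: "emb (B *\<^sub>v c') \<in> L q" using Lq[of q] flag_of_I[OF Bc c'] by simp
  have z: "vCons \<beta> (\<alpha> \<cdot>\<^sub>v col B q) \<in> L (Suc q)"
  proof -
    have "vCons \<beta> (\<alpha> \<cdot>\<^sub>v col B q) = y + (-1) \<cdot>\<^sub>v emb (B *\<^sub>v c')"
    proof (rule eq_vecI)
      show "dim_vec (vCons \<beta> (\<alpha> \<cdot>\<^sub>v col B q)) = dim_vec (y + (-1) \<cdot>\<^sub>v emb (B *\<^sub>v c'))"
        using yc Bc by simp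
      fix r assume "r < dim_vec (y + (-1) \<cdot>\<^sub>v emb (B *\<^sub>v c'))"
      then have r: "r < Suc n" using Bc by simp
      show "vCons \<beta> (\<alpha> \<cdot>\<^sub>v col B q) $ r = (y + (-1) \<cdot>\<^sub>v emb (B *\<^sub>v c')) $ r"
      proof (cases r)
        case (Suc r')
        have "y $ r = tail y $ r'" using tail_index[OF yc, of r'] r Suc by simp
        then have "y $ r = (B *\<^sub>v c') $ r' + \<alpha> * B $$ (r', q)"
          unfolding c(2) Bcc using Bc r Suc q by (simp del: index_mult_mat_vec)
        then show ?thesis using Suc r yc Bc q by (simp del: index_mult_mat_vec)
      qed (use Bc yc in \<open>simp add: \<beta>_def\<close>)
    qed
    moreover have "emb (B *\<^sub>v c') \<in> L (Suc q)" using emb Fl_mono[OF L, of q "Suc q"] by auto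
    ultimately show ?thesis
      using csubspaceD(3)[OF FlD(1)[OF L] y(1) csubspaceD(4)[OF FlD(1)[OF L]]] by metis
  qed
  have ab: "\<alpha> \<noteq> 0 \<or> \<beta> \<noteq> 0"
  proof (rule ccontr)
    assume "\<not> (\<alpha> \<noteq> 0 \<or> \<beta> \<noteq> 0)"
    then have "\<beta> = 0" "B *\<^sub>v c = B *\<^sub>v c'" using Bcc Bc q by (auto intro!: eq_vecI simp del: index_mult_mat_vec)
    then have "y = emb (B *\<^sub>v c')" using vCons_tail[OF yc] c by (simp add: \<beta>_def)
    then show False using emb y by simp
  qed
  \<comment> \<open>Completes the nonzero pair of \<alpha> and \<beta> to a basis of the
    plane.\<close>
  define \<gamma> where "\<gamma> = (if \<alpha> = 0 then 1 else 0 :: complex)"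
  define \<delta> where "\<delta> = (if \<alpha> = 0 then 0 else 1 :: complex)"
  let ?M = "lift_mat n q B \<alpha> \<beta> \<gamma> \<delta>"
  have M: "?M \<in> GL (Suc n)" by (rule lift_mat_GL[OF B q]) (use ab in \<open>auto simp: \<gamma>_def \<delta>_def\<close>)
  have "flag_of (Suc n) ?M = L"
  proof (rule flag_of_eqI[OF L M])
    fix s assume s: "s < Suc n"
    have colB: "col B l \<in> flag_of n B (Suc l)" if "l < n" for l using col_in_flag_of[OF Bc that] .
    consider "s < q" | "s = q" | "Suc q \<le> s" by linarith
    then show "col ?M s \<in> L (Suc s)"
    proof cases
      case 1
      then show ?thesis using Lq[of "Suc s"] colB[of s] q by (simp add: col_lift_mat[OF Bc q s])
    next
      case 2
      then show ?thesis using z col_lift_mat[OF Bc q s, of \<alpha> \<beta> \<gamma> \<delta>] by simp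
    next
      case 3
      have "tail (col ?M s) \<in> flag_of n B s"
      proof (cases "s = Suc q")
        case True
        then show ?thesis
          using csubspaceD(4)[OF csubspace_flag_of[OF Bc] colB[OF q]]
            col_lift_mat[OF Bc q s, of \<alpha> \<beta> \<gamma> \<delta>] by simp
      next
        case False
        then show ?thesis using 3 s colB[of "s - 1"] by (simp add: col_lift_mat[OF Bc q s])
      qed
      moreover have "col ?M s \<in> carrier_vec (Suc n)" using s lift_mat_carrier[of n q B \<alpha> \<beta> \<gamma> \<delta>] by auto
      ultimately show ?thesis using Lc[of "Suc s"] 3 by (simp add: cone_def)
    qed
  qed
  then show ?thesis using that M by blast
qed

lemma lift_mat_orbit:
  assumes A: "A \<in> GL n" and B: "B \<in> GL n" and q: "q < n"
    and orb: "flag_of n B \<in> torus_orbit n (flag_of n A)"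
    and M: "lift_mat n q B \<alpha> \<beta> \<gamma> \<delta> \<in> GL (Suc n)" and nz: "\<alpha> \<noteq> 0" "\<beta> \<noteq> 0" "a1 \<noteq> 0" "b1 \<noteq> 0"
  shows "flag_of (Suc n) (lift_mat n q B \<alpha> \<beta> \<gamma> \<delta>) \<in>
    torus_orbit (Suc n) (flag_of (Suc n) (lift_mat n q A 1 a1 0 b1))"
proof -
  let ?M = "lift_mat n q B \<alpha> \<beta> \<gamma> \<delta>" and ?A = "lift_mat n q A 1 a1 0 b1"
  note Ac = GL_carrier[OF A] and Bc = GL_carrier[OF B]
  obtain t where t: "\<forall>i<n. t i \<noteq> 0" "flag_of n B = torus_act n t (flag_of n A)"
    using orb by (auto simp: torus_orbit_def)
  have DA: "mat_diag n t * A \<in> GL n" by (rule GL_mult[OF _ A]) (simp add: mat_diag_GL t)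
  have "flag_of n B = flag_of n (mat_diag n t * A)" using t(2) torus_act_flag_of[OF Ac] by simp
  then obtain T where T: "T \<in> GL n" "upper_triangular T" "mat_diag n t * A = B * T"
    using flag_of_eqE[OF B DA] by blast
  note Tc = GL_carrier[OF T(1)]
  have Tstd: "col T i \<in> std_flag n (Suc i)" if "i < n" for i
    using T(2) Tc that by (auto simp: std_flag_def upper_triangular_def)
  have colDA: "col (mat_diag n t * A) i = B *\<^sub>v col T i" if "i < n" for i
    unfolding T(3) by (rule col_mult2[OF Bc Tc that])
  have Tqq: "T $$ (q, q) \<noteq> 0"
  proof -
    have "det T = prod_list (diag_mat T)" by (rule det_upper_triangular[OF T(2) Tc])
    then have "prod_list (diag_mat T) \<noteq> 0" using T(1) by (simp add: GL_iff_det)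
    then show ?thesis using q Tc by (auto simp: prod_list_diag_prod)
  qed
  \<comment> \<open>The first torus factor is solved from the requirement that column
    \<open>q\<close> of the rescaled matrix has first coordinate
    \<open>\<beta> * T $$ (q, q) / \<alpha>\<close>, as in
    \<open>vCons_in_flag_of_lift_mat\<close>.\<close>
  define \<tau> where "\<tau> = (\<lambda>r. if r = 0 then T $$ (q, q) * \<beta> / (\<alpha> * a1) else t (r - 1))"
  have \<tau>: "\<forall>i<Suc n. \<tau> i \<noteq> 0" using Tqq nz t by (auto simp: \<tau>_def)
  have A': "?A \<in> GL (Suc n)" by (rule lift_mat_GL[OF A q]) (use nz in auto)
  let ?D = "mat_diag (Suc n) \<tau> * ?A"
  have D: "?D \<in> GL (Suc n)" by (rule GL_mult[OF _ A']) (simp add: mat_diag_GL \<tau>)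
  have colD: "col ?D s = vCons (\<tau> 0 * (if s = q then a1 else if s = Suc q then b1 else 0))
      (if s < q then col (mat_diag n t * A) s else if s = q then col (mat_diag n t * A) q
       else if s = Suc q then 0\<^sub>v n else col (mat_diag n t * A) (s - 1))" (is "_ = ?c s")
    if s: "s < Suc n" for s
  proof (rule eq_vecI)
    have dim: "dim_vec (?c s) = Suc n" using Ac s carrier_matD(1)[OF mat_diag_dim, of n t] by auto
    show "dim_vec (col ?D s) = dim_vec (?c s)" unfolding dim using carrier_matD(1)[OF GL_carrier[OF D]] by (simp only: dim_col)
    fix r assume "r < dim_vec (?c s)"
    then have r: "r < Suc n" unfolding dim .
    have DA': "(mat_diag n t * A) $$ (i, k) = t i * A $$ (i, k)" if "i < n" "k < n" for i k
      using mat_diag_mult_left[OF Ac, of t] that by simp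
    have colDA: "col (mat_diag n t * A) k $ i = t i * A $$ (i, k)" if "i < n" "k < n" for i k
      using DA'[OF that] index_col[of i "mat_diag n t * A" k] carrier_matD[OF GL_carrier[OF DA]] that
      by (simp only:)
    have "col ?D s $ r = \<tau> r * ?A $$ (r, s)"
      using mat_diag_mult_left[OF lift_mat_carrier, of n \<tau> q A 1 a1 0 b1] r s by simp
    also have "\<dots> = ?c s $ r"
    proof (cases r)
      case 0
      then show ?thesis using r s q by (simp add: lift_mat_def)
    next
      case (Suc r')
      then have r': "r' < n" "\<tau> r = t r'" using r by (simp_all add: \<tau>_def)
      consider "s < q" | "s = q" | "s = Suc q" | "s > Suc q" by linarith
      then show ?thesis
        using Suc r' r s q colDA[OF r'(1)] by cases (simp_all add: lift_mat_def)
    qed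
    finally show "col ?D s $ r = ?c s $ r" .
  qed
  have lift: "lifted n q (flag_of (Suc n) ?M) (flag_of n B)" by (rule lifted_lift_mat[OF B q M])
  have colDA': "col (mat_diag n t * A) i \<in> flag_of n B (Suc i)" if "i < n" for i
    unfolding colDA[OF that] by (rule flag_of_I[OF Bc Tstd[OF that]])
  have "flag_of (Suc n) ?D = flag_of (Suc n) ?M"
  proof (rule flag_of_eqI[OF flag_of_in_Fl[OF M] D])
    fix s assume s: "s < Suc n"
    consider "s < q" | "s = q" | "Suc q \<le> s" by linarith
    then show "col ?D s \<in> flag_of (Suc n) ?M (Suc s)"
    proof cases
      case 1
      then have "flag_of (Suc n) ?M (Suc s) = emb ` flag_of n B (Suc s)" using lift by (simp add: lifted_def)
      then show ?thesis using 1 q colD[OF s] colDA'[of s] by simp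
    next
      case 2
      have "\<tau> 0 * a1 = \<beta> * col T q $ q / \<alpha>" using nz q Tc by (simp add: \<tau>_def)
      then have "col ?D s = vCons (\<beta> * col T q $ q / \<alpha>) (B *\<^sub>v col T q)"
        using colD[OF s] 2 colDA[OF q] by simp
      then show ?thesis using vCons_in_flag_of_lift_mat[OF Bc q nz(1) Tstd[OF q]] 2 by simp
    next
      case 3
      then have e: "flag_of (Suc n) ?M (Suc s) = cone n (flag_of n B s)" using lift by (simp add: lifted_def)
      have "tail (col ?D s) \<in> flag_of n B s"
        using 3 s colD[OF s] colDA'[of "s - 1"] csubspaceD(2)[OF csubspace_flag_of[OF Bc]] by auto
      moreover have "col ?D s \<in> carrier_vec (Suc n)" using GL_carrier[OF D] s by auto
      ultimately show ?thesis unfolding e cone_def by simp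
    qed
  qed
  then have "flag_of (Suc n) ?M = torus_act (Suc n) \<tau> (flag_of (Suc n) ?A)"
    using torus_act_flag_of[OF lift_mat_carrier] by simp
  then show ?thesis using \<tau> unfolding torus_orbit_def by blast
qed

section \<open>The Richardson variety as an iterated bundle of projective lines\<close>

text \<open>The permutation that defines the second Schubert variety is \<open>a \<mapsto> n + 1 - sw_col n w a\<close>, so
  that \<open>sw_col n w\<close> bounds the ranks of the bottom rows as \<open>w\<close> bounds those of the top rows.\<close>

definition sw_col :: "nat \<Rightarrow> (nat \<Rightarrow> nat) \<Rightarrow> nat \<Rightarrow> nat" where
  "sw_col n w a = (if a = 1 then n else w (a - 1))"

text \<open>For \<open>w\<close> permuting \<open>{1..n-1}\<close>, \<open>iota n w\<close> is
  \<open>w\<close> itself. The steps of both flags are replaced by coordinate subspaces, a form that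
  is suited to recursion on \<open>n\<close>.\<close>

definition richardson_set :: "nat \<Rightarrow> (nat \<Rightarrow> nat) \<Rightarrow> flag set" where
  "richardson_set n w = {L \<in> Fl n. \<forall>i\<le>n. \<forall>j\<le>n.
     card {a \<in> {1..i}. j < w a} \<le> cdim n (L i \<inter> low_zero n j) \<and>
     card {a \<in> {1..i}. sw_col n w a \<le> j} \<le> cdim n (L i \<inter> std_flag n j)}"

lemma F_flag_low_zero: "j \<le> n \<Longrightarrow> F_flag n (n - j) = low_zero n j"
  unfolding F_flag_def by (subst H_inter_eq, simp, subst cspan_unit_vecs) (auto simp: low_zero_def)

lemma F'_flag_std: "k \<le> n \<Longrightarrow> F'_flag n k = std_flag n k"
  unfolding F'_flag_def by (subst H_inter_eq, simp, subst cspan_unit_vecs) (auto simp: std_flag_def)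

text \<open>As \<open>B\<close> is injective and preserves \<open>G\<close>, it embeds the first
  intersection into the second.\<close>

lemma cdim_flag_of_mult_left:
  assumes A: "A \<in> GL n" and B: "B \<in> GL n" and G: "csubspace n G" "\<And>x. x \<in> G \<Longrightarrow> B *\<^sub>v x \<in> G"
  shows "cdim n (flag_of n A i \<inter> G) \<le> cdim n (flag_of n (B * A) i \<inter> G)"
proof -
  note Ac = GL_carrier[OF A] and Bc = GL_carrier[OF B]
  have W: "csubspace n (flag_of n A i \<inter> G)" by (intro csubspace_Int csubspace_flag_of Ac G)
  have lin: "linear_on n n (flag_of n A i \<inter> G) ((*\<^sub>v) B)"
    by (rule linear_on_mult_mat_vec[OF Bc csubspaceD(1)[OF W]])
  have "cdim n (flag_of n A i \<inter> G) = cdim n ((*\<^sub>v) B ` (flag_of n A i \<inter> G))"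
    using cdim_image[OF W lin] GL_kernel[OF B] csubspaceD(5)[OF W] by metis
  also have "\<dots> \<le> cdim n (flag_of n (B * A) i \<inter> G)"
    using GL_mult[OF B A] G flag_of_mult_left[OF Bc Ac, of i]
    by (intro cdim_mono csubspace_image[OF W lin] csubspace_Int csubspace_flag_of) (auto simp: GL_carrier)
  finally show ?thesis .
qed

lemma lower_triangular_mult_low_zero:
  assumes B: "B \<in> carrier_mat n n" "lower_triangular n B" and x: "x \<in> low_zero n j"
  shows "B *\<^sub>v x \<in> low_zero n j"
proof -
  have "(\<Sum>k = 0..<n. B $$ (r, k) * x $ k) = 0" if "r < n" "r < j" for r
  proof (rule sum.neutral, intro ballI)
    fix k assume "k \<in> {0..<n}"
    then show "B $$ (r, k) * x $ k = 0"
      using x B that by (cases "k < j") (auto simp: low_zero_def lower_triangular_def)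
  qed
  then show ?thesis using B x by (auto simp: low_zero_def scalar_prod_def)
qed

lemma Schubert_F_stable:
  assumes A: "A \<in> GL n" and B: "B \<in> GL n" "lower_triangular n B"
    and S: "flag_of n A \<in> Schubert n (F_flag n) v"
  shows "flag_of n (B * A) \<in> Schubert n (F_flag n) v"
proof -
  have "cdim n (flag_of n A i \<inter> F_flag n (n - j)) \<le> cdim n (flag_of n (B * A) i \<inter> F_flag n (n - j))"
    if "j \<le> n" for i j
    unfolding F_flag_low_zero[OF that]
    using lower_triangular_mult_low_zero[OF GL_carrier[OF B(1)] B(2)]
    by (intro cdim_flag_of_mult_left A B csubspace_low_zero)
  note le = this
  show ?thesis
    unfolding Schubert_def mem_Collect_eq
  proof (intro conjI allI impI)
    show "flag_of n (B * A) \<in> Fl n" by (rule flag_of_in_Fl[OF GL_mult[OF B(1) A]])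
    fix i j assume "i \<le> n" "j \<le> n"
    then have "card (v ` {1..i} \<inter> {j+1..n}) \<le> cdim n (flag_of n A i \<inter> F_flag n (n - j))"
      using S unfolding Schubert_def by simp
    also have "\<dots> \<le> cdim n (flag_of n (B * A) i \<inter> F_flag n (n - j))" by (rule le[OF \<open>j \<le> n\<close>])
    finally show "card (v ` {1..i} \<inter> {j+1..n}) \<le> cdim n (flag_of n (B * A) i \<inter> F_flag n (n - j))" .
  qed
qed

lemma Schubert_F'_stable:
  assumes A: "A \<in> GL n" and B: "B \<in> GL n" "upper_triangular B"
    and S: "flag_of n A \<in> Schubert n (F'_flag n) v"
  shows "flag_of n (B * A) \<in> Schubert n (F'_flag n) v"
proof -
  have "cdim n (flag_of n A i \<inter> F'_flag n (n - j)) \<le> cdim n (flag_of n (B * A) i \<inter> F'_flag n (n - j))"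
    for i j
    unfolding F'_flag_std[OF diff_le_self]
    using upper_triangular_mult_std_flag[OF GL_carrier[OF B(1)] B(2)]
    by (intro cdim_flag_of_mult_left A B csubspace_std_flag)
  note le = this
  show ?thesis
    unfolding Schubert_def mem_Collect_eq
  proof (intro conjI allI impI)
    show "flag_of n (B * A) \<in> Fl n" by (rule flag_of_in_Fl[OF GL_mult[OF B(1) A]])
    fix i j assume "i \<le> n" "j \<le> n"
    then have "card (v ` {1..i} \<inter> {j+1..n}) \<le> cdim n (flag_of n A i \<inter> F'_flag n (n - j))"
      using S unfolding Schubert_def by simp
    also have "\<dots> \<le> cdim n (flag_of n (B * A) i \<inter> F'_flag n (n - j))" by (rule le)
    finally show "card (v ` {1..i} \<inter> {j+1..n}) \<le> cdim n (flag_of n (B * A) i \<inter> F'_flag n (n - j))" .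
  qed
qed

lemma card_image_Int:
  fixes v :: "nat \<Rightarrow> nat"
  assumes "inj_on v {1..n}" "i \<le> n" "v ` {1..n} \<subseteq> {1..n}"
  shows "card (v ` {1..i} \<inter> {j+1..n}) = card {a \<in> {1..i}. j < v a}"
proof -
  have "v ` {1..i} \<inter> {j+1..n} = v ` {a \<in> {1..i}. j < v a}"
    using assms by (auto simp: image_subset_iff)
  moreover have "inj_on v {a \<in> {1..i}. j < v a}"
    by (rule inj_on_subset[OF assms(1)]) (use assms(2) in auto)
  ultimately show ?thesis by (simp add: card_image)
qed

lemma Richardson_eq_richardson_set:
  assumes n: "n \<ge> 1" and w: "w permutes {1..n-1}"
  shows "Schubert n (F_flag n) (iota n w) \<inter> Schubert n (F'_flag n) (iota_bar n (w0 n \<circ> w)) = richardson_set n w"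
proof -
  have wn: "w n = n" using permutes_not_in[OF w, of n] n by simp
  have iota: "iota n w = w" using wn by (auto simp: iota_def)
  have w1: "w a \<in> {1..n-1} \<longleftrightarrow> a \<in> {1..n-1}" for a by (rule permutes_in_image[OF w])
  have injw: "inj w" using permutes_inj[OF w] .
  have wimg: "w ` {1..n} \<subseteq> {1..n}"
  proof
    fix x assume "x \<in> w ` {1..n}"
    then obtain a where "a \<in> {1..n}" "x = w a" by auto
    then show "x \<in> {1..n}" using w1[of a] wn by (cases "a = n") auto
  qed
  have c1: "card (iota n w ` {1..i} \<inter> {j+1..n}) = card {a \<in> {1..i}. j < w a}" if "i \<le> n" for i j
    unfolding iota using that wimg by (intro card_image_Int inj_on_subset[OF injw]) auto
  let ?v = "iota_bar n (w0 n \<circ> w)"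
  \<comment> \<open>For \<open>a = 1\<close> both sides are 1; for larger \<open>a\<close> both are
    \<open>n - w (a - 1) + 1\<close>, since \<open>w0 n\<close> reverses
    \<open>{1..n-1}\<close>.\<close>
  have v: "?v a = n + 1 - sw_col n w a" "sw_col n w a \<in> {1..n}" if "a \<in> {1..n}" for a
  proof -
    have "w (a - 1) \<in> {1..n-1}" if "a \<noteq> 1" using w1[of "a - 1"] that \<open>a \<in> {1..n}\<close> by auto
    then show "?v a = n + 1 - sw_col n w a" "sw_col n w a \<in> {1..n}"
      using that n by (auto simp: iota_bar_def w0_def sw_col_def)
  qed
  have sinj: "inj_on (sw_col n w) {1..n}"
  proof (rule inj_onI)
    fix a b assume a: "a \<in> {1..n}" and b: "b \<in> {1..n}" and e: "sw_col n w a = sw_col n w b"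
    have "w (x - 1) \<noteq> n" if "x \<in> {1..n}" "x \<noteq> 1" for x using w1[of "x - 1"] that by auto
    then have "sw_col n w x = n \<longleftrightarrow> x = 1" if "x \<in> {1..n}" for x
      using that by (auto simp: sw_col_def)
    then have one: "a = 1 \<longleftrightarrow> b = 1" using a b e by metis
    show "a = b"
    proof (cases "a = 1")
      case False
      then have "w (a - 1) = w (b - 1)" using e one by (simp add: sw_col_def)
      then have "a - 1 = b - 1" by (rule injD[OF injw])
      then show ?thesis using a b by (simp; linarith)
    qed (use one in simp)
  qed
  have vinj: "inj_on ?v {1..n}"
  proof (rule inj_onI)
    fix a b assume ab: "a \<in> {1..n}" "b \<in> {1..n}" and e: "?v a = ?v b"
    have "n + 1 - sw_col n w a = n + 1 - sw_col n w b" "sw_col n w a \<le> n" "sw_col n w b \<le> n"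
      using e v[OF ab(1)] v[OF ab(2)] by simp_all
    then have "sw_col n w a = sw_col n w b" by linarith
    then show "a = b" by (rule inj_onD[OF sinj _ ab])
  qed
  have vimg: "?v ` {1..n} \<subseteq> {1..n}"
  proof (rule image_subsetI)
    fix a assume a: "a \<in> {1..n}"
    show "?v a \<in> {1..n}" using v(2)[OF a] unfolding v(1)[OF a] by (simp; linarith)
  qed
  have c2: "card (?v ` {1..i} \<inter> {(n-k)+1..n}) = card {a \<in> {1..i}. sw_col n w a \<le> k}" if "i \<le> n" "k \<le> n" for i k
  proof -
    have "n - k < ?v a \<longleftrightarrow> sw_col n w a \<le> k" if "a \<in> {1..i}" for a
    proof -
      have a: "a \<in> {1..n}" using that \<open>i \<le> n\<close> by simp
      show ?thesis using v(2)[OF a] \<open>k \<le> n\<close> unfolding v(1)[OF a] by auto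
    qed
    then have "{a \<in> {1..i}. n - k < ?v a} = {a \<in> {1..i}. sw_col n w a \<le> k}" by blast
    then show ?thesis using card_image_Int[OF vinj that(1) vimg, of "n - k"] by simp
  qed
  have e1: "L \<in> Schubert n (F_flag n) (iota n w) \<longleftrightarrow> L \<in> Fl n \<and> (\<forall>i\<le>n. \<forall>j\<le>n.
      card {a \<in> {1..i}. j < w a} \<le> cdim n (L i \<inter> low_zero n j))" for L
    unfolding Schubert_def using c1 by (auto simp: F_flag_low_zero)
  have e2: "L \<in> Schubert n (F'_flag n) ?v \<longleftrightarrow> L \<in> Fl n \<and> (\<forall>i\<le>n. \<forall>k\<le>n.
      card {a \<in> {1..i}. sw_col n w a \<le> k} \<le> cdim n (L i \<inter> std_flag n k))" for L
  proof -
    \<comment> \<open>The Schubert condition with index \<open>j\<close> concerns step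
      \<open>n - j\<close>; reindexing makes it a condition on step \<open>k\<close>.\<close>
    have flip: "(\<forall>j\<le>n. P j) \<longleftrightarrow> (\<forall>k\<le>n. P (n - k))" for P
      by (metis diff_diff_cancel diff_le_self)
    show ?thesis
      unfolding Schubert_def mem_Collect_eq flip[of "\<lambda>j. card (?v ` {1.._} \<inter> {j+1..n}) \<le> _ j"]
      using c2 by (auto simp: F'_flag_std)
  qed
  show ?thesis unfolding richardson_set_def using e1 e2 by blast
qed

section \<open>Deletion of the value 1 from a permutation\<close>

definition skip :: "nat \<Rightarrow> nat \<Rightarrow> nat" where
  "skip s a = (if a < s then a else Suc a)"

text \<open>In one-line notation, the entry 1 is removed and the other entries are lowered by
  one.\<close>

definition delete_one :: "(nat \<Rightarrow> nat) \<Rightarrow> nat \<Rightarrow> nat" where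
  "delete_one w a = w (skip (Hilbert_Choice.inv w 1) a) - 1"

lemma skip_inj: "skip s a = skip s b \<longleftrightarrow> a = b"
  by (auto simp: skip_def)

lemma skip_neq: "skip s a \<noteq> s"
  by (auto simp: skip_def)

lemma skip_less: "skip s a < skip s b \<longleftrightarrow> a < b"
  by (auto simp: skip_def)

lemma skip_surj:
  assumes "c \<noteq> s"
  shows "\<exists>a. c = skip s a"
proof (cases "c < s")
  case True
  then have "c = skip s c" by (simp add: skip_def)
  then show ?thesis by (rule exI)
next
  case False
  then have "c = skip s (c - 1)" using assms by (simp add: skip_def)
  then show ?thesis by (rule exI)
qed

lemma card_skip:
  assumes "1 \<le> s" "s \<le> i"
  shows "card {a \<in> {1..i}. P a} = (if P s then 1 else 0) + card {a \<in> {1..i-1}. P (skip s a)}"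
proof -
  have "{a \<in> {1..i}. P a} = (if P s then {s} else {}) \<union> skip s ` {a \<in> {1..i-1}. P (skip s a)}"
  proof (intro equalityI subsetI)
    fix a assume a: "a \<in> {a \<in> {1..i}. P a}"
    show "a \<in> (if P s then {s} else {}) \<union> skip s ` {a \<in> {1..i-1}. P (skip s a)}"
    proof (cases "a = s")
      case False
      then obtain b where b: "a = skip s b" using skip_surj by blast
      then have "b \<in> {1..i-1}" using a assms by (auto simp: skip_def split: if_splits)
      then show ?thesis using a b by auto
    qed (use a in auto)
  qed (use assms in \<open>auto simp: skip_def split: if_splits\<close>)
  moreover have "card (skip s ` {a \<in> {1..i-1}. P (skip s a)}) = card {a \<in> {1..i-1}. P (skip s a)}"
    by (intro card_image inj_onI) (simp add: skip_inj)
  moreover have "(if P s then {s} else {}) \<inter> skip s ` {a \<in> {1..i-1}. P (skip s a)} = {}"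
    using skip_neq by (auto split: if_splits) metis
  ultimately show ?thesis by (simp add: card_Un_disjoint)
qed

text \<open>\<open>p\<close> is the position of 1, counted from 1; \<open>q\<close> is the index of
  the same matrix column, counted from 0.\<close>

context
  fixes n :: nat and w :: "nat \<Rightarrow> nat" and p q :: nat
  assumes n: "n \<ge> 1" and w: "w permutes {1..n}"
    and p: "p = Hilbert_Choice.inv w 1" and q: "q = p - 1"
begin

lemma w_p: "w p = 1"
  unfolding p using permutes_inverses(1)[OF w] by simp

lemma p_range: "p \<in> {1..n}"
  using permutes_in_image[OF w, of p] w_p n by simp

lemma Suc_q: "Suc q = p" and q_less: "q < n"
  using p_range q by auto

lemma w_pos: "a \<ge> 1 \<Longrightarrow> w a \<ge> 1"
  using permutes_in_image[OF w, of a] permutes_not_in[OF w, of a] by (cases "a \<le> n") auto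

lemma w_eq_one: "w a = 1 \<longleftrightarrow> a = p"
  using w_p permutes_inj[OF w] by (metis injD)

lemma delete_one_alt: "delete_one w a = w (skip p a) - 1"
  unfolding delete_one_def p ..

lemma delete_one_eq: "a \<ge> 1 \<Longrightarrow> Suc (delete_one w a) = w (skip p a)"
proof -
  assume "a \<ge> 1"
  then have "skip p a \<ge> 1" by (simp add: skip_def)
  from w_pos[OF this] show ?thesis unfolding delete_one_alt by simp
qed

lemma delete_one_permutes: "delete_one w permutes {1..n-1}"
proof -
  have w0: "w 0 = 0" using permutes_not_in[OF w, of 0] by simp
  have outside: "delete_one w a = a" if "a \<notin> {1..n-1}" for a
  proof (cases "a = 0")
    case True
    \<comment> \<open>Index 0 stays fixed because \<open>w 0 = 0\<close> and subtraction of naturals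
      stops at 0.\<close>
    then show ?thesis using w0 p_range unfolding delete_one_alt by (simp add: skip_def)
  next
    case False
    then have "a \<ge> n" using that n by auto
    then have "skip p a = Suc a" using p_range by (auto simp: skip_def)
    then show ?thesis using permutes_not_in[OF w, of "Suc a"] \<open>a \<ge> n\<close> unfolding delete_one_alt by simp
  qed
  have inj: "inj_on (delete_one w) {1..n-1}"
  proof (rule inj_onI)
    fix a b assume "a \<in> {1..n-1}" "b \<in> {1..n-1}" "delete_one w a = delete_one w b"
    then have "w (skip p a) = w (skip p b)" using delete_one_eq[of a] delete_one_eq[of b] by auto
    then show "a = b" using injD[OF permutes_inj[OF w]] skip_inj by metis
  qed
  have img: "delete_one w ` {1..n-1} \<subseteq> {1..n-1}"
  proof
    fix x assume "x \<in> delete_one w ` {1..n-1}"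
    then obtain a where a: "a \<in> {1..n-1}" "x = delete_one w a" by auto
    then have "skip p a \<in> {1..n}" "w (skip p a) \<noteq> 1"
      using w_eq_one[of "skip p a"] skip_neq[of p a] by (auto simp: skip_def)
    then have "w (skip p a) \<in> {2..n}" using permutes_in_image[OF w, of "skip p a"] by auto
    then show "x \<in> {1..n-1}" using delete_one_eq[of a] a by auto
  qed
  have "bij_betw (delete_one w) {1..n-1} {1..n-1}"
    using endo_inj_surj[OF _ img inj] inj by (simp add: bij_betw_def)
  then show ?thesis using outside by (intro bij_imp_permutes) auto
qed

text \<open>\<open>sw_col\<close> is \<open>w\<close> moved by one position, so the value 1 sits at
  \<open>p + 1\<close> and that is the position to delete.\<close>

lemma sw_col_skip: "a \<ge> 1 \<Longrightarrow> Suc (sw_col n (delete_one w) a) = sw_col (Suc n) w (skip (Suc p) a)"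
proof (cases "a = 1")
  case True
  then show ?thesis using p_range by (simp add: sw_col_def skip_def)
next
  case False
  assume "a \<ge> 1"
  then have "Suc (delete_one w (a - 1)) = w (skip p (a - 1))" using False by (intro delete_one_eq) simp
  moreover have "skip (Suc p) a - 1 = skip p (a - 1)" "skip (Suc p) a \<noteq> 1"
    using False \<open>a \<ge> 1\<close> by (auto simp: skip_def)
  ultimately show ?thesis using False by (simp add: sw_col_def)
qed

lemma sw_col_Suc_p: "sw_col (Suc n) w (Suc p) = 1"
  using w_p p_range by (simp add: sw_col_def)

text \<open>In the first count the value 1 never exceeds \<open>Suc j\<close>, in the second it is
  always at most \<open>Suc k\<close>. The first count changes its form at step \<open>p\<close> and
  the second at step \<open>p + 1\<close>; the mismatch at step \<open>p\<close> is where the flag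
  has its freedom.\<close>

lemma card1_low: "i \<le> q \<Longrightarrow> card {a \<in> {1..i}. Suc j < w a} = card {a \<in> {1..i}. j < delete_one w a}"
proof -
  assume i: "i \<le> q"
  have "Suc j < w a \<longleftrightarrow> j < delete_one w a" if "a \<in> {1..i}" for a
  proof -
    have "w a = Suc (delete_one w a)" using delete_one_eq[of a] that i Suc_q by (simp add: skip_def)
    then show ?thesis by simp
  qed
  then show ?thesis by (intro arg_cong[of _ _ card]) blast
qed

lemma card1_high: "Suc q \<le> i \<Longrightarrow> card {a \<in> {1..i}. Suc j < w a} = card {a \<in> {1..i-1}. j < delete_one w a}"
proof -
  assume i: "Suc q \<le> i"
  have "card {a \<in> {1..i}. Suc j < w a} = card {a \<in> {1..i-1}. Suc j < w (skip p a)}"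
    using card_skip[of p i "\<lambda>a. Suc j < w a"] i Suc_q w_p by simp
  also have "{a \<in> {1..i-1}. Suc j < w (skip p a)} = {a \<in> {1..i-1}. j < delete_one w a}"
    using delete_one_eq by (auto simp flip: delete_one_eq)
  finally show ?thesis .
qed

lemma card2_low:
  "i \<le> Suc q \<Longrightarrow> card {a \<in> {1..i}. sw_col (Suc n) w a \<le> Suc k} = card {a \<in> {1..i}. sw_col n (delete_one w) a \<le> k}"
proof -
  assume i: "i \<le> Suc q"
  have "sw_col (Suc n) w a \<le> Suc k \<longleftrightarrow> sw_col n (delete_one w) a \<le> k" if "a \<in> {1..i}" for a
  proof -
    have "sw_col (Suc n) w a = Suc (sw_col n (delete_one w) a)"
      using sw_col_skip[of a] that i Suc_q by (simp add: skip_def)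
    then show ?thesis by simp
  qed
  then show ?thesis by (intro arg_cong[of _ _ card]) blast
qed

lemma card2_high: "q + 2 \<le> i \<Longrightarrow>
  card {a \<in> {1..i}. sw_col (Suc n) w a \<le> Suc k} = Suc (card {a \<in> {1..i-1}. sw_col n (delete_one w) a \<le> k})"
proof -
  assume i: "q + 2 \<le> i"
  have "card {a \<in> {1..i}. sw_col (Suc n) w a \<le> Suc k} = Suc (card {a \<in> {1..i-1}. sw_col (Suc n) w (skip (Suc p) a) \<le> Suc k})"
    using card_skip[of "Suc p" i "\<lambda>a. sw_col (Suc n) w a \<le> Suc k"] i Suc_q sw_col_Suc_p by simp
  also have "{a \<in> {1..i-1}. sw_col (Suc n) w (skip (Suc p) a) \<le> Suc k} = {a \<in> {1..i-1}. sw_col n (delete_one w) a \<le> k}"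
    by (auto simp flip: sw_col_skip)
  finally show ?thesis .
qed

lemma lifted_dims:
  assumes L: "lifted n q L L'" and L': "L' \<in> Fl n"
  shows "i \<le> q \<Longrightarrow> cdim (Suc n) (L i \<inter> low_zero (Suc n) (Suc j)) = cdim n (L' i \<inter> low_zero n j)"
    and "i \<le> q \<Longrightarrow> cdim (Suc n) (L i \<inter> std_flag (Suc n) (Suc j)) = cdim n (L' i \<inter> std_flag n j)"
    and "q + 2 \<le> i \<Longrightarrow> cdim (Suc n) (L i \<inter> low_zero (Suc n) (Suc j)) = cdim n (L' (i - 1) \<inter> low_zero n j)"
    and "q + 2 \<le> i \<Longrightarrow> cdim (Suc n) (L i \<inter> std_flag (Suc n) (Suc j)) = Suc (cdim n (L' (i - 1) \<inter> std_flag n j))"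
proof -
  note s = FlD(1)[OF L']
  have s1: "csubspace n (L' k \<inter> low_zero n j)" "csubspace n (L' k \<inter> std_flag n j)" for k
    using s csubspace_Int csubspace_low_zero csubspace_std_flag by blast+
  note c = csubspaceD(1)[OF s]
  show "i \<le> q \<Longrightarrow> cdim (Suc n) (L i \<inter> low_zero (Suc n) (Suc j)) = cdim n (L' i \<inter> low_zero n j)"
    using L emb_inter_low_zero[OF c] cdim_emb[OF s1(1)] by (simp add: lifted_def)
  show "i \<le> q \<Longrightarrow> cdim (Suc n) (L i \<inter> std_flag (Suc n) (Suc j)) = cdim n (L' i \<inter> std_flag n j)"
    using L emb_inter_std[OF c] cdim_emb[OF s1(2)] by (simp add: lifted_def)
  show "q + 2 \<le> i \<Longrightarrow> cdim (Suc n) (L i \<inter> low_zero (Suc n) (Suc j)) = cdim n (L' (i - 1) \<inter> low_zero n j)"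
    using L cone_inter_low_zero cdim_emb[OF s1(1)] by (simp add: lifted_def)
  show "q + 2 \<le> i \<Longrightarrow> cdim (Suc n) (L i \<inter> std_flag (Suc n) (Suc j)) = Suc (cdim n (L' (i - 1) \<inter> std_flag n j))"
    using L cone_inter_std cdim_cone[OF s1(2)] by (simp add: lifted_def)
qed

lemma richardson_set_lifted:
  assumes L: "L \<in> richardson_set (Suc n) w"
  obtains L' where "L' \<in> richardson_set n (delete_one w)" "lifted n q L L'"
proof -
  have LF: "L \<in> Fl (Suc n)"
    and c1: "\<And>i j. i \<le> Suc n \<Longrightarrow> j \<le> Suc n \<Longrightarrow> card {a \<in> {1..i}. j < w a} \<le> cdim (Suc n) (L i \<inter> low_zero (Suc n) j)"
    and c2: "\<And>i j. i \<le> Suc n \<Longrightarrow> j \<le> Suc n \<Longrightarrow>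
        card {a \<in> {1..i}. sw_col (Suc n) w a \<le> j} \<le> cdim (Suc n) (L i \<inter> std_flag (Suc n) j)"
    using L by (auto simp: richardson_set_def)
  note sub = FlD(1)[OF LF]
  \<comment> \<open>The first \<open>i\<close> positions all carry values above 1, so the rank
    condition for \<open>j = 1\<close> demands the full dimension.\<close>
  have low: "L i \<subseteq> low_zero (Suc n) 1" if i: "i \<le> q" for i
  proof -
    have "1 < w a" if "a \<in> {1..i}" for a
    proof -
      have "1 \<le> w a" using that by (intro w_pos) simp
      moreover have "w a \<noteq> 1" unfolding w_eq_one using that i Suc_q by simp
      ultimately show ?thesis by linarith
    qed
    then have "{a \<in> {1..i}. 1 < w a} = {1..i}" by blast
    then have "i \<le> cdim (Suc n) (L i \<inter> low_zero (Suc n) 1)" using c1[of i 1] i q_less by simp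
    then have "L i \<inter> low_zero (Suc n) 1 = L i"
      using FlD(2)[OF LF, of i] i q_less by (intro csubspace_eqI[where n = "Suc n"] sub csubspace_Int csubspace_low_zero) auto
    then show ?thesis by auto
  qed
  \<comment> \<open>Position \<open>p + 1\<close>, where \<open>sw_col\<close> is 1, is counted, so
    \<open>L i\<close> meets the first coordinate axis.\<close>
  have high: "std_flag (Suc n) 1 \<subseteq> L i" if i: "q + 2 \<le> i" for i
  proof (cases "i \<le> Suc n")
    case True
    have "Suc p \<in> {a \<in> {1..i}. sw_col (Suc n) w a \<le> 1}" using sw_col_Suc_p i Suc_q by simp
    then have "{a \<in> {1..i}. sw_col (Suc n) w a \<le> 1} \<noteq> {}" by blast
    then have "card {a \<in> {1..i}. sw_col (Suc n) w a \<le> 1} > 0" by (simp only: card_gt_0_iff) simp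
    then have "1 \<le> cdim (Suc n) (L i \<inter> std_flag (Suc n) 1)" using c2[of i 1] True by simp
    then have "L i \<inter> std_flag (Suc n) 1 = std_flag (Suc n) 1"
      using cdim_std_flag[of 1 "Suc n"]
      by (intro csubspace_eqI[where n = "Suc n"] sub csubspace_Int csubspace_std_flag) auto
    then show ?thesis by auto
  next
    case False
    then show ?thesis using FlD(4)[OF LF, of i] by (auto simp: std_flag_def)
  qed
  \<comment> \<open>Slices by the hyperplane where the first coordinate vanishes, with step
    \<open>q + 1\<close> left out. For a step that contains the first axis, slice and projection
    agree, which makes the step a cone.\<close>
  define L' where "L' = (\<lambda>i. {x \<in> carrier_vec n. emb x \<in> L (if i \<le> q then i else Suc i)})"
  have sub': "csubspace n (L' i)" for i
  proof -
    have "emb (0\<^sub>v n) = 0\<^sub>v (Suc n)" by (auto simp: vec_index_vCons intro!: eq_vecI)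
    then show ?thesis
      unfolding csubspace_iff L'_def
      using csubspaceD[OF sub] by (auto simp: emb_add[of _ n] emb_smult simp del: vCons_carrier)
  qed
  have Le: "L i = emb ` L' i" if i: "i \<le> q" for i
  proof (intro equalityI subsetI)
    fix y assume y: "y \<in> L i"
    then have yc: "y \<in> carrier_vec (Suc n)" using csubspaceD(5)[OF sub] by blast
    have "y $ 0 = 0" using low[OF i] y by (auto simp: low_zero_def)
    then have e: "y = emb (tail y)" using vCons_tail[OF yc] by simp
    then have "tail y \<in> L' i" using y yc i by (simp add: L'_def)
    then show "y \<in> emb ` L' i" using e by blast
  qed (use i in \<open>auto simp: L'_def\<close>)
  have Lc: "L i = cone n (L' (i - 1))" if i: "q + 2 \<le> i" for i
  proof (intro equalityI subsetI)
    have L'i: "L' (i - 1) = {x \<in> carrier_vec n. emb x \<in> L i}"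
    proof -
      have "\<not> i - 1 \<le> q" "Suc (i - 1) = i" using i by auto
      then show ?thesis unfolding L'_def by presburger
    qed
    have e1: "y $ 0 \<cdot>\<^sub>v unit_vec (Suc n) 0 \<in> L i" for y
      using high[OF i] by (intro csubspaceD(4)[OF sub]) (auto simp: std_flag_def)
    have eq: "emb (tail y) = y + (-1) \<cdot>\<^sub>v (y $ 0 \<cdot>\<^sub>v unit_vec (Suc n) 0)"
      and eq': "y = emb (tail y) + y $ 0 \<cdot>\<^sub>v unit_vec (Suc n) 0" if "y \<in> carrier_vec (Suc n)" for y
    proof -
      have t: "tail y \<in> carrier_vec n" using that by simp
      show "emb (tail y) = y + (-1) \<cdot>\<^sub>v (y $ 0 \<cdot>\<^sub>v unit_vec (Suc n) 0)"
      proof (rule eq_vecI)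
        fix r assume "r < dim_vec (y + (-1) \<cdot>\<^sub>v (y $ 0 \<cdot>\<^sub>v unit_vec (Suc n) 0))"
        then show "emb (tail y) $ r = (y + (-1) \<cdot>\<^sub>v (y $ 0 \<cdot>\<^sub>v unit_vec (Suc n) 0)) $ r"
          using that by (cases r) auto
      qed (use t in auto)
      show "y = emb (tail y) + y $ 0 \<cdot>\<^sub>v unit_vec (Suc n) 0"
      proof (rule eq_vecI)
        fix r assume "r < dim_vec (emb (tail y) + y $ 0 \<cdot>\<^sub>v unit_vec (Suc n) 0)"
        then show "y $ r = (emb (tail y) + y $ 0 \<cdot>\<^sub>v unit_vec (Suc n) 0) $ r"
          using that t by (cases r) auto
      qed (use that in auto)
    qed
    {
      fix y assume y: "y \<in> L i"
      then have yc: "y \<in> carrier_vec (Suc n)" using csubspaceD(5)[OF sub] by blast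
      have "emb (tail y) \<in> L i"
        unfolding eq[OF yc] by (intro csubspaceD(3,4)[OF sub] y e1)
      then show "y \<in> cone n (L' (i - 1))" using yc unfolding cone_def L'i by simp
    next
      fix y assume "y \<in> cone n (L' (i - 1))"
      then have yc: "y \<in> carrier_vec (Suc n)" and "emb (tail y) \<in> L i"
        unfolding cone_def L'i by auto
      then have "emb (tail y) + y $ 0 \<cdot>\<^sub>v unit_vec (Suc n) 0 \<in> L i"
        by (intro csubspaceD(3)[OF sub] e1)
      then show "y \<in> L i" using eq'[OF yc] by simp
    }
  qed
  have lift: "lifted n q L L'" using Le Lc by (auto simp: lifted_def)
  have dim: "cdim n (L' i) = i" if "i \<le> n" for i
  proof (cases "i \<le> q")
    case True
    then show ?thesis using Le[OF True] cdim_emb[OF sub', of i] FlD(2)[OF LF, of i] that by simp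
  next
    case False
    then have "q + 2 \<le> Suc i" by simp
    from Lc[OF this] show ?thesis using cdim_cone[OF sub', of i] FlD(2)[OF LF, of "Suc i"] that by simp
  qed
  have "L' \<in> Fl n"
    unfolding Fl_def
  proof (intro CollectI conjI allI impI)
    show "L' 0 = {0\<^sub>v n}" by (rule cdim_eq_0[OF sub' dim]) simp
    show "L' i = carrier_vec n" if "n \<le> i" for i
      using that q_less FlD(4)[OF LF, of "Suc i"] by (auto simp: L'_def)
    show "L' i \<subseteq> L' (Suc i)" for i
      using Fl_mono[OF LF, of "if i \<le> q then i else Suc i" "if Suc i \<le> q then Suc i else Suc (Suc i)"]
      by (auto simp: L'_def)
  qed (use sub' dim in auto)
  moreover have "card {a \<in> {1..i}. j < delete_one w a} \<le> cdim n (L' i \<inter> low_zero n j)"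
    "card {a \<in> {1..i}. sw_col n (delete_one w) a \<le> j} \<le> cdim n (L' i \<inter> std_flag n j)"
    if "i \<le> n" "j \<le> n" for i j
  proof -
    note d = lifted_dims[OF lift \<open>L' \<in> Fl n\<close>]
    have "card {a \<in> {1..i}. j < delete_one w a} \<le> cdim n (L' i \<inter> low_zero n j) \<and>
        card {a \<in> {1..i}. sw_col n (delete_one w) a \<le> j} \<le> cdim n (L' i \<inter> std_flag n j)"
    proof (cases "i \<le> q")
      case True
      then show ?thesis using c1[of i "Suc j"] c2[of i "Suc j"] that d(1,2) card1_low card2_low by simp
    next
      case False
      then show ?thesis
        using c1[of "Suc i" "Suc j"] c2[of "Suc i" "Suc j"] that d(3,4)[of "Suc i"]
          card1_high[of "Suc i"] card2_high[of "Suc i"] by simp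
    qed
    then show "card {a \<in> {1..i}. j < delete_one w a} \<le> cdim n (L' i \<inter> low_zero n j)"
      "card {a \<in> {1..i}. sw_col n (delete_one w) a \<le> j} \<le> cdim n (L' i \<inter> std_flag n j)" by auto
  qed
  ultimately have "L' \<in> richardson_set n (delete_one w)" by (simp add: richardson_set_def)
  then show ?thesis using that lift by blast
qed

text \<open>Away from step \<open>q + 1\<close>, ranks and counts change in the same way. At step
  \<open>q + 1\<close> the first condition is inherited from step \<open>q\<close>, and the second
  is carried over from step \<open>q + 1\<close> of the smaller flag along the graph that nonzero
  \<alpha> provides.\<close>

lemma lift_mat_in_richardson_set:
  assumes A: "A \<in> GL n" and R: "flag_of n A \<in> richardson_set n (delete_one w)"
    and M: "lift_mat n q A \<alpha> \<beta> \<gamma> \<delta> \<in> GL (Suc n)" and \<alpha>: "\<alpha> \<noteq> 0"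
  shows "flag_of (Suc n) (lift_mat n q A \<alpha> \<beta> \<gamma> \<delta>) \<in> richardson_set (Suc n) w"
proof -
  let ?L = "flag_of (Suc n) (lift_mat n q A \<alpha> \<beta> \<gamma> \<delta>)" and ?L' = "flag_of n A"
  note Ac = GL_carrier[OF A]
  have LF: "?L \<in> Fl (Suc n)" by (rule flag_of_in_Fl[OF M])
  have c1: "\<And>i j. i \<le> n \<Longrightarrow> j \<le> n \<Longrightarrow> card {a \<in> {1..i}. j < delete_one w a} \<le> cdim n (?L' i \<inter> low_zero n j)"
    and c2: "\<And>i j. i \<le> n \<Longrightarrow> j \<le> n \<Longrightarrow>
        card {a \<in> {1..i}. sw_col n (delete_one w) a \<le> j} \<le> cdim n (?L' i \<inter> std_flag n j)"
    using R by (auto simp: richardson_set_def)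
  note d = lifted_dims[OF lifted_lift_mat[OF A q_less M] flag_of_in_Fl[OF A]]
  have sub: "csubspace (Suc n) (?L i)" for i by (rule csubspace_flag_of[OF lift_mat_carrier])
  have "card {a \<in> {1..i}. j < w a} \<le> cdim (Suc n) (?L i \<inter> low_zero (Suc n) j)"
    if i: "i \<le> Suc n" and j: "j \<le> Suc n" for i j
  proof (cases j)
    case 0
    have "?L i \<inter> low_zero (Suc n) 0 = ?L i" using csubspaceD(1)[OF sub, of i] by (auto simp: low_zero_def)
    moreover have "card {a \<in> {1..i}. 0 < w a} \<le> card {1..i}" by (intro card_mono) auto
    ultimately show ?thesis using 0 cdim_flag_of[OF M i] by simp
  next
    case (Suc j')
    consider "i \<le> q" | "i = Suc q" | "q + 2 \<le> i" by linarith
    then show ?thesis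
    proof cases
      case 1
      then show ?thesis using c1[of i j'] Suc j q_less d(1) card1_low by simp
    next
      case 2
      have "card {a \<in> {1..i}. j < w a} = card {a \<in> {1..q}. j' < delete_one w a}"
        using card1_high[of i j'] 2 Suc by simp
      also have "\<dots> \<le> cdim (Suc n) (?L q \<inter> low_zero (Suc n) j)"
        using c1[of q j'] Suc j q_less d(1) by simp
      also have "\<dots> \<le> cdim (Suc n) (?L i \<inter> low_zero (Suc n) j)"
        using 2 Fl_mono[OF LF, of q i] by (intro cdim_mono csubspace_Int sub csubspace_low_zero) auto
      finally show ?thesis .
    next
      case 3
      then show ?thesis using c1[of "i - 1" j'] Suc i j d(3) card1_high by simp
    qed
  qed
  moreover have "card {a \<in> {1..i}. sw_col (Suc n) w a \<le> j} \<le> cdim (Suc n) (?L i \<inter> std_flag (Suc n) j)"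
    if i: "i \<le> Suc n" and j: "j \<le> Suc n" for i j
  proof (cases j)
    case 0
    have "sw_col (Suc n) w a \<noteq> 0" if "a \<in> {1..i}" for a
    proof (cases "a = 1")
      case False
      then have "1 \<le> a - 1" using that by auto
      then have "1 \<le> w (a - 1)" by (rule w_pos)
      then show ?thesis using False by (simp add: sw_col_def)
    qed (simp add: sw_col_def)
    then have "{a \<in> {1..i}. sw_col (Suc n) w a \<le> j} = {}" using 0 by blast
    then have "card {a \<in> {1..i}. sw_col (Suc n) w a \<le> j} = 0" by (simp only: card.empty)
    then show ?thesis by linarith
  next
    case (Suc j')
    consider "i \<le> q" | "i = Suc q" | "q + 2 \<le> i" by linarith
    then show ?thesis
    proof cases
      case 1
      then show ?thesis using c2[of i j'] Suc j q_less d(2) card2_low by simp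
    next
      case 2
      obtain Ai where Ai: "Ai \<in> GL n" "A * Ai = 1\<^sub>m n" "Ai * A = 1\<^sub>m n" by (rule GL_inverse[OF A])
      note Aic = GL_carrier[OF Ai(1)]
      define W where "W = ?L' (Suc q) \<inter> std_flag n j'"
      have W: "csubspace n W" unfolding W_def by (intro csubspace_Int csubspace_flag_of[OF Ac] csubspace_std_flag)
      \<comment> \<open>The graph map: \<open>Ai\<close> recovers the coefficients of
        \<open>x\<close> with respect to the columns of \<open>A\<close>, and the one with index
        \<open>q\<close> determines the first coordinate.\<close>
      define f where "f = (\<lambda>x. vCons (\<beta> * (Ai *\<^sub>v x) $ q / \<alpha>) x)"
      have lin: "linear_on n (Suc n) W f"
      proof -
        have "(Ai *\<^sub>v (x + y)) $ q = (Ai *\<^sub>v x) $ q + (Ai *\<^sub>v y) $ q"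
          "(Ai *\<^sub>v (c \<cdot>\<^sub>v x)) $ q = c * (Ai *\<^sub>v x) $ q"
          if "x \<in> carrier_vec n" "y \<in> carrier_vec n" for x y c
          using that Aic q_less
          by (simp_all add: mult_add_distrib_mat_vec[of Ai n n] mult_mat_vec[of Ai n n] del: index_mult_mat_vec)
        then have "f (x + y) = f x + f y" "f (c \<cdot>\<^sub>v x) = c \<cdot>\<^sub>v f x"
          if "x \<in> carrier_vec n" "y \<in> carrier_vec n" for x y c
          using that unfolding f_def
          by (auto simp: vec_index_vCons field_simps add_divide_distrib simp del: index_mult_mat_vec intro!: eq_vecI)
        then show ?thesis using csubspaceD(1)[OF W] by (auto simp: linear_on_def f_def subset_iff)
      qed
      have "card {a \<in> {1..i}. sw_col (Suc n) w a \<le> j} = card {a \<in> {1..i}. sw_col n (delete_one w) a \<le> j'}"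
        using card2_low[of i j'] 2 Suc by simp
      also have "\<dots> \<le> cdim n W" unfolding W_def using c2[of i j'] 2 Suc j q_less by simp
      also have "\<dots> = cdim (Suc n) (f ` W)"
      proof (rule cdim_image[OF W lin, symmetric])
        fix x assume "x \<in> W" "f x = 0\<^sub>v (Suc n)"
        then have "x = tail (0\<^sub>v (Suc n))" unfolding f_def by (metis tail_vCons)
        then show "x = 0\<^sub>v n" by (auto simp: tail_def)
      qed
      also have "\<dots> \<le> cdim (Suc n) (?L i \<inter> std_flag (Suc n) j)"
      proof (intro cdim_mono csubspace_Int sub csubspace_std_flag csubspace_image[OF W lin])
        show "f ` W \<subseteq> ?L i \<inter> std_flag (Suc n) j"
        proof (rule image_subsetI)
          fix x assume x: "x \<in> W"
          then obtain c where c: "c \<in> std_flag n (Suc q)" "x = A *\<^sub>v c"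
            using Ac by (auto simp: W_def flag_of_altdef)
          then have cc: "c \<in> carrier_vec n" by (simp add: std_flag_def)
          have "Ai *\<^sub>v x = (Ai * A) *\<^sub>v c" unfolding c(2) using Aic Ac cc by simp
          then have "Ai *\<^sub>v x = c" using Ai(3) cc by simp
          then have "f x \<in> ?L (Suc q)"
            using vCons_in_flag_of_lift_mat[OF Ac q_less \<alpha> c(1), of \<beta> \<gamma> \<delta>] c(2) by (simp add: f_def)
          moreover have "f x \<in> std_flag (Suc n) j"
            using x Suc by (auto simp: W_def f_def std_flag_def All_less_Suc2)
          ultimately show "f x \<in> ?L i \<inter> std_flag (Suc n) j" using 2 by simp
        qed
      qed
      finally show ?thesis .
    next
      case 3
      then show ?thesis using c2[of "i - 1" j'] Suc i j d(4) card2_high by simp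
    qed
  qed
  ultimately show ?thesis using LF by (simp add: richardson_set_def)
qed

section \<open>Recursive structure of the matrix \<open>A_mat\<close>\<close>

lemma star2_col_skip:
  assumes "i \<in> {1..n}"
  shows "star2_col (Suc n) w (Suc i) = skip (Suc p) (star2_col n (delete_one w) i)"
proof (cases "i = n")
  case True
  then show ?thesis using p_range by (simp add: star2_col_def skip_def)
next
  case False
  define x where "x = Hilbert_Choice.inv (delete_one w) i"
  have x: "delete_one w x = i" unfolding x_def using permutes_inverses(1)[OF delete_one_permutes] .
  have "x \<ge> 1" using permutes_in_image[OF delete_one_permutes, of x] x False assms by auto
  then have "w (skip p x) = Suc i" using delete_one_eq[of x] x by simp
  then have "Hilbert_Choice.inv w (Suc i) = skip p x" using permutes_inverses(2)[OF w] by metis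
  then show ?thesis using False by (simp add: star2_col_def x_def[symmetric] skip_def)
qed

lemma star2_col_one: "star2_col (Suc n) w 1 = Suc p"
  using n by (simp add: star2_col_def p)

lemma star1_col_one: "star1_col (Suc n) w 1 = p"
proof -
  have "{c. 1 \<le> c \<and> c < star2_col (Suc n) w 1 \<and> (\<forall>k\<in>{1..<1}. star2_col (Suc n) w k \<noteq> c)} = {1..p}"
    using star2_col_one by auto
  moreover have "Max {1..p} = p" using p_range by (intro Max_eqI) auto
  ultimately show ?thesis unfolding star1_col_def by metis
qed

text \<open>Column \<open>p + 1\<close> carries the second symbol of row 1 and is excluded for all
  later rows. On the remaining columns the admissible sets correspond, and an increasing renumbering
  commutes with the maximum.\<close>

lemma star1_col_skip:
  assumes i: "i \<in> {1..<n}"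
  shows "star1_col (Suc n) w (Suc i) = skip (Suc p) (star1_col n (delete_one w) i)"
proof -
  let ?S = "\<lambda>m v i. {c. 1 \<le> c \<and> c < star2_col m v i \<and> (\<forall>k\<in>{1..<i}. star2_col m v k \<noteq> c)}"
  have s1: "star2_col n (delete_one w) k \<noteq> 1" if "k \<in> {1..<n}" for k
  proof -
    define x where "x = Hilbert_Choice.inv (delete_one w) k"
    have "delete_one w x = k" unfolding x_def using permutes_inverses(1)[OF delete_one_permutes] .
    then have "x \<ge> 1" using permutes_in_image[OF delete_one_permutes, of x] that by auto
    then show ?thesis using that by (simp add: star2_col_def x_def)
  qed
  have img: "?S (Suc n) w (Suc i) = skip (Suc p) ` ?S n (delete_one w) i"
  proof (intro equalityI subsetI)
    fix c assume c: "c \<in> ?S (Suc n) w (Suc i)"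
    then have "c \<noteq> Suc p" using star2_col_one i by force
    then obtain c' where c': "c = skip (Suc p) c'" using skip_surj by blast
    have "1 \<le> c'" using c c' p_range by (auto simp: skip_def split: if_splits)
    moreover have "c' < star2_col n (delete_one w) i"
      using c c' star2_col_skip[of i] i skip_less by auto
    moreover have "star2_col n (delete_one w) k \<noteq> c'" if k: "k \<in> {1..<i}" for k
      using c c' star2_col_skip[of k] i k by force
    ultimately show "c \<in> skip (Suc p) ` ?S n (delete_one w) i" using c' by blast
  next
    fix c assume "c \<in> skip (Suc p) ` ?S n (delete_one w) i"
    then obtain c' where c': "c = skip (Suc p) c'" "c' \<in> ?S n (delete_one w) i" by blast
    have "star2_col (Suc n) w k \<noteq> c" if k: "k \<in> {1..<Suc i}" for k
    proof (cases "k = 1")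
      case True
      then show ?thesis using star2_col_one c' skip_neq by metis
    next
      case False
      then obtain l where l: "k = Suc l" "l \<in> {1..<i}" using k by (cases k) auto
      then have "star2_col (Suc n) w k = skip (Suc p) (star2_col n (delete_one w) l)"
        using star2_col_skip[of l] i by simp
      then show ?thesis using c' l by (auto simp: skip_inj)
    qed
    moreover have "1 \<le> c" using c' by (auto simp: skip_def)
    moreover have "c < star2_col (Suc n) w (Suc i)" using c' star2_col_skip[of i] i by (simp add: skip_less)
    ultimately show "c \<in> ?S (Suc n) w (Suc i)" by simp
  qed
  have fin: "finite (?S n (delete_one w) i)"
    by (rule finite_subset[of _ "{..<star2_col n (delete_one w) i}"]) auto
  \<comment> \<open>Column 1 receives a second symbol in the last row alone, so it is admissible for
    every earlier row and the maximum is taken over a nonempty set.\<close>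
  have "1 \<in> ?S n (delete_one w) i"
  proof -
    have "star2_col n (delete_one w) i \<ge> 1" by (simp add: star2_col_def)
    then have "1 < star2_col n (delete_one w) i" using s1[of i] i by simp
    moreover have "star2_col n (delete_one w) k \<noteq> 1" if "k \<in> {1..<i}" for k
      by (rule s1) (use that i in auto)
    ultimately show ?thesis by blast
  qed
  then have ne: "?S n (delete_one w) i \<noteq> {}" by blast
  have "mono (skip (Suc p))" by (auto simp: mono_def skip_def)
  then have "skip (Suc p) (Max (?S n (delete_one w) i)) = Max (skip (Suc p) ` ?S n (delete_one w) i)"
    by (rule mono_Max_commute[OF _ fin ne])
  then show ?thesis unfolding star1_col_def img[symmetric] by (rule sym)
qed

text \<open>Row 1 has its symbols in columns \<open>p\<close> and \<open>p + 1\<close>, and column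
  \<open>p + 1\<close> is zero below row 1 because \<open>skip\<close> avoids it. Hence \<alpha> = 1
  and \<gamma> = 0.\<close>

lemma A_mat_lift: "A_mat (Suc n) w a b =
  lift_mat n q (A_mat n (delete_one w) (a \<circ> Suc) (b \<circ> Suc)) 1 (a 1) 0 (b 1)" (is "_ = ?M")
proof (rule eq_matI)
  show "dim_row (A_mat (Suc n) w a b) = dim_row ?M" "dim_col (A_mat (Suc n) w a b) = dim_col ?M"
    by (simp_all add: A_mat_def lift_mat_def)
  fix r s assume "r < dim_row ?M" "s < dim_col ?M"
  then have rs: "r < Suc n" "s < Suc n" by (simp_all add: lift_mat_def)
  show "A_mat (Suc n) w a b $$ (r, s) = ?M $$ (r, s)"
  proof (cases r)
    case 0
    then show ?thesis
      using rs n star2_col_one star1_col_one Suc_q by (auto simp: A_mat_def lift_mat_def Let_def)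
  next
    case (Suc r')
    then have r': "Suc r' \<in> {1..n}" using rs by simp
    have s2: "star2_col (Suc n) w (Suc r) = skip (Suc p) (star2_col n (delete_one w) r)"
      using star2_col_skip[OF r'] Suc by simp
    have s1: "star1_col (Suc n) w (Suc r) = skip (Suc p) (star1_col n (delete_one w) r)" if "r < n"
      using star1_col_skip[of r] Suc that by simp
    show ?thesis
    proof (cases "s = p")
      case True
      have "A_mat (Suc n) w a b $$ (r, s) = 0"
      proof -
        have "star2_col (Suc n) w (Suc r) \<noteq> Suc s" unfolding s2 True by (rule skip_neq)
        moreover have "star1_col (Suc n) w (Suc r) \<noteq> Suc s" if "r < n"
          unfolding s1[OF that] True by (rule skip_neq)
        ultimately show ?thesis using rs by (simp add: A_mat_def Let_def) metis
      qed
      then show ?thesis using True Suc rs Suc_q by (simp add: lift_mat_def)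
    next
      case False
      define s' where "s' = (if s < p then s else s - 1)"
      have s': "Suc s = skip (Suc p) (Suc s')" "s' < n"
        using False rs p_range by (auto simp: s'_def skip_def)
      have "A_mat (Suc n) w a b $$ (r, s) = A_mat n (delete_one w) (a \<circ> Suc) (b \<circ> Suc) $$ (r', s')"
      proof -
        have "Suc s = star2_col (Suc n) w (Suc r) \<longleftrightarrow> Suc s' = star2_col n (delete_one w) r"
          unfolding s2 s'(1) by (rule skip_inj)
        moreover have "Suc s = star1_col (Suc n) w (Suc r) \<longleftrightarrow> Suc s' = star1_col n (delete_one w) r" if "r < n"
          unfolding s1[OF that] s'(1) by (rule skip_inj)
        ultimately show ?thesis using rs s'(2) Suc by (cases "r < n") (simp_all add: A_mat_def Let_def)
      qed
      moreover have "?M $$ (r, s) = A_mat n (delete_one w) (a \<circ> Suc) (b \<circ> Suc) $$ (r', s')"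
        using False rs Suc Suc_q by (auto simp: lift_mat_def s'_def)
      ultimately show ?thesis by simp
    qed
  qed
qed

end

section \<open>Density of the torus orbit\<close>

text \<open>Each step of the recursion is a lift with \<alpha> = 1 and determinant
  \<open>b 1\<close>; the induction starts at \<open>n = 1\<close>, where there is a single
  flag.\<close>

lemma A_mat_in_richardson_set:
  assumes "n \<ge> 1" "w permutes {1..n-1}" "\<forall>i\<in>{1..n-1}. a i \<noteq> 0" "\<forall>i\<in>{1..n}. b i \<noteq> 0"
  shows "A_mat n w a b \<in> GL n \<and> flag_of n (A_mat n w a b) \<in> richardson_set n w"
  using assms
proof (induction n arbitrary: w a b rule: nat_induct_at_least)
  case base
  have A: "A_mat 1 w a b = mat 1 1 (\<lambda>_. b 1)"
    by (rule eq_matI) (auto simp: A_mat_def star2_col_def)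
  have "det (mat 1 1 (\<lambda>_. b 1)) = b 1" by (subst det_single) auto
  then have GL: "A_mat 1 w a b \<in> GL 1" using base unfolding A by (simp add: GL_iff_det)
  have F: "flag_of 1 (A_mat 1 w a b) \<in> Fl 1" by (rule flag_of_in_Fl[OF GL])
  have "w = id" using base by simp
  have "card {a \<in> {1..i}. j < w a} \<le> cdim 1 (flag_of 1 (A_mat 1 w a b) i \<inter> low_zero 1 j)"
    "card {a \<in> {1..i}. sw_col 1 w a \<le> j} \<le> cdim 1 (flag_of 1 (A_mat 1 w a b) i \<inter> std_flag 1 j)"
    if "i \<le> 1" "j \<le> 1" for i j
  proof -
    have "i = 0 \<or> i = 1 \<and> j = 0 \<or> i = 1 \<and> j = 1" using that by arith
    then consider "i = 0" | "i = 1" "j = 0" | "i = 1" "j = 1" by blast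
    then have "card {a \<in> {1..i}. j < w a} \<le> cdim 1 (flag_of 1 (A_mat 1 w a b) i \<inter> low_zero 1 j) \<and>
      card {a \<in> {1..i}. sw_col 1 w a \<le> j} \<le> cdim 1 (flag_of 1 (A_mat 1 w a b) i \<inter> std_flag 1 j)"
    proof cases
      case 2
      have full: "carrier_vec 1 \<inter> low_zero 1 0 = (carrier_vec 1 :: complex vec set)" by (auto simp: low_zero_def)
      have "{a \<in> {1..1}. 0 < w a} = {1}" "{a \<in> {1..1}. sw_col 1 w a \<le> 0} = {}"
        using \<open>w = id\<close> by (auto simp: sw_col_def)
      then have "card {a \<in> {1..1}. 0 < w a} = 1" "card {a \<in> {1..1}. sw_col 1 w a \<le> 0} = 0" by (simp_all only:) simp_all
      moreover have "flag_of 1 (A_mat 1 w a b) 1 = carrier_vec 1" by (rule FlD(4)[OF F order_refl])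
      ultimately show ?thesis unfolding 2 using full cdim_carrier[of 1] by presburger
    next
      case 3
      have full: "carrier_vec 1 \<inter> std_flag 1 1 = (carrier_vec 1 :: complex vec set)" by (auto simp: std_flag_def)
      have "{a \<in> {1..1}. 1 < w a} = {}" "{a \<in> {1..1}. sw_col 1 w a \<le> 1} = {1}"
        using \<open>w = id\<close> by (auto simp: sw_col_def)
      then have "card {a \<in> {1..1}. 1 < w a} = 0" "card {a \<in> {1..1}. sw_col 1 w a \<le> 1} = 1" by (simp_all only:) simp_all
      moreover have "flag_of 1 (A_mat 1 w a b) 1 = carrier_vec 1" by (rule FlD(4)[OF F order_refl])
      ultimately show ?thesis unfolding 3 using full cdim_carrier[of 1] by presburger
    qed simp
    then show "card {a \<in> {1..i}. j < w a} \<le> cdim 1 (flag_of 1 (A_mat 1 w a b) i \<inter> low_zero 1 j)"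
      "card {a \<in> {1..i}. sw_col 1 w a \<le> j} \<le> cdim 1 (flag_of 1 (A_mat 1 w a b) i \<inter> std_flag 1 j)" by auto
  qed
  then show ?case using GL F by (simp add: richardson_set_def)
next
  case (Suc n)
  have w: "w permutes {1..n}" using Suc.prems(1) by simp
  note ctx = Suc.hyps w refl refl
  let ?q = "Hilbert_Choice.inv w 1 - 1"
  let ?A = "A_mat n (delete_one w) (a \<circ> Suc) (b \<circ> Suc)"
  have IH: "?A \<in> GL n \<and> flag_of n ?A \<in> richardson_set n (delete_one w)"
    using Suc.prems by (intro Suc.IH delete_one_permutes[OF ctx]) auto
  have b1: "b 1 \<noteq> 0" using Suc.prems by auto
  have M: "lift_mat n ?q ?A 1 (a 1) 0 (b 1) \<in> GL (Suc n)"
    using IH b1 by (intro lift_mat_GL q_less[OF ctx]) auto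
  show ?case
    unfolding A_mat_lift[OF ctx]
    using M lift_mat_in_richardson_set[OF ctx _ _ M] IH by auto
qed

text \<open>Along a line of matrices a polynomial function becomes a univariate polynomial, which
  has finitely many roots unless it is zero.\<close>

lemma poly_curve: "fun_algebra (\<lambda>F. \<exists>p. \<forall>s. F s = poly p (s :: complex))"
proof
  show "\<exists>p. \<forall>s. c = poly p s" for c :: complex by (rule exI[of _ "[:c:]"]) simp
  fix f g :: "complex \<Rightarrow> complex"
  assume "\<exists>p. \<forall>s. f s = poly p s" "\<exists>p. \<forall>s. g s = poly p s"
  then obtain p q where "\<forall>s. f s = poly p s" "\<forall>s. g s = poly q s" by blast
  then show "\<exists>p. \<forall>s. f s + g s = poly p s" "\<exists>p. \<forall>s. f s * g s = poly p s"
    by (auto intro: exI[of _ "p + q"] exI[of _ "p * q"])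
qed

text \<open>Over the flag of \<open>B\<close> the fibre is a projective line with coordinates \<open>\<alpha>\<close>, \<open>\<beta>\<close>; moving
  both away from zero, and then moving \<open>B\<close> by induction, leads into the torus orbit.\<close>

lemma torus_orbit_dense:
  assumes "n \<ge> 1" "w permutes {1..n-1}" "\<forall>i\<in>{1..n-1}. a i \<noteq> 0" "\<forall>i\<in>{1..n}. b i \<noteq> 0"
    and "A \<in> GL n" "flag_of n A \<in> richardson_set n w" "polynomial_fun n r" "r A \<noteq> 0"
  shows "\<exists>B. B \<in> GL n \<and> r B \<noteq> 0 \<and> flag_of n B \<in> torus_orbit n (flag_of n (A_mat n w a b))"
  using assms
proof (induction n arbitrary: w a b A r rule: nat_induct_at_least)
  case base
  have GL: "A_mat 1 w a b \<in> GL 1" using A_mat_in_richardson_set[of 1 w a b] base by auto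
  have "flag_of 1 A i = flag_of 1 (A_mat 1 w a b) i" for i
    using FlD(3,4)[OF flag_of_in_Fl[OF base(4)]] FlD(3,4)[OF flag_of_in_Fl[OF GL]] by (cases "i = 0") auto
  then have "flag_of 1 A = flag_of 1 (A_mat 1 w a b)" by blast
  moreover have "mat_diag 1 (\<lambda>_. 1) * A_mat 1 w a b = A_mat 1 w a b"
    using GL_carrier[OF GL] by simp
  then have "flag_of 1 (A_mat 1 w a b) = torus_act 1 (\<lambda>_. 1) (flag_of 1 (A_mat 1 w a b))"
    using torus_act_flag_of[OF GL_carrier[OF GL], of "\<lambda>_. 1"] by simp
  then have "flag_of 1 (A_mat 1 w a b) \<in> torus_orbit 1 (flag_of 1 (A_mat 1 w a b))"
    unfolding torus_orbit_def by (intro CollectI exI[of _ "\<lambda>_. 1"]) simp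
  ultimately show ?case using base(4,7) by auto
next
  case (Suc n)
  have w: "w permutes {1..n}" using Suc.prems(1) by simp
  note ctx = Suc.hyps w refl refl
  let ?q = "Hilbert_Choice.inv w 1 - 1"
  note q = q_less[OF ctx]
  let ?A = "A_mat n (delete_one w) (a \<circ> Suc) (b \<circ> Suc)"
  note A = Suc.prems(4)
  have w': "delete_one w permutes {1..n-1}" by (rule delete_one_permutes[OF ctx])
  have ab: "\<forall>i\<in>{1..n-1}. (a \<circ> Suc) i \<noteq> 0" "\<forall>i\<in>{1..n}. (b \<circ> Suc) i \<noteq> 0" "a 1 \<noteq> 0" "b 1 \<noteq> 0"
    using Suc.prems(2,3) Suc.hyps by auto
  have A': "?A \<in> GL n" by (rule A_mat_in_richardson_set[OF Suc.hyps w' ab(1,2), THEN conjunct1])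
  obtain L' where L': "L' \<in> richardson_set n (delete_one w)" "lifted n ?q (flag_of (Suc n) A) L'"
    using richardson_set_lifted[OF ctx Suc.prems(5)] by blast
  then have "L' \<in> Fl n" by (simp add: richardson_set_def)
  then obtain B0 where B0: "B0 \<in> GL n" "flag_of n B0 = L'" by (rule Fl_flag_of)
  obtain \<alpha> \<beta> \<gamma> \<delta> where M0: "lift_mat n ?q B0 \<alpha> \<beta> \<gamma> \<delta> \<in> GL (Suc n)"
      "flag_of (Suc n) (lift_mat n ?q B0 \<alpha> \<beta> \<gamma> \<delta>) = flag_of (Suc n) A"
    using lifted_eq_lift_mat[OF flag_of_in_Fl[OF A] B0(1) q] L'(2) B0(2) by metis
  let ?M0 = "lift_mat n ?q B0 \<alpha> \<beta> \<gamma> \<delta>"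
  obtain T where T: "T \<in> GL (Suc n)" "upper_triangular T" "A = ?M0 * T"
    using flag_of_eqE[OF M0(1) A M0(2)] by blast
  \<comment> \<open>\<open>A\<close> need not have the shape of a lift. The upper triangular
    correction \<open>T\<close> is absorbed into the polynomial, with multiplication by
    \<open>T\<close> written out in entries.\<close>
  define m where "m = (\<lambda>X. mat (Suc n) (Suc n) (\<lambda>(i, j). \<Sum>k<Suc n. X $$ (i, k) * T $$ (k, j)))"
  have m: "m X = X * T" if "X \<in> carrier_mat (Suc n) (Suc n)" for X
    unfolding m_def using GL_carrier[OF T(1)] that
    by (intro eq_matI) (auto simp: scalar_prod_def atLeast0LessThan intro!: sum.cong)
  define coord where "coord = (\<lambda>M. mat (Suc n) (Suc n) (\<lambda>(i, j). M $$ (i, j)) :: complex mat)"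
  have coord: "coord M = M" if "M \<in> carrier_mat (Suc n) (Suc n)" for M
    using that by (auto simp: coord_def intro!: eq_matI)
  \<comment> \<open>The determinant makes invertibility part of the nonvanishing condition, so that
    it survives both perturbations.\<close>
  define r1 where "r1 = (\<lambda>X. r (m X) * det (coord X))"
  have r1: "polynomial_fun (Suc n) r1"
    unfolding r1_def
  proof (rule poly.mult)
    show "polynomial_fun (Suc n) (\<lambda>X. r (m X))"
      unfolding m_def by (rule poly.subst[OF Suc.prems(6)]) (use GL_carrier[OF T(1)] in \<open>simp add: poly_entry_mult del: sum.lessThan_Suc\<close>)
    have "poly.mats (Suc n) (Suc n) (Suc n) coord"
      unfolding coord_def by (intro poly.mats_mat polynomial_fun.entry)
    then show "polynomial_fun (Suc n) (\<lambda>X. det (coord X))" by (rule poly.det)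
  qed
  have r1D: "r1 X \<noteq> 0 \<longleftrightarrow> X \<in> GL (Suc n) \<and> r (X * T) \<noteq> 0" if "X \<in> carrier_mat (Suc n) (Suc n)" for X
    using that by (auto simp: r1_def m coord GL_iff_det)
  have r1M0: "r1 ?M0 \<noteq> 0" using r1D[OF lift_mat_carrier] M0(1) T(3) Suc.prems(7) by auto
  \<comment> \<open>A common shift moves \<alpha> and \<beta> off zero. The polynomial is nonzero at
    shift 0, so all but finitely many shifts are allowed.\<close>
  obtain s where s: "r1 (lift_mat n ?q B0 (\<alpha> + s) (\<beta> + s) \<gamma> \<delta>) \<noteq> 0" "\<alpha> + s \<noteq> 0" "\<beta> + s \<noteq> 0"
  proof -
    interpret c: fun_algebra "\<lambda>F. \<exists>p. \<forall>s. F s = poly p (s :: complex)" by (rule poly_curve)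
    have lin: "\<exists>p. \<forall>s. x + s = poly p (s :: complex)" for x by (rule exI[of _ "[:x, 1:]"]) simp
    have "\<exists>p. \<forall>s. r1 (lift_mat n ?q B0 (\<alpha> + s) (\<beta> + s) \<gamma> \<delta>) = poly p s"
    proof (rule c.subst[OF r1])
      fix i j assume "i < Suc n" "j < Suc n"
      then have e: "lift_mat n ?q B0 (\<alpha> + s) (\<beta> + s) \<gamma> \<delta> $$ (i, j) =
          (if j = ?q then if i = 0 then \<beta> + s else (\<alpha> + s) * B0 $$ (i - 1, ?q)
           else lift_mat n ?q B0 0 0 \<gamma> \<delta> $$ (i, j))" for s
        by (simp add: lift_mat_def)
      show "\<exists>p. \<forall>s. lift_mat n ?q B0 (\<alpha> + s) (\<beta> + s) \<gamma> \<delta> $$ (i, j) = poly p s"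
        unfolding e
        by (cases "j = ?q"; cases "i = 0") (simp_all add: lin c.const c.mult[OF lin c.const])
    qed
    then obtain p where p: "\<And>s. r1 (lift_mat n ?q B0 (\<alpha> + s) (\<beta> + s) \<gamma> \<delta>) = poly p s" by blast
    have "poly p 0 \<noteq> 0" using r1M0 p[of 0] by simp
    then have "p \<noteq> 0" by auto
    then have "finite ({s. poly p s = 0} \<union> {- \<alpha>, - \<beta>})" by (simp add: poly_roots_finite)
    then obtain s where "s \<notin> {s. poly p s = 0} \<union> {- \<alpha>, - \<beta>}"
      using ex_new_if_finite[OF infinite_UNIV_char_0] by blast
    then have s: "poly p s \<noteq> 0" "s \<noteq> - \<alpha>" "s \<noteq> - \<beta>" by auto
    show ?thesis
    proof (rule that)
      show "\<alpha> + s \<noteq> 0" "\<beta> + s \<noteq> 0"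
        using s(2,3) by (simp_all add: eq_neg_iff_add_eq_0 add.commute)
    qed (use p s(1) in simp)
  qed
  \<comment> \<open>With the point on the projective line fixed, the condition is polynomial in the
    smaller matrix and fits the induction hypothesis.\<close>
  define r2 where "r2 = (\<lambda>B. r1 (lift_mat n ?q B (\<alpha> + s) (\<beta> + s) \<gamma> \<delta>))"
  have r2: "polynomial_fun n r2"
    unfolding r2_def
  proof (rule poly.subst[OF r1])
    fix i j assume ij: "i < Suc n" "j < Suc n"
    have ent: "polynomial_fun n (\<lambda>B. B $$ (k, l))" if "k < n" "l < n" for k l
      using that by (rule polynomial_fun.entry)
    consider "i = 0" | "i > 0" "j < ?q" | "i > 0" "j = ?q" | "i > 0" "j = Suc ?q" | "i > 0" "j > Suc ?q" by linarith
    then show "polynomial_fun n (\<lambda>B. lift_mat n ?q B (\<alpha> + s) (\<beta> + s) \<gamma> \<delta> $$ (i, j))"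
    proof cases
      case 1
      then show ?thesis using ij poly.const by (simp add: lift_mat_def)
    next
      case 2
      then show ?thesis using ij q ent[of "i - 1" j] by (simp add: lift_mat_def)
    next
      case 3
      then show ?thesis using ij q poly.cmult[OF ent[of "i - 1" j], of "\<alpha> + s"] by (simp add: lift_mat_def)
    next
      case 4
      then show ?thesis using ij q poly.cmult[OF ent[of "i - 1" ?q], of \<gamma>] by (simp add: lift_mat_def)
    next
      case 5
      then show ?thesis using ij ent[of "i - 1" "j - 1"] by (simp add: lift_mat_def)
    qed
  qed
  have "r2 B0 \<noteq> 0" using s(1) by (simp add: r2_def)
  then obtain B where B: "B \<in> GL n" "r2 B \<noteq> 0" "flag_of n B \<in> torus_orbit n (flag_of n ?A)"
    using Suc.IH[OF w' ab(1,2) B0(1) _ r2] L'(1) B0(2) by blast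
  let ?M = "lift_mat n ?q B (\<alpha> + s) (\<beta> + s) \<gamma> \<delta>"
  have M: "?M \<in> GL (Suc n)" "r (?M * T) \<noteq> 0"
    using B(2) r1D[OF lift_mat_carrier] by (auto simp: r2_def)
  have "flag_of (Suc n) ?M \<in> torus_orbit (Suc n) (flag_of (Suc n) (A_mat (Suc n) w a b))"
    unfolding A_mat_lift[OF ctx] by (rule lift_mat_orbit[OF A' B(1) q B(3) M(1) s(2,3) ab(3,4)])
  then show ?case
    using M GL_mult[OF M(1) T(1)] flag_of_mult_upper[OF M(1) T(1,2)] by (intro exI[of _ "?M * T"]) simp
qed

theorem theorem6p0p1:
  fixes n :: nat and w :: "nat \<Rightarrow> nat" and a b :: "nat \<Rightarrow> complex"
  assumes "n \<ge> 2"
    and "w permutes {1..n-1}"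
    and "\<forall>i\<in>{1..n-1}. a i \<noteq> 0"
    and "\<forall>i\<in>{1..n}. b i \<noteq> 0"
  shows "same_subscheme n
           (reduced_subscheme n (Z_orbit_closure n w a b))
           (Richardson n (F_flag n) (iota n w) (F'_flag n) (iota_bar n (w0 n \<circ> w)))"
proof -
  let ?S1 = "Schubert n (F_flag n) (iota n w)" and ?S2 = "Schubert n (F'_flag n) (iota_bar n (w0 n \<circ> w))"
  let ?A = "A_mat n w a b"
  let ?orbit = "torus_orbit n (flag_of n ?A)"
  have n: "n \<ge> 1" using assms(1) by simp
  have R: "?S1 \<inter> ?S2 = richardson_set n w" by (rule Richardson_eq_richardson_set[OF n assms(2)])
  have A: "?A \<in> GL n" "flag_of n ?A \<in> ?S1 \<inter> ?S2"
    using A_mat_in_richardson_set[OF n assms(2-4)] R by auto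
  have orbit: "?orbit \<subseteq> ?S1 \<inter> ?S2"
  proof
    fix L assume "L \<in> ?orbit"
    then obtain t where t: "\<forall>i<n. t i \<noteq> 0" "L = flag_of n (mat_diag n t * ?A)"
      using torus_act_flag_of[OF GL_carrier[OF A(1)]] by (auto simp: torus_orbit_def)
    have "mat_diag n t \<in> GL n" "lower_triangular n (mat_diag n t)" "upper_triangular (mat_diag n t)"
      using t(1) by (auto simp: mat_diag_GL) (auto simp: mat_diag_def lower_triangular_def upper_triangular_def)
    then show "L \<in> ?S1 \<inter> ?S2"
      unfolding t(2) using A Schubert_F_stable[OF A(1)] Schubert_F'_stable[OF A(1)] by blast
  qed
  have closure: "?S1 \<inter> ?S2 \<subseteq> Z_orbit_closure n w a b"
  proof
    fix L assume L: "L \<in> ?S1 \<inter> ?S2"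
    then have "L \<in> Fl n" by (simp add: Schubert_def)
    then obtain M where M: "M \<in> GL n" "flag_of n M = L" by (rule Fl_flag_of)
    have meet: "\<exists>K. K \<in> ?orbit \<and> K \<in> W" if "L \<in> W" "openin (Fl_zariski n) W" for W
    proof -
      have "openin (GL_zariski n) {B \<in> GL n. flag_of n B \<in> W}" "M \<in> {B \<in> GL n. flag_of n B \<in> W}"
        using that M by (auto simp: openin_Fl_zariski)
      then obtain r where r: "polynomial_fun n r" "r M \<noteq> 0" "{B \<in> GL n. r B \<noteq> 0} \<subseteq> {B \<in> GL n. flag_of n B \<in> W}"
        unfolding openin_GL_zariski by blast
      obtain B where "B \<in> GL n" "r B \<noteq> 0" "flag_of n B \<in> ?orbit"
        using torus_orbit_dense[OF n assms(2-4) M(1) _ r(1,2)] M(2) L R by blast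
      then show ?thesis using r(3) by blast
    qed
    \<comment> \<open>The constant polynomial 1 shows that the set of all flags of invertible
      matrices is open, so \<open>L\<close> is a point of the space.\<close>
    have "openin (Fl_zariski n) (flag_of n ` {A \<in> GL n. 1 \<noteq> (0 :: complex)})"
      by (rule openin_Fl_zariski_image[OF poly.const])
    moreover have "L \<in> flag_of n ` {A \<in> GL n. 1 \<noteq> (0 :: complex)}" using M by auto
    ultimately have "L \<in> topspace (Fl_zariski n)" using openin_subset by blast
    then show "L \<in> Z_orbit_closure n w a b"
      unfolding Z_orbit_closure_def in_closure_of using meet by blast
  qed
  have "reduced_subscheme n (Z_orbit_closure n w a b) U = reduced_subscheme n (?S1 \<inter> ?S2) U"
    if U: "openin (Fl_zariski n) U" for U
  proof (intro equalityI subsetI)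
    fix f assume "f \<in> reduced_subscheme n (Z_orbit_closure n w a b) U"
    then show "f \<in> reduced_subscheme n (?S1 \<inter> ?S2) U"
      using closure unfolding reduced_subscheme_def by blast
  next
    fix f assume f: "f \<in> reduced_subscheme n (?S1 \<inter> ?S2) U"
    then have fr: "f \<in> regular_funs n U" and f0: "\<And>K. K \<in> U \<Longrightarrow> K \<in> ?orbit \<Longrightarrow> f K = 0"
      using orbit unfolding reduced_subscheme_def by blast+
    \<comment> \<open>In place of closedness of the intersection, openness of nonvanishing loci is
      used: vanishing on the orbit propagates to its closure.\<close>
    have "f L = 0" if "L \<in> U \<inter> Z_orbit_closure n w a b" for L
      using regular_fun_vanishes_on_closure[OF U fr f0] that unfolding Z_orbit_closure_def by blast
    then show "f \<in> reduced_subscheme n (Z_orbit_closure n w a b) U"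
      using f unfolding reduced_subscheme_def by blast
  qed
  moreover have "same_subscheme n (reduced_subscheme n (?S1 \<inter> ?S2))
      (scheme_inter n (reduced_subscheme n ?S1) (reduced_subscheme n ?S2))"
    by (rule reduced_subscheme_eq_inter) (fact Schubert_F_stable Schubert_F'_stable)+
  ultimately show ?thesis unfolding same_subscheme_def Richardson_def by simp
qed

end
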